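(* Let $(M,\varphi)$ be a co-calibrated $G_2$ manifold, i.e. $d{*\varphi}=0$, and suppose that the curvature $R$ of the characteristic connection $\nabla$ is a $G_2$-instanton. Then the torsion 3-form $T$ of $\nabla$ is parallel with respect to the characteristic connection, $\nabla T=0$.
   Context: Manifolds are smooth. A $G_2$ manifold $(M,\varphi)$ is a 7-manifold with a 3-form $\varphi$ that near each point can be written, in a local coframe $e_1,\dots,e_7$, as $\varphi=e_{127}+e_{135}-e_{146}-e_{236}-e_{245}+e_{347}+e_{567}$, where $e_{ijk}=e_i\wedge e_j\wedge e_k$. It induces the metric $g$ and orientation for which such coframes are oriented orthonormal; $*$ is the Hodge star, $(\cdot,\cdot)$ the induced scalar product on forms. Indices refer to a local orthonormal frame, and repeated indices are summed. On a co-calibrated $G_2$ manifold there is a unique linear connection $\nabla$ (the characteristic connection) with $\nabla g=0$, $\nabla\varphi=0$ and totally skew-symmetric torsion, i.e. $T(X,Y,Z)=g(\nabla_XY-\nabla_YX-[X,Y],Z)$ is a 3-form; explicitly $T=-*d\varphi+\frac16(d\varphi,*\varphi)\varphi$. Curvature: $R(X,Y)Z=[\nabla_X,\nabla_Y]Z-\nabla_{[X,Y]}Z$, $R(X,Y,Z,V)=g(R(X,Y)Z,V)$. $R$ is a $G_2$-instanton if $R_{abij}\varphi_{abk}=0$ for all $i,j,k$, i.e. the curvature 2-form lies in $\mathfrak g_2\cong\{\alpha\in\Lambda^2: *(\alpha\wedge\varphi)=-\alpha\}$; equivalently (since $\nabla\varphi=0$) $R\in\mathfrak g_2\otimes\mathfrak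 g_2$. *)

theory Defs
  imports "HOL-Analysis.Analysis" "HOL-Combinatorics.Permutations"
begin

section \<open>Smooth maps between Euclidean spaces\<close>

text \<open>Only meaningful for open \<open>S\<close>; all uses below are on open sets.\<close>

primrec Ck_on :: "nat \<Rightarrow> ('a::euclidean_space \<Rightarrow> 'b::real_normed_vector) \<Rightarrow> 'a set \<Rightarrow> bool" where
  "Ck_on 0 f S \<longleftrightarrow> continuous_on S f"
| "Ck_on (Suc k) f S \<longleftrightarrow> (\<forall>x\<in>S. f differentiable (at x)) \<and>
     (\<forall>b\<in>Basis. Ck_on k (\<lambda>x. frechet_derivative f (at x) b) S)"

definition smooth_on :: "'a set \<Rightarrow> ('a::euclidean_space \<Rightarrow> 'b::real_normed_vector) \<Rightarrow> bool" where
  "smooth_on S f \<longleftrightarrow> (\<forall>k. Ck_on k f S)"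

section \<open>Smooth manifolds, tangent vectors and vector fields\<close>

text \<open>The manifold is the whole of a Hausdorff second countable type \<open>'m\<close>; an atlas is a set of
  charts (domain, coordinate map).\<close>

type_synonym ('m, 'n) chart = "'m set \<times> ('m \<Rightarrow> real^'n)"

definition inv_chart :: "('m, 'n) chart \<Rightarrow> real^'n \<Rightarrow> 'm" where
  "inv_chart c = inv_into (fst c) (snd c)"

definition smooth_atlas :: "('m::{t2_space,second_countable_topology}, 'n::finite) chart set \<Rightarrow> bool" where
  "smooth_atlas A \<longleftrightarrow>
     (\<Union>c\<in>A. fst c) = UNIV \<and>
     (\<forall>c\<in>A. open (fst c) \<and> open (snd c ` fst c) \<and>
        homeomorphism (fst c) (snd c ` fst c) (snd c) (inv_chart c)) \<and>
     (\<forall>c\<in>A. \<forall>d\<in>A. smooth_on (snd c ` (fst c \<inter> fst d)) (snd d \<circ> inv_chart c))"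

definition smooth_fun :: "('m, 'n::finite) chart set \<Rightarrow> ('m \<Rightarrow> real) \<Rightarrow> bool" where
  "smooth_fun A f \<longleftrightarrow> (\<forall>c\<in>A. smooth_on (snd c ` fst c) (f \<circ> inv_chart c))"

text \<open>A tangent vector at \<open>p\<close> is represented by its component vector in one fixed chart
  \<open>chart_at A p\<close> around \<open>p\<close>, so that every tangent space is a copy of \<open>real^'n\<close>. As the fixed chart
  varies with \<open>p\<close>, the components in an arbitrary chart \<open>c\<close> are obtained with the differential of the
  coordinate change: \<open>to_chart\<close> is the differential of \<open>c\<close> at \<open>p\<close>, \<open>from_chart\<close> its inverse.\<close>

definition chart_at :: "('m, 'n) chart set \<Rightarrow> 'm \<Rightarrow> ('m, 'n) chart" where
  "chart_at A p = (SOME c. c \<in> A \<and> p \<in> fst c)"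

definition to_chart :: "('m, 'n::finite) chart set \<Rightarrow> ('m, 'n) chart \<Rightarrow> 'm \<Rightarrow> real^'n \<Rightarrow> real^'n" where
  "to_chart A c p v =
     frechet_derivative (snd c \<circ> inv_chart (chart_at A p)) (at (snd (chart_at A p) p)) v"

definition from_chart :: "('m, 'n::finite) chart set \<Rightarrow> ('m, 'n) chart \<Rightarrow> 'm \<Rightarrow> real^'n \<Rightarrow> real^'n" where
  "from_chart A c p w =
     frechet_derivative (snd (chart_at A p) \<circ> inv_chart c) (at (snd c p)) w"

type_synonym ('m, 'n) vfield = "'m \<Rightarrow> real^'n"

definition vf_rep :: "('m, 'n::finite) chart set \<Rightarrow> ('m, 'n) chart \<Rightarrow> ('m, 'n) vfield \<Rightarrow> real^'n \<Rightarrow> real^'n" where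
  "vf_rep A c X x = to_chart A c (inv_chart c x) (X (inv_chart c x))"

definition smooth_vf :: "('m, 'n::finite) chart set \<Rightarrow> ('m, 'n) vfield \<Rightarrow> bool" where
  "smooth_vf A X \<longleftrightarrow> (\<forall>c\<in>A. smooth_on (snd c ` fst c) (vf_rep A c X))"

definition vf_apply :: "('m, 'n::finite) chart set \<Rightarrow> ('m, 'n) vfield \<Rightarrow> ('m \<Rightarrow> real) \<Rightarrow> 'm \<Rightarrow> real" where
  "vf_apply A X f p =
     frechet_derivative (f \<circ> inv_chart (chart_at A p)) (at (snd (chart_at A p) p)) (X p)"

definition lie_bracket ::
  "('m, 'n::finite) chart set \<Rightarrow> ('m, 'n) vfield \<Rightarrow> ('m, 'n) vfield \<Rightarrow> ('m, 'n) vfield" where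
  "lie_bracket A X Y p = (let c = chart_at A p; x = snd c p in
     frechet_derivative (vf_rep A c Y) (at x) (X p)
     - frechet_derivative (vf_rep A c X) (at x) (Y p))"

section \<open>Covariant tensors and differential forms\<close>

text \<open>The value at \<open>p\<close> of a covariant \<open>k\<close>-tensor is a function of lists of \<open>k\<close> tangent vectors;
  its values on lists of other lengths are irrelevant.\<close>

type_synonym ('m, 'n) tensor = "'m \<Rightarrow> (real^'n) list \<Rightarrow> real"

definition form_rep :: "('m, 'n::finite) chart set \<Rightarrow> ('m, 'n) chart \<Rightarrow> ('m, 'n) tensor \<Rightarrow>
    real^'n \<Rightarrow> (real^'n) list \<Rightarrow> real" where
  "form_rep A c \<omega> x ws = \<omega> (inv_chart c x) (map (from_chart A c (inv_chart c x)) ws)"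

definition smooth_form :: "('m, 'n::finite) chart set \<Rightarrow> 'm set \<Rightarrow> nat \<Rightarrow> ('m, 'n) tensor \<Rightarrow> bool" where
  "smooth_form A U k \<omega> \<longleftrightarrow>
     (\<forall>p\<in>U. \<forall>vs. length vs = k \<longrightarrow>
        (\<forall>i<k. linear (\<lambda>v. \<omega> p (vs[i := v]))) \<and>
        (\<forall>i<k. \<forall>j<k. i \<noteq> j \<and> vs ! i = vs ! j \<longrightarrow> \<omega> p vs = 0)) \<and>
     (\<forall>c\<in>A. \<forall>ws. length ws = k \<longrightarrow>
        smooth_on (snd c ` (fst c \<inter> U)) (\<lambda>x. form_rep A c \<omega> x ws))"

definition wedge1 :: "('m, 'n) tensor list \<Rightarrow> ('m, 'n) tensor" where
  "wedge1 \<alpha>s p vs = (\<Sum>\<pi> | \<pi> permutes {..<length \<alpha>s}.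
     of_int (sign \<pi>) * (\<Prod>j<length \<alpha>s. (\<alpha>s ! j) p [vs ! \<pi> j]))"

text \<open>\<open>(d\<omega>)(v\<^sub>0,\<dots>,v\<^sub>k) = \<Sum>\<^sub>i (-1)\<^sup>i (\<partial>\<omega>/\<partial>v\<^sub>i)(v\<^sub>0,\<dots>,v\<^sub>i\<^sub>-\<^sub>1,v\<^sub>i\<^sub>+\<^sub>1,\<dots>,v\<^sub>k)\<close>, computed in the fixed chart
  at \<open>p\<close>.\<close>

definition ext_deriv :: "('m, 'n::finite) chart set \<Rightarrow> ('m, 'n) tensor \<Rightarrow> ('m, 'n) tensor" where
  "ext_deriv A \<omega> p vs = (let c = chart_at A p in
     \<Sum>i<length vs. (-1)^i *
       frechet_derivative (\<lambda>x. form_rep A c \<omega> x (take i vs @ drop (Suc i) vs))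
         (at (snd c p)) (vs ! i))"

text \<open>The orientation is carried by the oriented volume form \<open>vol\<close>. The Hodge star is
  \<open>(*\<alpha>)\<^sub>j\<^sub>\<dots> = 1/k! \<alpha>\<^sup>i\<^sup>\<dots> vol\<^sub>i\<^sub>\<dots>\<^sub>j\<^sub>\<dots>\<close> with indices raised by the inverse metric, i.e.
  \<open>*(e\<^sub>1\<and>\<dots>\<and>e\<^sub>k) = e\<^sub>k\<^sub>+\<^sub>1\<and>\<dots>\<and>e\<^sub>n\<close> for oriented orthonormal coframes.\<close>

definition inv_metric :: "('m, 'n::finite) tensor \<Rightarrow> 'm \<Rightarrow> real^'n^'n" where
  "inv_metric g p = matrix_inv (\<chi> i j. g p [axis i 1, axis j 1])"

definition hodge :: "('m, 'n::finite) tensor \<Rightarrow> ('m, 'n) tensor \<Rightarrow> nat \<Rightarrow> ('m, 'n) tensor \<Rightarrow> ('m, 'n) tensor" where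
  "hodge g vol k \<alpha> p vs = 1 / fact k *
     (\<Sum>is | length is = k. \<Sum>js | length js = k.
        (\<Prod>m<k. inv_metric g p $ (is ! m) $ (js ! m)) *
        \<alpha> p (map (\<lambda>i. axis i 1) is) * vol p (map (\<lambda>j. axis j 1) js @ vs))"

section \<open>Linear connections, torsion and curvature\<close>

type_synonym ('m, 'n) conn = "('m, 'n) vfield \<Rightarrow> ('m, 'n) vfield \<Rightarrow> ('m, 'n) vfield"

definition linear_connection :: "('m, 'n::finite) chart set \<Rightarrow> ('m, 'n) conn \<Rightarrow> bool" where
  "linear_connection A D \<longleftrightarrow>
     (\<forall>X Y. smooth_vf A X \<and> smooth_vf A Y \<longrightarrow> smooth_vf A (D X Y)) \<and>
     (\<forall>X X' Y. smooth_vf A X \<and> smooth_vf A X' \<and> smooth_vf A Y \<longrightarrow>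
        D (\<lambda>p. X p + X' p) Y = (\<lambda>p. D X Y p + D X' Y p)) \<and>
     (\<forall>f X Y. smooth_fun A f \<and> smooth_vf A X \<and> smooth_vf A Y \<longrightarrow>
        D (\<lambda>p. f p *\<^sub>R X p) Y = (\<lambda>p. f p *\<^sub>R D X Y p)) \<and>
     (\<forall>X Y Y'. smooth_vf A X \<and> smooth_vf A Y \<and> smooth_vf A Y' \<longrightarrow>
        D X (\<lambda>p. Y p + Y' p) = (\<lambda>p. D X Y p + D X Y' p)) \<and>
     (\<forall>f X Y. smooth_fun A f \<and> smooth_vf A X \<and> smooth_vf A Y \<longrightarrow>
        D X (\<lambda>p. f p *\<^sub>R Y p) = (\<lambda>p. vf_apply A X f p *\<^sub>R Y p + f p *\<^sub>R D X Y p))"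

text \<open>Tensor fields as maps on lists of vector fields, and their covariant derivative
  \<open>(\<nabla>\<^sub>X S)(Y\<^sub>1,\<dots>,Y\<^sub>k) = X (S (Y\<^sub>1,\<dots>,Y\<^sub>k)) - \<Sum>\<^sub>i S (Y\<^sub>1,\<dots>,\<nabla>\<^sub>X Y\<^sub>i,\<dots>,Y\<^sub>k)\<close>.\<close>

definition on_fields :: "('m, 'n) tensor \<Rightarrow> ('m, 'n) vfield list \<Rightarrow> 'm \<Rightarrow> real" where
  "on_fields \<omega> Ys p = \<omega> p (map (\<lambda>Y. Y p) Ys)"

definition cov_deriv :: "('m, 'n::finite) chart set \<Rightarrow> ('m, 'n) conn \<Rightarrow>
    (('m, 'n) vfield list \<Rightarrow> 'm \<Rightarrow> real) \<Rightarrow> ('m, 'n) vfield \<Rightarrow> ('m, 'n) vfield list \<Rightarrow> 'm \<Rightarrow> real" where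
  "cov_deriv A D S X Ys p =
     vf_apply A X (S Ys) p - (\<Sum>i<length Ys. S (Ys[i := D X (Ys ! i)]) p)"

definition parallel :: "('m, 'n::finite) chart set \<Rightarrow> ('m, 'n) conn \<Rightarrow> nat \<Rightarrow>
    (('m, 'n) vfield list \<Rightarrow> 'm \<Rightarrow> real) \<Rightarrow> bool" where
  "parallel A D k S \<longleftrightarrow>
     (\<forall>X Ys p. smooth_vf A X \<and> length Ys = k \<and> (\<forall>Y\<in>set Ys. smooth_vf A Y) \<longrightarrow>
        cov_deriv A D S X Ys p = 0)"

definition torsion :: "('m, 'n::finite) chart set \<Rightarrow> ('m, 'n) tensor \<Rightarrow> ('m, 'n) conn \<Rightarrow>
    ('m, 'n) vfield list \<Rightarrow> 'm \<Rightarrow> real" where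
  "torsion A g D Ys p = (let X = Ys ! 0; Y = Ys ! 1; Z = Ys ! 2 in
     g p [D X Y p - D Y X p - lie_bracket A X Y p, Z p])"

definition curvature :: "('m, 'n::finite) chart set \<Rightarrow> ('m, 'n) tensor \<Rightarrow> ('m, 'n) conn \<Rightarrow>
    ('m, 'n) vfield \<Rightarrow> ('m, 'n) vfield \<Rightarrow> ('m, 'n) vfield \<Rightarrow> ('m, 'n) vfield \<Rightarrow> 'm \<Rightarrow> real" where
  "curvature A g D X Y Z V p =
     g p [D X (D Y Z) p - D Y (D X Z) p - D (lie_bracket A X Y) Z p, V p]"

section \<open>\<open>G\<^sub>2\<close> structures\<close>

definition coframe_on :: "('m, 'n::finite) chart set \<Rightarrow> 'm set \<Rightarrow> ('n \<Rightarrow> ('m, 'n) tensor) \<Rightarrow> bool" where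
  "coframe_on A U e \<longleftrightarrow>
     (\<forall>i. smooth_form A U 1 (e i)) \<and>
     (\<forall>p\<in>U. \<forall>a. (\<forall>v. (\<Sum>i\<in>UNIV. a i * e i p [v]) = 0) \<longrightarrow> (\<forall>i. a i = 0))"

text \<open>Frame indices are the elements \<open>1, \<dots>, 7\<close> of the numeral type \<open>7\<close> (in which \<open>7 = 0\<close>).\<close>

definition g2_model :: "(7 \<Rightarrow> ('m, 7) tensor) \<Rightarrow> ('m, 7) tensor" where
  "g2_model e p vs =
     wedge1 [e 1, e 2, e 7] p vs + wedge1 [e 1, e 3, e 5] p vs - wedge1 [e 1, e 4, e 6] p vs
     - wedge1 [e 2, e 3, e 6] p vs - wedge1 [e 2, e 4, e 5] p vs
     + wedge1 [e 3, e 4, e 7] p vs + wedge1 [e 5, e 6, e 7] p vs"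

definition adapted_coframe ::
  "('m::topological_space, 7) chart set \<Rightarrow> ('m, 7) tensor \<Rightarrow> 'm set \<Rightarrow> (7 \<Rightarrow> ('m, 7) tensor) \<Rightarrow> bool" where
  "adapted_coframe A \<phi> U e \<longleftrightarrow> open U \<and> coframe_on A U e \<and>
     (\<forall>p\<in>U. \<forall>vs. length vs = 3 \<longrightarrow> \<phi> p vs = g2_model e p vs)"

definition g2_manifold :: "('m::{t2_space,second_countable_topology}, 7) chart set \<Rightarrow> ('m, 7) tensor \<Rightarrow> bool" where
  "g2_manifold A \<phi> \<longleftrightarrow> smooth_atlas A \<and> smooth_form A UNIV 3 \<phi> \<and>
     (\<forall>p. \<exists>U e. p \<in> U \<and> adapted_coframe A \<phi> U e)"

text \<open>The metric and the oriented volume form induced by \<open>\<phi>\<close>: those for which every adapted coframe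
  is oriented orthonormal. They exist and are unique because the stabilizer of the model form lies in
  \<open>SO(7)\<close>.\<close>

definition induced_metric :: "('m::topological_space, 7) chart set \<Rightarrow> ('m, 7) tensor \<Rightarrow> ('m, 7) tensor \<Rightarrow> bool" where
  "induced_metric A \<phi> g \<longleftrightarrow>
     (\<forall>U e. adapted_coframe A \<phi> U e \<longrightarrow>
        (\<forall>p\<in>U. \<forall>u v. g p [u, v] = (\<Sum>i\<in>UNIV. e i p [u] * e i p [v])))"

definition induced_volume :: "('m::topological_space, 7) chart set \<Rightarrow> ('m, 7) tensor \<Rightarrow> ('m, 7) tensor \<Rightarrow> bool" where
  "induced_volume A \<phi> vol \<longleftrightarrow>
     (\<forall>U e. adapted_coframe A \<phi> U e \<longrightarrow>
        (\<forall>p\<in>U. \<forall>vs. length vs = 7 \<longrightarrow>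
           vol p vs = wedge1 [e 1, e 2, e 3, e 4, e 5, e 6, e 7] p vs))"

definition cocalibrated ::
  "('m, 7) chart set \<Rightarrow> ('m, 7) tensor \<Rightarrow> ('m, 7) tensor \<Rightarrow> ('m, 7) tensor \<Rightarrow> bool" where
  "cocalibrated A \<phi> g vol \<longleftrightarrow>
     (\<forall>p vs. length vs = 5 \<longrightarrow> ext_deriv A (hodge g vol 3 \<phi>) p vs = 0)"

definition characteristic_connection ::
  "('m, 7) chart set \<Rightarrow> ('m, 7) tensor \<Rightarrow> ('m, 7) tensor \<Rightarrow> ('m, 7) conn \<Rightarrow> bool" where
  "characteristic_connection A \<phi> g D \<longleftrightarrow>
     linear_connection A D \<and>
     parallel A D 2 (on_fields g) \<and>
     parallel A D 3 (on_fields \<phi>) \<and>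
     (\<exists>\<tau>. smooth_form A UNIV 3 \<tau> \<and>
        (\<forall>Ys p. length Ys = 3 \<and> (\<forall>Y\<in>set Ys. smooth_vf A Y) \<longrightarrow>
           torsion A g D Ys p = on_fields \<tau> Ys p))"

text \<open>\<open>R\<^sub>a\<^sub>b\<^sub>i\<^sub>j \<phi>\<^sub>a\<^sub>b\<^sub>k = 0\<close> in every local orthonormal frame. Connections act on global vector fields
  here, so a local orthonormal frame is given by global fields that are orthonormal near the point
  (cutting off shows that every local frame is of this kind on a smaller neighbourhood).\<close>

definition g2_instanton ::
  "('m::topological_space, 7) chart set \<Rightarrow> ('m, 7) tensor \<Rightarrow> ('m, 7) tensor \<Rightarrow> ('m, 7) conn \<Rightarrow> bool" where
  "g2_instanton A \<phi> g D \<longleftrightarrow>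
     (\<forall>U E. open U \<and> (\<forall>a. smooth_vf A (E a)) \<and>
        (\<forall>p\<in>U. \<forall>a b. g p [E a p, E b p] = (if a = b then 1 else 0)) \<longrightarrow>
        (\<forall>p\<in>U. \<forall>i j k.
           (\<Sum>a\<in>UNIV. \<Sum>b\<in>UNIV.
              curvature A g D (E a) (E b) (E i) (E j) p * \<phi> p [E a p, E b p, E (k::7) p]) = 0))"

end

theory Submission
  imports Defs
begin

text \<open>Put \<open>S\<^sub>l\<^sub>m = T\<^sub>l\<^sub>a\<^sub>b \<phi>\<^sub>a\<^sub>b\<^sub>m\<close>, which determines \<open>T\<close> and is symmetric because \<open>\<phi>\<close> is cocalibrated. By the
  first Bianchi identity \<open>2 (R\<^sub>i\<^sub>j\<^sub>k\<^sub>l - R\<^sub>k\<^sub>l\<^sub>i\<^sub>j)\<close> is an alternating sum of components of \<open>\<nabla>T\<close>. Contraction with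
  \<open>\<phi>\<^sub>i\<^sub>j\<^sub>m\<close> kills both curvature terms, one by the instanton condition and one because \<open>\<nabla>\<phi> = 0\<close>, and leaves
  \<open>2 \<phi>\<^sub>i\<^sub>j\<^sub>m \<nabla>\<^sub>i T\<^sub>j\<^sub>k\<^sub>l = \<nabla>\<^sub>k S\<^sub>l\<^sub>m - \<nabla>\<^sub>l S\<^sub>k\<^sub>m\<close>. Pointwise linear algebra turns this into: \<open>\<nabla>S\<close> is totally symmetric
  and trace-free. In the Ricci identity for \<open>\<nabla>\<nabla>S\<close>, contracted with \<open>\<phi>\<close>, the curvature drops out again, and
  what remains yields \<open>S\<^sub>s\<^sub>m \<nabla>\<^sub>s S\<^sub>k\<^sub>m = 0\<close> and \<open>S\<^sub>k\<^sub>l \<nabla>\<^sub>i \<nabla>\<^sub>i S\<^sub>k\<^sub>l = 0\<close>. The divergence of the first equation is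
  then \<open>\<bar>\<nabla>S\<bar>\<^sup>2 = 0\<close>, so \<open>\<nabla>S = 0\<close> and hence \<open>\<nabla>T = 0\<close>.\<close>

text \<open>The map from \<open>T\<close> to \<open>S\<close> is equivariant and injective. Among
  the G2 components of a 3-form, of dimension 1, 7 and 27, the 7 is the skew part of
  \<open>S\<close>, which cocalibration removes; the symmetric part carries 1 and 27. The pair
  symmetry of \<open>R\<close> fails by an expression in \<open>\<nabla>T\<close>, so the two
  vanishing contractions of \<open>R\<close> are separate facts: one index pair lies in
  \<open>g2\<close> by hypothesis, the other because the connection forms do. Comparing them is what
  constrains \<open>\<nabla>T\<close>. Passing to \<open>S\<close> pays off because total symmetry
  of \<open>\<nabla>S\<close> allows the indices in contractions of \<open>\<nabla>\<nabla>S\<close>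
  to be rearranged; the final identity is pointwise and takes the place of an integration by parts.
  Representation theory is replaced by linear systems in the components of an adapted frame, cut
  into blocks by a grading of the model form. Frames are local while connections act on global
  fields, so the tensor calculus is done abstractly in a locale and cutoffs connect it with the
  manifold.\<close>

abbreviation sum_UNIV :: "('i \<Rightarrow> 'b::comm_monoid_add) \<Rightarrow> 'b" (binder "SUM " 10) where
  "sum_UNIV f \<equiv> sum f UNIV"

section \<open>Algebra of the model three-form\<close>

lemma exhaust_7:
  fixes x :: 7
  shows "x = 1 \<or> x = 2 \<or> x = 3 \<or> x = 4 \<or> x = 5 \<or> x = 6 \<or> x = 7"
proof (induct x)
  case (of_int z)
  then have "0 \<le> z" and "z < 7" by simp_all
  then have "z = 0 \<or> z = 1 \<or> z = 2 \<or> z = 3 \<or> z = 4 \<or> z = 5 \<or> z = 6" by arith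
  then show ?case by auto
qed

lemma UNIV_7: "(UNIV :: 7 set) = {1, 2, 3, 4, 5, 6, 7}"
  using exhaust_7 by auto

lemma forall_7: "(\<forall>i::7. P i) \<longleftrightarrow> P 1 \<and> P 2 \<and> P 3 \<and> P 4 \<and> P 5 \<and> P 6 \<and> P 7"
  by (metis exhaust_7)

lemma sum_7: "(SUM i::7. f i) = f 1 + f 2 + f 3 + f 4 + f 5 + f 6 + f (7::7)"
  unfolding UNIV_7 by (simp add: add.assoc)

definition kdelta :: "'i \<Rightarrow> 'i \<Rightarrow> real" where
  "kdelta i j = (if i = j then 1 else 0)"

definition wedge3 :: "'i \<Rightarrow> 'i \<Rightarrow> 'i \<Rightarrow> 'i \<Rightarrow> 'i \<Rightarrow> 'i \<Rightarrow> real" where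
  "wedge3 a b c i j k =
     kdelta a i * kdelta b j * kdelta c k + kdelta a j * kdelta b k * kdelta c i
   + kdelta a k * kdelta b i * kdelta c j - kdelta a j * kdelta b i * kdelta c k
   - kdelta a i * kdelta b k * kdelta c j - kdelta a k * kdelta b j * kdelta c i"

text \<open>The structure constants of the seven-dimensional cross product on the imaginary
  octonions, and the components of \<open>\<phi>\<close> in an adapted frame.\<close>

definition phi0 :: "7 \<Rightarrow> 7 \<Rightarrow> 7 \<Rightarrow> real" where
  "phi0 i j k = wedge3 1 2 7 i j k + wedge3 1 3 5 i j k - wedge3 1 4 6 i j k
     - wedge3 2 3 6 i j k - wedge3 2 4 5 i j k + wedge3 3 4 7 i j k + wedge3 5 6 7 i j k"

lemma wedge3_skew12: "wedge3 a b c j i k = - wedge3 a b c i j k"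
  and wedge3_skew23: "wedge3 a b c i k j = - wedge3 a b c i j k"
  by (simp_all add: wedge3_def algebra_simps)

lemma phi0_skew12: "phi0 j i k = - phi0 i j k"
  and phi0_skew23: "phi0 i k j = - phi0 i j k"
  by (simp_all add: phi0_def wedge3_skew12[of _ _ _ j i] wedge3_skew23[of _ _ _ i k j])

lemma sum_kdelta: "(SUM i::'i::finite. kdelta a i * f i) = f a"
  by (simp add: kdelta_def if_distrib[of "\<lambda>x. x * _"] cong: if_cong)

lemma wedge3_contract:
  "(SUM m::'i::finite. wedge3 a b c i j m * f m) =
     (kdelta a i * kdelta b j - kdelta a j * kdelta b i) * f c
   + (kdelta b i * kdelta c j - kdelta b j * kdelta c i) * f a
   + (kdelta c i * kdelta a j - kdelta c j * kdelta a i) * f b"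
proof -
  have "(SUM m. wedge3 a b c i j m * f m) =
     (kdelta a i * kdelta b j - kdelta a j * kdelta b i) * (SUM m. kdelta c m * f m)
   + (kdelta b i * kdelta c j - kdelta b j * kdelta c i) * (SUM m. kdelta a m * f m)
   + (kdelta c i * kdelta a j - kdelta c j * kdelta a i) * (SUM m. kdelta b m * f m)"
    unfolding sum_distrib_left sum.distrib[symmetric]
    by (rule sum.cong) (auto simp: wedge3_def algebra_simps)
  then show ?thesis by (simp add: sum_kdelta)
qed

text \<open>Only the seven lines of \<open>phi0\<close> contribute, each through skew differences of
  \<open>f\<close>. For a numeral \<open>m\<close> three of them survive, which keeps the linear
  systems below sparse.\<close>

lemma phi0_sum_first:
  "(SUM i j. phi0 i j m * f i j) =
   (let w = (\<lambda>a b c. kdelta c m * (f a b - f b a) + kdelta a m * (f b c - f c b)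
     + kdelta b m * (f c a - f a c))
   in w 1 2 7 + w 1 3 5 - w 1 4 6 - w 2 3 6 - w 2 4 5 + w 3 4 7 + w 5 6 7)"
proof -
  have w: "(SUM i j. wedge3 a b c i j m * f i j) =
    kdelta c m * (f a b - f b a) + kdelta a m * (f b c - f c b) + kdelta b m * (f c a - f a c)"
    for a b c :: 7
  proof -
    have cyc: "wedge3 a b c i j m = wedge3 a b c m i j" for i j
      by (simp add: wedge3_def)
    have "(SUM i j. wedge3 a b c i j m * f i j) =
      (SUM i. kdelta a i * (kdelta c m * f i b - kdelta b m * f i c)
        + kdelta b i * (kdelta a m * f i c - kdelta c m * f i a)
        + kdelta c i * (kdelta b m * f i a - kdelta a m * f i b))"
      unfolding cyc wedge3_contract by (rule sum.cong) (auto simp: algebra_simps)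
    also have "\<dots> = kdelta c m * (f a b - f b a) + kdelta a m * (f b c - f c b)
        + kdelta b m * (f c a - f a c)"
      by (simp add: sum.distrib sum_kdelta) (simp add: algebra_simps)
    finally show ?thesis .
  qed
  show ?thesis
    unfolding phi0_def
    by (simp only: w distrib_right left_diff_distrib sum.distrib sum_subtractf Let_def)
qed

lemma phi0_table:
  shows "phi0 1 1 m = 0" and "phi0 1 2 m = kdelta 7 m" and "phi0 1 3 m = kdelta 5 m"
  and "phi0 1 4 m = - kdelta 6 m" and "phi0 1 5 m = - kdelta 3 m" and "phi0 1 6 m = kdelta 4 m"
  and "phi0 1 7 m = - kdelta 2 m" and "phi0 2 1 m = - kdelta 7 m" and "phi0 2 2 m = 0"
  and "phi0 2 3 m = - kdelta 6 m" and "phi0 2 4 m = - kdelta 5 m" and "phi0 2 5 m = kdelta 4 m"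
  and "phi0 2 6 m = kdelta 3 m" and "phi0 2 7 m = kdelta 1 m" and "phi0 3 1 m = - kdelta 5 m"
  and "phi0 3 2 m = kdelta 6 m" and "phi0 3 3 m = 0" and "phi0 3 4 m = kdelta 7 m"
  and "phi0 3 5 m = kdelta 1 m" and "phi0 3 6 m = - kdelta 2 m" and "phi0 3 7 m = - kdelta 4 m"
  and "phi0 4 1 m = kdelta 6 m" and "phi0 4 2 m = kdelta 5 m" and "phi0 4 3 m = - kdelta 7 m"
  and "phi0 4 4 m = 0" and "phi0 4 5 m = - kdelta 2 m" and "phi0 4 6 m = - kdelta 1 m"
  and "phi0 4 7 m = kdelta 3 m" and "phi0 5 1 m = kdelta 3 m" and "phi0 5 2 m = - kdelta 4 m"
  and "phi0 5 3 m = - kdelta 1 m" and "phi0 5 4 m = kdelta 2 m" and "phi0 5 5 m = 0"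
  and "phi0 5 6 m = kdelta 7 m" and "phi0 5 7 m = - kdelta 6 m" and "phi0 6 1 m = - kdelta 4 m"
  and "phi0 6 2 m = - kdelta 3 m" and "phi0 6 3 m = kdelta 2 m" and "phi0 6 4 m = kdelta 1 m"
  and "phi0 6 5 m = - kdelta 7 m" and "phi0 6 6 m = 0" and "phi0 6 7 m = kdelta 5 m"
  and "phi0 7 1 m = kdelta 2 m" and "phi0 7 2 m = - kdelta 1 m" and "phi0 7 3 m = kdelta 4 m"
  and "phi0 7 4 m = - kdelta 3 m" and "phi0 7 5 m = kdelta 6 m" and "phi0 7 6 m = - kdelta 5 m"
  and "phi0 7 7 m = 0"
  by (simp_all add: phi0_def wedge3_def kdelta_def)

text \<open>A single contraction is \<open>\<delta>\<^sub>i\<^sub>k \<delta>\<^sub>j\<^sub>p -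
  \<delta>\<^sub>i\<^sub>p \<delta>\<^sub>j\<^sub>k\<close> up to a component of the dual 4-form.
  Symmetrizing in \<open>j\<close> and \<open>k\<close> cancels the 4-form.\<close>

lemma phi0_contract:
  "(SUM m. phi0 i j m * phi0 k p m) + (SUM m. phi0 i k m * phi0 j p m) =
   kdelta i k * kdelta j p + kdelta i j * kdelta k p - 2 * (kdelta i p * kdelta j k)"
proof -
  have c: "(SUM m. - kdelta a m * f m) = - f a" for a :: 7 and f :: "7 \<Rightarrow> real"
    by (simp add: sum_negf sum_kdelta)
  have "\<forall>i j. \<forall>k p. (SUM m. phi0 i j m * phi0 k p m) + (SUM m. phi0 i k m * phi0 j p m) =
   kdelta i k * kdelta j p + kdelta i j * kdelta k p - 2 * (kdelta i p * kdelta j k)"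
    unfolding forall_7 phi0_table c sum_kdelta
    by (simp add: phi0_table kdelta_def c sum_kdelta)
  then show ?thesis by blast
qed

lemma phi0_sum_first_simps:
  fixes f :: "7 \<Rightarrow> 7 \<Rightarrow> real"
  shows
    "(SUM i j. phi0 i j 1 * f i j) =
      (f 2 7 - f 7 2) + (f 3 5 - f 5 3) - (f 4 6 - f 6 4)"
    "(SUM i j. phi0 i j 2 * f i j) =
      -(f 1 7 - f 7 1) - (f 3 6 - f 6 3) - (f 4 5 - f 5 4)"
    "(SUM i j. phi0 i j 3 * f i j) =
      -(f 1 5 - f 5 1) + (f 2 6 - f 6 2) + (f 4 7 - f 7 4)"
    "(SUM i j. phi0 i j 4 * f i j) =
      (f 1 6 - f 6 1) + (f 2 5 - f 5 2) - (f 3 7 - f 7 3)"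
    "(SUM i j. phi0 i j 5 * f i j) =
      (f 1 3 - f 3 1) - (f 2 4 - f 4 2) + (f 6 7 - f 7 6)"
    "(SUM i j. phi0 i j 6 * f i j) =
      -(f 1 4 - f 4 1) - (f 2 3 - f 3 2) - (f 5 7 - f 7 5)"
    "(SUM i j. phi0 i j 7 * f i j) =
      (f 1 2 - f 2 1) + (f 3 4 - f 4 3) + (f 5 6 - f 6 5)"
  by (simp_all add: phi0_sum_first kdelta_def Let_def)

text \<open>The equations are listed for descending index pairs only: as rewrite rules they
  terminate and leave every skew component with its indices in ascending order.\<close>

lemma skew_sorted:
  fixes f :: "7 \<Rightarrow> 7 \<Rightarrow> real"
  assumes "\<And>i j. f j i = - f i j"
  shows "f i i = 0"
    and
    "f 2 1 = - f 1 2" "f 3 1 = - f 1 3" "f 4 1 = - f 1 4" "f 5 1 = - f 1 5" "f 6 1 = - f 1 6"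
    "f 7 1 = - f 1 7" "f 3 2 = - f 2 3" "f 4 2 = - f 2 4" "f 5 2 = - f 2 5" "f 6 2 = - f 2 6"
    "f 7 2 = - f 2 7" "f 4 3 = - f 3 4" "f 5 3 = - f 3 5" "f 6 3 = - f 3 6" "f 7 3 = - f 3 7"
    "f 5 4 = - f 4 5" "f 6 4 = - f 4 6" "f 7 4 = - f 4 7" "f 6 5 = - f 5 6" "f 7 5 = - f 5 7"
    "f 7 6 = - f 6 7"
proof -
  show "f i i = 0" using assms[of i i] by simp
qed (rule assms)+

text \<open>\<open>x\<close> stands for \<open>\<nabla>T\<close> and \<open>X\<close> for
  \<open>\<nabla>S\<close> at a point. The hypotheses are linear in the 7 x 35 independent
  components of \<open>x\<close>, so the claim is a statement about one finite linear
  system.\<close>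

lemma skew_torsion_linear:
  fixes x :: "7 \<Rightarrow> 7 \<Rightarrow> 7 \<Rightarrow> 7 \<Rightarrow> real"
  defines "X \<equiv> \<lambda>i l m. SUM a b. phi0 a b m * x i l a b"
  assumes skew: "\<And>i j k l. x i k j l = - x i j k l" "\<And>i j k l. x i j l k = - x i j k l"
    and sym: "\<And>i l m. X i m l = X i l m"
    and H: "\<And>k l m. 2 * (SUM i j. phi0 i j m * x i j k l) = X k l m - X l k m"
  shows "X k l m = X l k m" and "(SUM l. X k l l) = 0"
proof -
  note rules = X_def phi0_sum_first_simps skew_sorted[of "\<lambda>j k. x i j k l" for i l, OF skew(1)]
    skew_sorted[of "\<lambda>k l. x i j k l" for i j, OF skew(2)]
  text \<open>The terms of \<open>phi0\<close> are the lines of the Fano plane, so \<open>phi0\<close> is homogeneous of degree 0 when the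
    indices are the nonzero elements of \<open>(\<int>/2)\<^sup>3\<close>. The system therefore splits into eight blocks
    according to the degree of \<open>(k, l, m)\<close>.\<close>
  have g0:
    "X 1 2 7 = X 2 1 7 \<and> X 1 3 5 = X 3 1 5 \<and> X 1 4 6 = X 4 1 6 \<and>
    X 1 5 3 = X 5 1 3 \<and> X 1 6 4 = X 6 1 4 \<and> X 1 7 2 = X 7 1 2 \<and>
    X 2 3 6 = X 3 2 6 \<and> X 2 4 5 = X 4 2 5 \<and> X 2 5 4 = X 5 2 4 \<and>
    X 2 6 3 = X 6 2 3 \<and> X 2 7 1 = X 7 2 1 \<and> X 3 4 7 = X 4 3 7 \<and>
    X 3 5 1 = X 5 3 1 \<and> X 3 6 2 = X 6 3 2 \<and> X 3 7 4 = X 7 3 4 \<and>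
    X 4 5 2 = X 5 4 2 \<and> X 4 6 1 = X 6 4 1 \<and> X 4 7 3 = X 7 4 3 \<and>
    X 5 6 7 = X 6 5 7 \<and> X 5 7 6 = X 7 5 6 \<and> X 6 7 5 = X 7 6 5"
    using
      sym[of 1 2 7] sym[of 1 3 5] sym[of 1 4 6] sym[of 2 1 7] sym[of 2 3 6] sym[of 2 4 5]
      sym[of 3 1 5] sym[of 3 2 6] sym[of 3 4 7] sym[of 4 1 6] sym[of 4 2 5] sym[of 4 3 7]
      sym[of 5 1 3] sym[of 5 2 4] sym[of 5 6 7] sym[of 6 1 4] sym[of 6 2 3] sym[of 6 5 7]
      sym[of 7 1 2] sym[of 7 3 4] sym[of 7 5 6] H[of 7 1 2] H[of 5 1 3] H[of 6 1 4] H[of 3 1 5]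
      H[of 4 1 6] H[of 2 1 7] H[of 6 2 3] H[of 5 2 4] H[of 4 2 5] H[of 3 2 6] H[of 1 2 7]
      H[of 7 3 4] H[of 1 3 5] H[of 2 3 6] H[of 4 3 7] H[of 2 4 5] H[of 1 4 6] H[of 3 4 7]
      H[of 7 5 6] H[of 6 5 7] H[of 5 6 7]
    unfolding rules by (intro conjI; algebra)
  \<comment> \<open>The frame indices 1, 2, 7, 3, 5, 6, 4 have the degrees 1 to 7 in binary, which
    is the order of the blocks. The trace of \<open>X k l l\<close> over \<open>l\<close> has the
    degree of \<open>k\<close> and so belongs to the block of that index; the block of degree 0
    contains no trace.\<close>
  have g1:
    "X 1 2 2 = X 2 1 2 \<and> X 1 3 3 = X 3 1 3 \<and> X 1 4 4 = X 4 1 4 \<and>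
    X 1 5 5 = X 5 1 5 \<and> X 1 6 6 = X 6 1 6 \<and> X 1 7 7 = X 7 1 7 \<and>
    X 2 3 4 = X 3 2 4 \<and> X 2 4 3 = X 4 2 3 \<and> X 2 5 6 = X 5 2 6 \<and>
    X 2 6 5 = X 6 2 5 \<and> X 3 4 2 = X 4 3 2 \<and> X 3 6 7 = X 6 3 7 \<and>
    X 3 7 6 = X 7 3 6 \<and> X 4 5 7 = X 5 4 7 \<and> X 4 7 5 = X 7 4 5 \<and>
    X 5 6 2 = X 6 5 2 \<and> X 5 7 4 = X 7 5 4 \<and> X 6 7 3 = X 7 6 3 \<and>
    X 1 1 1 + X 1 2 2 + X 1 3 3 + X 1 4 4 + X 1 5 5 + X 1 6 6 + X 1 7 7 = 0"
    using
      sym[of 2 1 2] sym[of 2 3 4] sym[of 2 5 6] sym[of 3 1 3] sym[of 3 2 4] sym[of 3 6 7]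
      sym[of 4 1 4] sym[of 4 2 3] sym[of 4 5 7] sym[of 5 1 5] sym[of 5 2 6] sym[of 5 4 7]
      sym[of 6 1 6] sym[of 6 2 5] sym[of 6 3 7] sym[of 7 1 7] sym[of 7 3 6] sym[of 7 4 5]
      H[of 2 1 2] H[of 3 1 3] H[of 4 1 4] H[of 5 1 5] H[of 6 1 6] H[of 7 1 7] H[of 4 2 3]
      H[of 3 2 4] H[of 6 2 5] H[of 5 2 6] H[of 2 3 4] H[of 7 3 6] H[of 6 3 7] H[of 7 4 5]
      H[of 5 4 7] H[of 2 5 6] H[of 4 5 7] H[of 3 6 7]
    unfolding rules by (intro conjI; algebra)
  have g2:
    "X 1 2 1 = X 2 1 1 \<and> X 1 3 4 = X 3 1 4 \<and> X 1 4 3 = X 4 1 3 \<and>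
    X 1 5 6 = X 5 1 6 \<and> X 1 6 5 = X 6 1 5 \<and> X 2 3 3 = X 3 2 3 \<and>
    X 2 4 4 = X 4 2 4 \<and> X 2 5 5 = X 5 2 5 \<and> X 2 6 6 = X 6 2 6 \<and>
    X 2 7 7 = X 7 2 7 \<and> X 3 4 1 = X 4 3 1 \<and> X 3 5 7 = X 5 3 7 \<and>
    X 3 7 5 = X 7 3 5 \<and> X 4 6 7 = X 6 4 7 \<and> X 4 7 6 = X 7 4 6 \<and>
    X 5 6 1 = X 6 5 1 \<and> X 5 7 3 = X 7 5 3 \<and> X 6 7 4 = X 7 6 4 \<and>
    X 2 1 1 + X 2 2 2 + X 2 3 3 + X 2 4 4 + X 2 5 5 + X 2 6 6 + X 2 7 7 = 0"
    using
      sym[of 1 1 2] sym[of 1 3 4] sym[of 1 5 6] sym[of 3 1 4] sym[of 3 2 3] sym[of 3 5 7]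
      sym[of 4 1 3] sym[of 4 2 4] sym[of 4 6 7] sym[of 5 1 6] sym[of 5 2 5] sym[of 5 3 7]
      sym[of 6 1 5] sym[of 6 2 6] sym[of 6 4 7] sym[of 7 2 7] sym[of 7 3 5] sym[of 7 4 6]
      H[of 1 1 2] H[of 4 1 3] H[of 3 1 4] H[of 6 1 5] H[of 5 1 6] H[of 3 2 3] H[of 4 2 4]
      H[of 5 2 5] H[of 6 2 6] H[of 7 2 7] H[of 1 3 4] H[of 7 3 5] H[of 5 3 7] H[of 7 4 6]
      H[of 6 4 7] H[of 1 5 6] H[of 3 5 7] H[of 4 6 7]
    unfolding rules by (intro conjI; algebra)
  have g3:
    "X 1 3 6 = X 3 1 6 \<and> X 1 4 5 = X 4 1 5 \<and> X 1 5 4 = X 5 1 4 \<and>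
    X 1 6 3 = X 6 1 3 \<and> X 1 7 1 = X 7 1 1 \<and> X 2 3 5 = X 3 2 5 \<and>
    X 2 4 6 = X 4 2 6 \<and> X 2 5 3 = X 5 2 3 \<and> X 2 6 4 = X 6 2 4 \<and>
    X 2 7 2 = X 7 2 2 \<and> X 3 5 2 = X 5 3 2 \<and> X 3 6 1 = X 6 3 1 \<and>
    X 3 7 3 = X 7 3 3 \<and> X 4 5 1 = X 5 4 1 \<and> X 4 6 2 = X 6 4 2 \<and>
    X 4 7 4 = X 7 4 4 \<and> X 5 7 5 = X 7 5 5 \<and> X 6 7 6 = X 7 6 6 \<and>
    X 7 1 1 + X 7 2 2 + X 7 3 3 + X 7 4 4 + X 7 5 5 + X 7 6 6 + X 7 7 7 = 0"
    using
      sym[of 1 1 7] sym[of 1 3 6] sym[of 1 4 5] sym[of 2 2 7] sym[of 2 3 5] sym[of 2 4 6]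
      sym[of 3 1 6] sym[of 3 2 5] sym[of 3 3 7] sym[of 4 1 5] sym[of 4 2 6] sym[of 4 4 7]
      sym[of 5 1 4] sym[of 5 2 3] sym[of 5 5 7] sym[of 6 1 3] sym[of 6 2 4] sym[of 6 6 7]
      H[of 6 1 3] H[of 5 1 4] H[of 4 1 5] H[of 3 1 6] H[of 1 1 7] H[of 5 2 3] H[of 6 2 4]
      H[of 3 2 5] H[of 4 2 6] H[of 2 2 7] H[of 2 3 5] H[of 1 3 6] H[of 3 3 7] H[of 1 4 5]
      H[of 2 4 6] H[of 4 4 7] H[of 5 5 7] H[of 6 6 7]
    unfolding rules by (intro conjI; algebra)
  have g4:
    "X 1 2 4 = X 2 1 4 \<and> X 1 3 1 = X 3 1 1 \<and> X 1 4 2 = X 4 1 2 \<and>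
    X 1 6 7 = X 6 1 7 \<and> X 1 7 6 = X 7 1 6 \<and> X 2 3 2 = X 3 2 2 \<and>
    X 2 4 1 = X 4 2 1 \<and> X 2 5 7 = X 5 2 7 \<and> X 2 7 5 = X 7 2 5 \<and>
    X 3 4 4 = X 4 3 4 \<and> X 3 5 5 = X 5 3 5 \<and> X 3 6 6 = X 6 3 6 \<and>
    X 3 7 7 = X 7 3 7 \<and> X 4 5 6 = X 5 4 6 \<and> X 4 6 5 = X 6 4 5 \<and>
    X 5 6 4 = X 6 5 4 \<and> X 5 7 2 = X 7 5 2 \<and> X 6 7 1 = X 7 6 1 \<and>
    X 3 1 1 + X 3 2 2 + X 3 3 3 + X 3 4 4 + X 3 5 5 + X 3 6 6 + X 3 7 7 = 0"
    using
      sym[of 1 1 3] sym[of 1 2 4] sym[of 1 6 7] sym[of 2 1 4] sym[of 2 2 3] sym[of 2 5 7]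
      sym[of 4 1 2] sym[of 4 3 4] sym[of 4 5 6] sym[of 5 2 7] sym[of 5 3 5] sym[of 5 4 6]
      sym[of 6 1 7] sym[of 6 3 6] sym[of 6 4 5] sym[of 7 1 6] sym[of 7 2 5] sym[of 7 3 7]
      H[of 4 1 2] H[of 1 1 3] H[of 2 1 4] H[of 7 1 6] H[of 6 1 7] H[of 2 2 3] H[of 1 2 4]
      H[of 7 2 5] H[of 5 2 7] H[of 4 3 4] H[of 5 3 5] H[of 6 3 6] H[of 7 3 7] H[of 6 4 5]
      H[of 5 4 6] H[of 4 5 6] H[of 2 5 7] H[of 1 6 7]
    unfolding rules by (intro conjI; algebra)
  have g5:
    "X 1 2 6 = X 2 1 6 \<and> X 1 4 7 = X 4 1 7 \<and> X 1 5 1 = X 5 1 1 \<and>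
    X 1 6 2 = X 6 1 2 \<and> X 1 7 4 = X 7 1 4 \<and> X 2 3 7 = X 3 2 7 \<and>
    X 2 5 2 = X 5 2 2 \<and> X 2 6 1 = X 6 2 1 \<and> X 2 7 3 = X 7 2 3 \<and>
    X 3 4 6 = X 4 3 6 \<and> X 3 5 3 = X 5 3 3 \<and> X 3 6 4 = X 6 3 4 \<and>
    X 3 7 2 = X 7 3 2 \<and> X 4 5 4 = X 5 4 4 \<and> X 4 6 3 = X 6 4 3 \<and>
    X 4 7 1 = X 7 4 1 \<and> X 5 6 6 = X 6 5 6 \<and> X 5 7 7 = X 7 5 7 \<and>
    X 5 1 1 + X 5 2 2 + X 5 3 3 + X 5 4 4 + X 5 5 5 + X 5 6 6 + X 5 7 7 = 0"
    using
      sym[of 1 1 5] sym[of 1 2 6] sym[of 1 4 7] sym[of 2 1 6] sym[of 2 2 5] sym[of 2 3 7]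
      sym[of 3 2 7] sym[of 3 3 5] sym[of 3 4 6] sym[of 4 1 7] sym[of 4 3 6] sym[of 4 4 5]
      sym[of 6 1 2] sym[of 6 3 4] sym[of 6 5 6] sym[of 7 1 4] sym[of 7 2 3] sym[of 7 5 7]
      H[of 6 1 2] H[of 7 1 4] H[of 1 1 5] H[of 2 1 6] H[of 4 1 7] H[of 7 2 3] H[of 2 2 5]
      H[of 1 2 6] H[of 3 2 7] H[of 6 3 4] H[of 3 3 5] H[of 4 3 6] H[of 2 3 7] H[of 4 4 5]
      H[of 3 4 6] H[of 1 4 7] H[of 6 5 6] H[of 7 5 7]
    unfolding rules by (intro conjI; algebra)
  have g6:
    "X 1 2 5 = X 2 1 5 \<and> X 1 3 7 = X 3 1 7 \<and> X 1 5 2 = X 5 1 2 \<and>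
    X 1 6 1 = X 6 1 1 \<and> X 1 7 3 = X 7 1 3 \<and> X 2 4 7 = X 4 2 7 \<and>
    X 2 5 1 = X 5 2 1 \<and> X 2 6 2 = X 6 2 2 \<and> X 2 7 4 = X 7 2 4 \<and>
    X 3 4 5 = X 4 3 5 \<and> X 3 5 4 = X 5 3 4 \<and> X 3 6 3 = X 6 3 3 \<and>
    X 3 7 1 = X 7 3 1 \<and> X 4 5 3 = X 5 4 3 \<and> X 4 6 4 = X 6 4 4 \<and>
    X 4 7 2 = X 7 4 2 \<and> X 5 6 5 = X 6 5 5 \<and> X 6 7 7 = X 7 6 7 \<and>
    X 6 1 1 + X 6 2 2 + X 6 3 3 + X 6 4 4 + X 6 5 5 + X 6 6 6 + X 6 7 7 = 0"
    using
      sym[of 1 1 6] sym[of 1 2 5] sym[of 1 3 7] sym[of 2 1 5] sym[of 2 2 6] sym[of 2 4 7]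
      sym[of 3 1 7] sym[of 3 3 6] sym[of 3 4 5] sym[of 4 2 7] sym[of 4 3 5] sym[of 4 4 6]
      sym[of 5 1 2] sym[of 5 3 4] sym[of 5 5 6] sym[of 7 1 3] sym[of 7 2 4] sym[of 7 6 7]
      H[of 5 1 2] H[of 7 1 3] H[of 2 1 5] H[of 1 1 6] H[of 3 1 7] H[of 7 2 4] H[of 1 2 5]
      H[of 2 2 6] H[of 4 2 7] H[of 5 3 4] H[of 4 3 5] H[of 3 3 6] H[of 1 3 7] H[of 3 4 5]
      H[of 4 4 6] H[of 2 4 7] H[of 5 5 6] H[of 7 6 7]
    unfolding rules by (intro conjI; algebra)
  have g7:
    "X 1 2 3 = X 2 1 3 \<and> X 1 3 2 = X 3 1 2 \<and> X 1 4 1 = X 4 1 1 \<and>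
    X 1 5 7 = X 5 1 7 \<and> X 1 7 5 = X 7 1 5 \<and> X 2 3 1 = X 3 2 1 \<and>
    X 2 4 2 = X 4 2 2 \<and> X 2 6 7 = X 6 2 7 \<and> X 2 7 6 = X 7 2 6 \<and>
    X 3 4 3 = X 4 3 3 \<and> X 3 5 6 = X 5 3 6 \<and> X 3 6 5 = X 6 3 5 \<and>
    X 4 5 5 = X 5 4 5 \<and> X 4 6 6 = X 6 4 6 \<and> X 4 7 7 = X 7 4 7 \<and>
    X 5 6 3 = X 6 5 3 \<and> X 5 7 1 = X 7 5 1 \<and> X 6 7 2 = X 7 6 2 \<and>
    X 4 1 1 + X 4 2 2 + X 4 3 3 + X 4 4 4 + X 4 5 5 + X 4 6 6 + X 4 7 7 = 0"
    using
      sym[of 1 1 4] sym[of 1 2 3] sym[of 1 5 7] sym[of 2 1 3] sym[of 2 2 4] sym[of 2 6 7]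
      sym[of 3 1 2] sym[of 3 3 4] sym[of 3 5 6] sym[of 5 1 7] sym[of 5 3 6] sym[of 5 4 5]
      sym[of 6 2 7] sym[of 6 3 5] sym[of 6 4 6] sym[of 7 1 5] sym[of 7 2 6] sym[of 7 4 7]
      H[of 3 1 2] H[of 2 1 3] H[of 1 1 4] H[of 7 1 5] H[of 5 1 7] H[of 1 2 3] H[of 2 2 4]
      H[of 7 2 6] H[of 6 2 7] H[of 3 3 4] H[of 6 3 5] H[of 5 3 6] H[of 5 4 5] H[of 6 4 6]
      H[of 7 4 7] H[of 3 5 6] H[of 1 5 7] H[of 2 6 7]
    unfolding rules by (intro conjI; algebra)
  have "\<forall>k l m. X k l m = X l k m"
    unfolding forall_7 by (simp add: g0 g1 g2 g3 g4 g5 g6 g7)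
  then show "X k l m = X l k m" by blast
  have "\<forall>k. (SUM l. X k l l) = 0"
    unfolding forall_7 sum_7 using g0 g1 g2 g3 g4 g5 g6 g7 by blast
  then show "(SUM l. X k l l) = 0" by blast
qed

text \<open>Injectivity of the map from \<open>T\<close> to \<open>S\<close>, which is nonzero on
  each of the components of dimension 1, 7 and 27. In coordinates, the 35 unknowns split by degree
  into one block of seven and seven blocks of four.\<close>

lemma skew_zero_if_phi0_contraction_zero:
  fixes t :: "7 \<Rightarrow> 7 \<Rightarrow> 7 \<Rightarrow> real"
  assumes skew: "\<And>j k l. t k j l = - t j k l" "\<And>j k l. t j l k = - t j k l"
    and H: "\<And>l m. (SUM a b. phi0 a b m * t l a b) = 0"
  shows "t j k l = 0"
proof -
  note sorted = skew_sorted[of "\<lambda>j k. t j k l" for l, OF skew(1)] skew_sorted[of "t j" for j, OF skew(2)]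
  note rules = phi0_sum_first_simps sorted
  have h0: "t 1 2 7 = 0 \<and> t 1 3 5 = 0 \<and> t 1 4 6 = 0 \<and> t 2 3 6 = 0 \<and> t 2 4 5 = 0 \<and>
    t 3 4 7 = 0 \<and> t 5 6 7 = 0"
    using H[of 1 1] H[of 2 2] H[of 3 3] H[of 4 4] H[of 5 5] H[of 6 6] H[of 7 7]
    unfolding rules by (intro conjI; algebra)
  have h1: "t 2 3 4 = 0 \<and> t 2 5 6 = 0 \<and> t 3 6 7 = 0 \<and> t 4 5 7 = 0"
    using H[of 2 7] H[of 3 5] H[of 4 6] H[of 5 3] H[of 6 4] H[of 7 2]
    unfolding rules by (intro conjI; algebra)
  have h2: "t 1 3 4 = 0 \<and> t 1 5 6 = 0 \<and> t 3 5 7 = 0 \<and> t 4 6 7 = 0"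
    using H[of 1 7] H[of 3 6] H[of 4 5] H[of 5 4] H[of 6 3] H[of 7 1]
    unfolding rules by (intro conjI; algebra)
  have h3: "t 1 3 6 = 0 \<and> t 1 4 5 = 0 \<and> t 2 3 5 = 0 \<and> t 2 4 6 = 0"
    using H[of 1 2] H[of 2 1] H[of 3 4] H[of 4 3] H[of 5 6] H[of 6 5]
    unfolding rules by (intro conjI; algebra)
  have h4: "t 1 2 4 = 0 \<and> t 1 6 7 = 0 \<and> t 2 5 7 = 0 \<and> t 4 5 6 = 0"
    using H[of 1 5] H[of 2 6] H[of 4 7] H[of 5 1] H[of 6 2] H[of 7 4]
    unfolding rules by (intro conjI; algebra)
  have h5: "t 1 2 6 = 0 \<and> t 1 4 7 = 0 \<and> t 2 3 7 = 0 \<and> t 3 4 6 = 0"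
    using H[of 1 3] H[of 2 4] H[of 3 1] H[of 4 2] H[of 6 7] H[of 7 6]
    unfolding rules by (intro conjI; algebra)
  have h6: "t 1 2 5 = 0 \<and> t 1 3 7 = 0 \<and> t 2 4 7 = 0 \<and> t 3 4 5 = 0"
    using H[of 1 4] H[of 2 3] H[of 3 2] H[of 4 1] H[of 5 7] H[of 7 5]
    unfolding rules by (intro conjI; algebra)
  have h7: "t 1 2 3 = 0 \<and> t 1 5 7 = 0 \<and> t 2 6 7 = 0 \<and> t 3 5 6 = 0"
    using H[of 1 6] H[of 2 5] H[of 3 7] H[of 5 2] H[of 6 1] H[of 7 3]
    unfolding rules by (intro conjI; algebra)
  have "\<forall>j k l. t j k l = 0"
    unfolding forall_7 by (simp add: sorted h0 h1 h2 h3 h4 h5 h6 h7)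
  then show ?thesis by blast
qed

section \<open>Algebra of the contracted Ricci identity\<close>

lemma skew_sum2:
  fixes f :: "'i::finite \<Rightarrow> 'i \<Rightarrow> real"
  assumes "\<And>i j. f j i = - f i j"
  shows "(SUM i j. f i j) = 0"
proof -
  have "(SUM i j. f i j) = (SUM i j. f j i)" by (rule sum.swap)
  also have "\<dots> = (SUM i j. - f i j)" by (intro sum.cong refl assms)
  also have "\<dots> = - (SUM i j. f i j)" by (simp add: sum_negf)
  finally show ?thesis by simp
qed

lemma sum_kdelta2: "(SUM i. kdelta i a * f i) = f a" for a :: "'i::finite"
  using sum_kdelta[of a f] by (simp add: kdelta_def eq_commute)

text \<open>\<open>X\<close> and \<open>Y\<close> stand for \<open>\<nabla>S\<close> and
  \<open>\<nabla>\<nabla>S\<close>. The commutator \<open>K\<close> of second derivatives can be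
  contracted with \<open>phi0\<close> in two ways: over both derivative indices, which is
  \<open>ric\<close>, or over one derivative index and one tensor index. Total symmetry relates the
  two, and their interplay gives both conclusions.\<close>

lemma contracted_ricci_consequences:
  fixes S :: "7 \<Rightarrow> 7 \<Rightarrow> real" and X :: "7 \<Rightarrow> 7 \<Rightarrow> 7 \<Rightarrow> real" and Y :: "7 \<Rightarrow> 7 \<Rightarrow> 7 \<Rightarrow> 7 \<Rightarrow> real"
  assumes S: "\<And>i j. S j i = S i j"
    and X: "\<And>i j k. X j i k = X i j k" "\<And>i j k. X i k j = X i j k"
    and Y: "\<And>a i j k. Y a j i k = Y a i j k" "\<And>a i j k. Y a i k j = Y a i j k"
    and tr: "\<And>i k. (SUM l. Y i k l l) = 0"
    and ric: "\<And>k l m. (SUM i j. phi0 i j m * (Y i j k l - Y j i k l)) = - (SUM s. S s m * X s k l)"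
  shows "(SUM s m. S s m * X s k m) = 0"
    and "(SUM k l. S k l * (SUM i. Y i i k l)) = 0"
proof -
  define K where "K i k j l = Y i k j l - Y k i j l" for i k j l
  have Klj: "K i k l j = K i k j l" for i j k l
    by (simp add: K_def Y)
  \<comment> \<open>In \<open>K\<close> one of the two terms is symmetric in the contracted indices
    and drops out; the other is half of the left-hand side of \<open>ric\<close>.\<close>
  have half: "2 * (SUM i j. phi0 i j m * K i k j l) = - (SUM s. S s m * X s k l)" for k l m
  proof -
    have z: "(SUM i j. phi0 i j m * Y k i j l) = 0"
      by (rule skew_sum2) (metis Y(1) mult_minus_left phi0_skew12)
    have "(SUM i j. phi0 i j m * K i k j l) = (SUM i j. phi0 i j m * Y i j k l)"
      using z by (simp add: K_def right_diff_distrib sum_subtractf Y(1)[of _ k])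
    moreover have "(SUM i j. phi0 i j m * Y j i k l) = - (SUM i j. phi0 i j m * Y i j k l)"
    proof -
      have "(SUM i j. phi0 i j m * Y j i k l) = (SUM j i. phi0 i j m * Y j i k l)"
        by (rule sum.swap)
      also have "\<dots> = (SUM j i. - (phi0 j i m * Y j i k l))"
        by (intro sum.cong refl) (subst phi0_skew12, simp)
      finally show ?thesis by (simp add: sum_negf)
    qed
    ultimately show ?thesis
      using ric[of m k l] by (simp add: right_diff_distrib sum_subtractf)
  qed
  \<comment> \<open>For \<open>l = m\<close> the contraction vanishes, since \<open>K\<close> is
    symmetric in its last two indices and \<open>phi0\<close> is skew in \<open>j\<close> and
    \<open>m\<close>.\<close>
  have zero1: "(SUM m s. S s m * X s k m) = 0" for k
  proof -
    have "(SUM m j. phi0 i j m * K i k j m) = 0" for i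
      by (rule skew_sum2) (metis Klj mult_minus_left phi0_skew23)
    moreover have "(SUM m i j. phi0 i j m * K i k j m) = (SUM i m j. phi0 i j m * K i k j m)"
      by (rule sum.swap)
    ultimately have "(SUM m i j. phi0 i j m * K i k j m) = 0" by simp
    then have "(SUM m. 2 * (SUM i j. phi0 i j m * K i k j m)) = 0"
      unfolding sum_distrib_left[symmetric] by simp
    then show ?thesis unfolding half by (simp add: sum_negf)
  qed
  then show "(SUM s m. S s m * X s k m) = 0" by (subst sum.swap)

  \<comment> \<open>The rough Laplacian of \<open>S\<close>. It equals both traces of
    \<open>K\<close> up to sign, because the other term of each trace is the derivative of a
    vanishing trace of \<open>X\<close>.\<close>
  define L where "L k l = (SUM i. Y i i k l)" for k l
  have L1: "(SUM i. K i k i l) = L k l" for k l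
  proof -
    have "(SUM i. Y k i i l) = 0"
      using tr[of k l] by (metis (no_types, lifting) Y sum.cong)
    then show ?thesis by (simp add: K_def L_def sum_subtractf Y(1)[of _ k])
  qed
  have L2: "(SUM j. K i j j l) = - L i l" for i l
  proof -
    have "(SUM j. Y i j j l) = 0"
      using tr[of i l] by (metis (no_types, lifting) Y sum.cong)
    then show ?thesis by (simp add: K_def L_def sum_subtractf Y(1)[of _ i])
  qed
  define D where "D = (SUM k l. S k l * L k l)"
  text \<open>Contracting \<open>half\<close> with \<open>phi0 k p m * S p l\<close> gives zero on the right by symmetry, and the
    contraction identity of \<open>phi0\<close> turns the left-hand side into a multiple of \<open>D\<close>.\<close>
  have skew0: "(SUM l p s m. phi0 k p m * S p l * (S s m * X s k l)) = 0" for k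
  proof -
    have "(SUM l p s m. phi0 k p m * S p l * (S s m * X s k l)) =
      (SUM l s p m. phi0 k p m * S p l * (S s m * X s k l))"
      by (rule sum.cong[OF refl], rule sum.swap)
    \<comment> \<open>Exchanging \<open>l\<close> with \<open>s\<close> and \<open>p\<close> with
      \<open>m\<close> permutes the two factors \<open>S\<close> and fixes \<open>X\<close> by its
      total symmetry, while \<open>phi0\<close> changes sign.\<close>
    also have "\<dots> = 0"
    proof (rule skew_sum2)
      fix l s
      have "(SUM p m. phi0 k p m * S p s * (S l m * X l k s)) =
        (SUM m p. phi0 k p m * S p s * (S l m * X l k s))" by (rule sum.swap)
      also have "\<dots> = (SUM p m. - (phi0 k p m * S p l * (S s m * X s k l)))"
      proof (intro sum.cong refl)
        fix p m
        have "X l k s = X s k l" by (metis X)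
        then show "phi0 k m p * S m s * (S l p * X l k s) = - (phi0 k p m * S p l * (S s m * X s k l))"
          using S[of m s] S[of l p] phi0_skew23[of k m p] by simp
      qed
      finally show "(SUM p m. phi0 k p m * S p s * (S l m * X l k s)) =
        - (SUM p m. phi0 k p m * S p l * (S s m * X s k l))" by (simp add: sum_negf)
    qed
    finally show ?thesis .
  qed
  have A: "(SUM k l p m. phi0 k p m * S p l * (SUM i j. phi0 i j m * K i k j l)) = 0"
  proof -
    have "2 * (SUM k l p m. phi0 k p m * S p l * (SUM i j. phi0 i j m * K i k j l)) =
      (SUM k l p m. phi0 k p m * S p l * (2 * (SUM i j. phi0 i j m * K i k j l)))"
      by (simp add: sum_distrib_left mult_ac)
    also have "\<dots> = - (SUM k l p m s. phi0 k p m * S p l * (S s m * X s k l))"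
      unfolding half by (simp add: sum_negf sum_distrib_left)
    also have "\<dots> = - (SUM k l p s m. phi0 k p m * S p l * (S s m * X s k l))"
      by (intro arg_cong[where f = uminus] sum.cong refl sum.swap)
    finally show ?thesis using skew0 by simp
  qed
  \<comment> \<open>The same contraction applied to \<open>ric\<close> itself. With these names of
    the indices it supplies the second summand of \<open>phi0_contract\<close>, the one with
    \<open>j\<close> and \<open>k\<close> exchanged.\<close>
  have B: "(SUM j l p m. phi0 j p m * S p l * (SUM i k. phi0 i k m * K i k j l)) = 0"
  proof -
    have "(SUM i k. phi0 i k m * K i k j l) = - (SUM s. S s m * X s j l)" for m j l
      unfolding K_def by (rule ric)
    then have "(SUM j l p m. phi0 j p m * S p l * (SUM i k. phi0 i k m * K i k j l)) =
      - (SUM j l p m s. phi0 j p m * S p l * (S s m * X s j l))"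
      by (simp add: sum_negf sum_distrib_left)
    also have "\<dots> = - (SUM j l p s m. phi0 j p m * S p l * (S s m * X s j l))"
      by (intro arg_cong[where f = uminus] sum.cong refl sum.swap)
    finally show ?thesis using skew0 by simp
  qed
  define c where "c i j k p = (SUM m. phi0 i j m * phi0 k p m)" for i j k p
  have A': "(SUM k l p i j. c i j k p * (S p l * K i k j l)) = 0"
  proof -
    have "(SUM m. phi0 k p m * S p l * (SUM i j. phi0 i j m * K i k j l)) =
      (SUM i j. c i j k p * (S p l * K i k j l))" for k l p
    proof -
      have "(SUM m. phi0 k p m * S p l * (SUM i j. phi0 i j m * K i k j l)) =
        (SUM m i j. phi0 i j m * phi0 k p m * (S p l * K i k j l))"
        by (simp add: sum_distrib_left mult_ac)
      also have "\<dots> = (SUM i m j. phi0 i j m * phi0 k p m * (S p l * K i k j l))"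
        by (rule sum.swap)
      also have "\<dots> = (SUM i j m. phi0 i j m * phi0 k p m * (S p l * K i k j l))"
        by (rule sum.cong[OF refl], rule sum.swap)
      finally show ?thesis by (simp add: c_def sum_distrib_right)
    qed
    then show ?thesis using A by simp
  qed
  have B': "(SUM k l p i j. c i k j p * (S p l * K i k j l)) = 0"
  proof -
    have "(SUM m. phi0 j p m * S p l * (SUM i k. phi0 i k m * K i k j l)) =
      (SUM i k. c i k j p * (S p l * K i k j l))" for j l p
    proof -
      have "(SUM m. phi0 j p m * S p l * (SUM i k. phi0 i k m * K i k j l)) =
        (SUM m i k. phi0 i k m * phi0 j p m * (S p l * K i k j l))"
        by (simp add: sum_distrib_left mult_ac)
      also have "\<dots> = (SUM i m k. phi0 i k m * phi0 j p m * (S p l * K i k j l))"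
        by (rule sum.swap)
      also have "\<dots> = (SUM i k m. phi0 i k m * phi0 j p m * (S p l * K i k j l))"
        by (rule sum.cong[OF refl], rule sum.swap)
      finally show ?thesis by (simp add: c_def sum_distrib_right)
    qed
    with B have "(SUM j l p i k. c i k j p * (S p l * K i k j l)) = 0" by simp
    moreover have "(SUM j l p i k. c i k j p * (S p l * K i k j l)) =
       (SUM l p i j k. c i k j p * (S p l * K i k j l))"
      by (subst sum.swap, rule sum.cong[OF refl], subst sum.swap, rule sum.cong[OF refl], rule sum.swap)
    moreover have "\<dots> = (SUM k l p i j. c i k j p * (S p l * K i k j l))"
    proof -
      have "(SUM k l p i j. c i k j p * (S p l * K i k j l)) =
        (SUM l p i k j. c i k j p * (S p l * K i k j l))"
        by (subst sum.swap, rule sum.cong[OF refl], subst sum.swap, rule sum.cong[OF refl], rule sum.swap)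
      also have "\<dots> = (SUM l p i j k. c i k j p * (S p l * K i k j l))"
        by (intro sum.cong refl sum.swap)
      finally show ?thesis ..
    qed
    ultimately show ?thesis by simp
  qed
  have "(SUM k l p i j. (c i j k p + c i k j p) * (S p l * K i k j l)) = 0"
    using A' B' by (simp add: distrib_right sum.distrib)
  moreover have "c i j k p + c i k j p =
      kdelta i k * kdelta j p + kdelta i j * kdelta k p - 2 * (kdelta i p * kdelta j k)" for i j k p
    unfolding c_def by (rule phi0_contract)
  ultimately have "(SUM k l p i j. (kdelta i k * kdelta j p + kdelta i j * kdelta k p
     - 2 * (kdelta i p * kdelta j k)) * (S p l * K i k j l)) = 0" by simp
  moreover have "(SUM i j. (kdelta i k * kdelta j p + kdelta i j * kdelta k p
     - 2 * (kdelta i p * kdelta j k)) * (S p l * K i k j l)) =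
     S p l * K k k p l + kdelta k p * (S p l * (SUM i. K i k i l)) - 2 * (S p l * K p k k l)" for k l p
    by (simp add: distrib_right left_diff_distrib sum.distrib sum_subtractf mult.assoc sum_distrib_left[symmetric]
        sum_kdelta sum_kdelta2 sum_kdelta[where f = "\<lambda>j. _ * (_ * K _ _ j _)"])
  ultimately have "(SUM k l p. kdelta k p * (S p l * L k l) - 2 * (S p l * K p k k l)) = 0"
    by (simp add: K_def[of k k for k] L1)
  \<comment> \<open>The first product of deltas leaves \<open>K k k p l = 0\<close>, the second
    leaves \<open>D\<close>, and the third a trace of \<open>K\<close> that equals
    \<open>- L\<close>; altogether \<open>D = - 2 D\<close>.\<close>
  then have "D = (SUM k l p. 2 * (S p l * K p k k l))"
    by (simp add: sum_subtractf sum_kdelta D_def)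
  also have "\<dots> = (SUM l p k. 2 * (S p l * K p k k l))"
    by (subst sum.swap, rule sum.cong[OF refl], rule sum.swap)
  also have "\<dots> = (SUM l p. - 2 * (S p l * L p l))"
    by (simp add: sum_distrib_left[symmetric] L2)
  also have "\<dots> = - 2 * D"
    unfolding D_def sum_distrib_left by (rule sum.swap)
  finally show "(SUM k l. S k l * (SUM i. Y i i k l)) = 0"
    unfolding D_def L_def by simp
qed

text \<open>A skew endomorphism annihilating \<open>phi0\<close> lies in \<open>g2\<close>, which is
  orthogonal to the seven 2-forms obtained by fixing one index of \<open>phi0\<close>.\<close>

lemma phi0_annihilator_contraction:
  fixes A :: "7 \<Rightarrow> 7 \<Rightarrow> real"
  assumes skew: "\<And>i j. A j i = - A i j"
    and A: "\<And>b c d. (SUM s. A b s * phi0 s c d + A c s * phi0 b s d + A d s * phi0 b c s) = 0"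
  shows "(SUM i j. phi0 i j k * A i j) = 0"
proof -
  have "\<forall>k. (SUM i j. phi0 i j k * A i j) = 0"
    unfolding forall_7 phi0_sum_first_simps
    \<comment> \<open>The triples are chosen so that the \<open>k\<close>-th has the degree of
      \<open>k\<close> in the grading by the nonzero elements of \<open>(\<int>/2)\<^sup>3\<close>;
      its equation then involves only the components of \<open>A\<close> that occur in the
      \<open>k\<close>-th contraction.\<close>
    using A[of 2 3 4] A[of 1 3 4] A[of 1 2 4] A[of 1 2 3] A[of 1 2 6] A[of 1 2 5] A[of 1 3 6]
    by (auto simp: sum_7 phi0_table kdelta_def skew_sorted[of A, OF skew])
  then show ?thesis by blast
qed

text \<open>The contraction sees only the skew part of the product, half of a commutator, so this is
  closure of \<open>g2\<close> under the bracket. Moving \<open>A\<close> onto the other two indices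
  of \<open>phi0\<close> turns the sum into its own negative plus a term containing the contraction
  of \<open>B\<close>.\<close>

lemma bracket_in_g2:
  fixes A B :: "7 \<Rightarrow> 7 \<Rightarrow> real"
  assumes B: "\<And>i j. B j i = - B i j" "\<And>k. (SUM i j. phi0 i j k * B i j) = 0"
    and A: "\<And>b c d. (SUM s. A b s * phi0 s c d + A c s * phi0 b s d + A d s * phi0 b c s) = 0"
  shows "(SUM i j s. phi0 i j k * (B i s * A s j)) = 0"
proof -
  let ?L = "SUM i s j. phi0 i j k * (B i s * A s j)"
  have "(SUM j. A s j * phi0 i j k) = - (SUM j. A i j * phi0 j s k) - (SUM j. A k j * phi0 i s j)" for i s
    using A[of i s k] by (simp add: sum.distrib)
  then have "(SUM i s. B i s * (SUM j. A s j * phi0 i j k)) =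
      (SUM i s. B i s * (- (SUM j. A i j * phi0 j s k) - (SUM j. A k j * phi0 i s j)))"
    by (intro sum.cong refl) simp
  moreover have "(SUM i s. B i s * (SUM j. A s j * phi0 i j k)) = ?L"
    by (simp add: sum_distrib_left mult_ac)
  ultimately have "?L = (SUM i s. B i s * (- (SUM j. A i j * phi0 j s k) - (SUM j. A k j * phi0 i s j)))"
    by simp
  also have "\<dots> = - (SUM i s j. B i s * (A i j * phi0 j s k)) - (SUM i s j. B i s * (A k j * phi0 i s j))"
    by (simp add: right_diff_distrib sum_subtractf sum_negf sum_distrib_left)
  also have "(SUM i s j. B i s * (A k j * phi0 i s j)) = (SUM j. A k j * (SUM i s. phi0 i s j * B i s))"
  proof -
    have "(SUM i s j. B i s * (A k j * phi0 i s j)) = (SUM i j s. B i s * (A k j * phi0 i s j))"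
      by (rule sum.cong[OF refl], rule sum.swap)
    also have "\<dots> = (SUM j i s. B i s * (A k j * phi0 i s j))" by (rule sum.swap)
    finally show ?thesis by (simp add: sum_distrib_left mult_ac)
  qed
  also have "(SUM i s j. B i s * (A i j * phi0 j s k)) = (SUM s i j. B i s * (A i j * phi0 j s k))"
    by (rule sum.swap)
  also have "\<dots> = ?L"
  proof (intro sum.cong refl)
    fix s i j
    show "B i s * (A i j * phi0 j s k) = phi0 s j k * (B s i * A i j)"
      by (subst phi0_skew12, subst B(1)) simp
  qed
  finally have "?L = 0" using B(2) by simp
  moreover have "(SUM i j s. phi0 i j k * (B i s * A s j)) = ?L" by (rule sum.cong[OF refl], rule sum.swap)
  ultimately show ?thesis by simp
qed

text \<open>The octahedron argument: an alternating sum of four cyclic sums isolates the defect of the pair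
  symmetry of \<open>R\<close>.\<close>

lemma octahedron:
  fixes R x \<sigma> :: "'i \<Rightarrow> 'i \<Rightarrow> 'i \<Rightarrow> 'i \<Rightarrow> real"
  assumes R: "\<And>i j k l. R j i k l = - R i j k l" "\<And>i j k l. R i j l k = - R i j k l"
    and x: "\<And>i j k l. x i k j l = - x i j k l" "\<And>i j k l. x i j l k = - x i j k l"
    and \<sigma>: "\<And>i j k l. \<sigma> j i k l = - \<sigma> i j k l" "\<And>i j k l. \<sigma> i k j l = - \<sigma> i j k l"
      "\<And>i j k l. \<sigma> i j l k = - \<sigma> i j k l"
    and b: "\<And>i j k l. R i j k l + R j k i l + R k i j l = x i j k l + x j k i l + x k i j l + \<sigma> i j k l"
  shows "2 * (R i j k l - R k l i j) = x i j k l - x j i k l - x k l i j + x l k i j"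
proof -
  have "\<sigma> j k l i = - \<sigma> i j k l" "\<sigma> k l i j = \<sigma> i j k l" "\<sigma> l i j k = - \<sigma> i j k l"
    by (metis \<sigma> minus_minus)+
  moreover have "R j k l i = - R j k i l" "R k l j i = - R k l i j" "R l j k i = - R l j i k"
    "R i k l j = R k i j l" "R j l i k = - R l j i k" "R i j l k = - R i j k l" "R l i k j = - R l i j k"
    using R[of i k l j] R(2)[of k i j l] by (metis R minus_minus)+
  moreover have "x i k l j = x i j k l" "x i j l k = - x i j k l"
    "x j k i l = - x j i k l" "x j k l i = x j i k l" "x j l i k = x j i k l"
    "x k i j l = x k l i j" "x k l j i = - x k l i j"
    "x l j k i = x l k i j" "x l i k j = x l k j i" "x l i j k = - x l k j i" "x l k j i = - x l k i j"
    by (metis x minus_minus)+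
  \<comment> \<open>The combination is the first plus the second minus the third minus the fourth
    cyclic sum. A cyclic shift of four indices is odd, so the four \<sigma> terms have alternating
    signs and cancel.\<close>
  ultimately show ?thesis
    using b[of i j k l] b[of j k l i] b[of k l i j] b[of l i j k] by algebra
qed

section \<open>Curvature and torsion in a local frame\<close>

text \<open>Calculus in a fixed local frame: \<open>dd a\<close> is differentiation along the \<open>a\<close>-th frame field,
  \<open>sm\<close> is smoothness on \<open>V\<close>, \<open>\<Gamma> a b c\<close> and \<open>T a b c\<close> are the components of the
  connection and of its torsion. The definitions below are the components of the brackets (\<open>C\<close>), the
  curvature (\<open>R\<close>), \<open>\<nabla>T\<close> (\<open>DT\<close>), \<open>\<nabla>S\<close> (\<open>X\<close>) and \<open>\<nabla>\<nabla>S\<close> (\<open>Y\<close>).\<close>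

locale g2_frame =
  fixes V :: "'m set" and sm :: "('m \<Rightarrow> real) \<Rightarrow> bool" and dd :: "7 \<Rightarrow> ('m \<Rightarrow> real) \<Rightarrow> 'm \<Rightarrow> real"
    and \<Gamma> T :: "7 \<Rightarrow> 7 \<Rightarrow> 7 \<Rightarrow> 'm \<Rightarrow> real"
  assumes sm_const: "sm (\<lambda>p. r)"
    and sm_add: "sm f \<Longrightarrow> sm h \<Longrightarrow> sm (\<lambda>p. f p + h p)"
    and sm_mult: "sm f \<Longrightarrow> sm h \<Longrightarrow> sm (\<lambda>p. f p * h p)"
    and sm_dd: "sm f \<Longrightarrow> sm (dd a f)"
    and dd_add: "sm f \<Longrightarrow> sm h \<Longrightarrow> p \<in> V \<Longrightarrow> dd a (\<lambda>p. f p + h p) p = dd a f p + dd a h p"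
    and dd_mult: "sm f \<Longrightarrow> sm h \<Longrightarrow> p \<in> V \<Longrightarrow> dd a (\<lambda>p. f p * h p) p = dd a f p * h p + f p * dd a h p"
    and dd_const: "p \<in> V \<Longrightarrow> dd a (\<lambda>p. r) p = 0"
    and dd_cong: "(\<And>q. q \<in> V \<Longrightarrow> f q = h q) \<Longrightarrow> p \<in> V \<Longrightarrow> dd a f p = dd a h p"
    and sm_\<Gamma>: "sm (\<Gamma> a b c)" and sm_T: "sm (T a b c)"
    and bracket: "sm f \<Longrightarrow> p \<in> V \<Longrightarrow> dd a (dd b f) p - dd b (dd a f) p =
        (SUM s. (\<Gamma> a b s p - \<Gamma> b a s p - T a b s p) * dd s f p)"
    and dd_independent: "p \<in> V \<Longrightarrow> (\<And>f. sm f \<Longrightarrow> (SUM s. v s * dd s f p) = 0) \<Longrightarrow> v s = 0"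
    and \<Gamma>_skew: "p \<in> V \<Longrightarrow> \<Gamma> a c b p = - \<Gamma> a b c p"
    and T_skew: "p \<in> V \<Longrightarrow> T b a c p = - T a b c p" "p \<in> V \<Longrightarrow> T a c b p = - T a b c p"
    and \<Gamma>_phi0: "p \<in> V \<Longrightarrow> (SUM s. \<Gamma> a b s p * phi0 s c d + \<Gamma> a c s p * phi0 b s d
        + \<Gamma> a d s p * phi0 b c s) = 0"
    and T_contraction_sym: "p \<in> V \<Longrightarrow> (SUM a b. phi0 a b l * T m a b p) = (SUM a b. phi0 a b m * T l a b p)"
begin

definition C where "C a b s p = \<Gamma> a b s p - \<Gamma> b a s p - T a b s p"

definition R where
  "R a b i j p = dd a (\<Gamma> b i j) p - dd b (\<Gamma> a i j) p
     + (SUM s. \<Gamma> b i s p * \<Gamma> a s j p - \<Gamma> a i s p * \<Gamma> b s j p - C a b s p * \<Gamma> s i j p)"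

definition S where "S l m p = (SUM a b. phi0 a b m * T l a b p)"

definition DT where
  "DT a b c d p = dd a (T b c d) p - (SUM s. \<Gamma> a b s p * T s c d p + \<Gamma> a c s p * T b s d p
     + \<Gamma> a d s p * T b c s p)"

definition X where
  "X k l m p = dd k (S l m) p - (SUM s. \<Gamma> k l s p * S s m p + \<Gamma> k m s p * S l s p)"

definition Y where
  "Y i k j l p = dd i (X k j l) p - (SUM s. \<Gamma> i k s p * X s j l p + \<Gamma> i j s p * X k s l p
     + \<Gamma> i l s p * X k j s p)"

section \<open>Derivation rules and symmetries of the curvature in a frame\<close>

lemma sm_minus: "sm f \<Longrightarrow> sm (\<lambda>p. - f p)"
  using sm_mult[OF sm_const[of "- 1"]] by simp

lemma sm_diff: "sm f \<Longrightarrow> sm h \<Longrightarrow> sm (\<lambda>p. f p - h p)"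
  using sm_add[OF _ sm_minus] by simp

lemma sm_sum: "(\<And>i. i \<in> I \<Longrightarrow> sm (f i)) \<Longrightarrow> sm (\<lambda>p. \<Sum>i\<in>I. f i p)"
  by (induction I rule: infinite_finite_induct) (auto intro: sm_const sm_add)

lemma dd_cmult: "sm f \<Longrightarrow> p \<in> V \<Longrightarrow> dd a (\<lambda>p. r * f p) p = r * dd a f p"
  by (simp add: dd_mult sm_const dd_const)

lemma dd_minus: "sm f \<Longrightarrow> p \<in> V \<Longrightarrow> dd a (\<lambda>p. - f p) p = - dd a f p"
  using dd_cmult[of f p a "- 1"] by simp

lemma dd_diff: "sm f \<Longrightarrow> sm h \<Longrightarrow> p \<in> V \<Longrightarrow> dd a (\<lambda>p. f p - h p) p = dd a f p - dd a h p"
  using dd_add[OF _ sm_minus] by (simp add: dd_minus)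

lemma dd_sum:
  "(\<And>i. i \<in> I \<Longrightarrow> sm (f i)) \<Longrightarrow> p \<in> V \<Longrightarrow> dd a (\<lambda>p. \<Sum>i\<in>I. f i p) p = (\<Sum>i\<in>I. dd a (f i) p)"
  by (induction I rule: infinite_finite_induct) (auto simp: dd_const dd_add sm_sum)

lemma sm_S: "sm (S l m)"
  unfolding S_def by (intro sm_sum sm_mult sm_const sm_T)

lemma sm_X: "sm (X k l m)"
  unfolding X_def by (intro sm_diff sm_dd sm_S sm_sum sm_add sm_mult sm_\<Gamma>)

lemma sm_C: "sm (C a b s)"
  unfolding C_def by (intro sm_diff sm_\<Gamma> sm_T)

lemma dd_\<Gamma>_skew: "p \<in> V \<Longrightarrow> dd a (\<Gamma> b j i) p = - dd a (\<Gamma> b i j) p"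
  using dd_cong[of "\<Gamma> b j i" "\<lambda>p. - \<Gamma> b i j p"] by (simp add: dd_minus sm_\<Gamma> \<Gamma>_skew[of _ b j i])

lemma dd_T_skew:
  assumes "p \<in> V"
  shows "dd a (T c b d) p = - dd a (T b c d) p" "dd a (T b d c) p = - dd a (T b c d) p"
proof -
  have "dd a (T c b d) p = dd a (\<lambda>p. - T b c d p) p" "dd a (T b d c) p = dd a (\<lambda>p. - T b c d p) p"
    by (rule dd_cong[OF _ assms]; erule T_skew)+
  then show "dd a (T c b d) p = - dd a (T b c d) p" "dd a (T b d c) p = - dd a (T b c d) p"
    using dd_minus[OF sm_T assms] by simp_all
qed

context
  fixes p :: 'm
  assumes p: "p \<in> V"
begin

lemma C_skew: "C b a s p = - C a b s p"
  by (simp add: C_def T_skew(1)[OF p, of b a])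

lemma R_skew12: "R b a i j p = - R a b i j p"
  unfolding R_def C_skew[of b a] by (simp add: sum_negf[symmetric] algebra_simps sum_subtractf sum.distrib)

lemma R_skew34: "R a b j i p = - R a b i j p"
proof -
  have "(SUM s. \<Gamma> b j s p * \<Gamma> a s i p - \<Gamma> a j s p * \<Gamma> b s i p - C a b s p * \<Gamma> s j i p) =
    (SUM s. - (\<Gamma> b i s p * \<Gamma> a s j p - \<Gamma> a i s p * \<Gamma> b s j p - C a b s p * \<Gamma> s i j p))"
  proof (rule sum.cong[OF refl])
    fix s
    show "\<Gamma> b j s p * \<Gamma> a s i p - \<Gamma> a j s p * \<Gamma> b s i p - C a b s p * \<Gamma> s j i p =
      - (\<Gamma> b i s p * \<Gamma> a s j p - \<Gamma> a i s p * \<Gamma> b s j p - C a b s p * \<Gamma> s i j p)"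
      using \<Gamma>_skew[OF p, of b j s] \<Gamma>_skew[OF p, of a s i] \<Gamma>_skew[OF p, of a j s]
        \<Gamma>_skew[OF p, of b s i] \<Gamma>_skew[OF p, of s j i]
      by simp
  qed
  then show ?thesis
    using dd_\<Gamma>_skew[OF p, of a b j i] dd_\<Gamma>_skew[OF p, of b a j i]
    unfolding R_def sum_negf by linarith
qed

lemma \<Gamma>_in_g2: "(SUM i j. phi0 i j k * \<Gamma> a i j p) = 0"
  by (rule phi0_annihilator_contraction[OF \<Gamma>_skew[OF p] \<Gamma>_phi0[OF p]])

text \<open>The curvature takes values in \<open>g2\<close> because the connection forms do: the
  derivative terms, the quadratic terms and the bracket term of \<open>R\<close> vanish separately
  under the contraction. This concerns the second index pair, the instanton condition the
  first.\<close>

lemma R_in_g2: "(SUM i j. phi0 i j k * R a b i j p) = 0"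
proof -
  have d: "(SUM i j. phi0 i j k * dd c (\<Gamma> e i j) p) = 0" for c e
  proof -
    have "(SUM i j. phi0 i j k * dd c (\<Gamma> e i j) p) = dd c (\<lambda>p. SUM i j. phi0 i j k * \<Gamma> e i j p) p"
      using p by (simp add: dd_sum dd_cmult sm_sum sm_mult sm_const sm_\<Gamma>)
    also have "\<dots> = dd c (\<lambda>p. 0) p"
      by (rule dd_cong[OF _ p]) (rule phi0_annihilator_contraction[OF \<Gamma>_skew \<Gamma>_phi0]; assumption)
    finally show ?thesis using dd_const[OF p] by simp
  qed
  have q: "(SUM i j s. phi0 i j k * (\<Gamma> e i s p * \<Gamma> c s j p)) = 0" for c e
    by (rule bracket_in_g2[where B = "\<lambda>i j. \<Gamma> e i j p" and A = "\<lambda>i j. \<Gamma> c i j p",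
        OF \<Gamma>_skew[OF p] \<Gamma>_in_g2 \<Gamma>_phi0[OF p]])
  have c: "(SUM i j s. phi0 i j k * (C a b s p * \<Gamma> s i j p)) = 0"
  proof -
    have "(SUM i j s. phi0 i j k * (C a b s p * \<Gamma> s i j p)) =
      (SUM i s j. phi0 i j k * (C a b s p * \<Gamma> s i j p))"
      by (rule sum.cong[OF refl], rule sum.swap)
    also have "\<dots> = (SUM s i j. phi0 i j k * (C a b s p * \<Gamma> s i j p))"
      by (rule sum.swap)
    also have "\<dots> = (SUM s. C a b s p * (SUM i j. phi0 i j k * \<Gamma> s i j p))"
      by (simp add: sum_distrib_left mult_ac)
    finally show ?thesis by (simp add: \<Gamma>_in_g2)
  qed
  show ?thesis
    unfolding R_def using d[of a b] d[of b a] q[of b a] q[of a b] c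
    by (simp add: distrib_left right_diff_distrib sum_distrib_left sum.distrib sum_subtractf)
qed

lemma DT_skew: "DT a c b d p = - DT a b c d p" "DT a b d c p = - DT a b c d p"
proof -
  have "(SUM s. \<Gamma> a c s p * T s b d p + \<Gamma> a b s p * T c s d p + \<Gamma> a d s p * T c b s p) =
    (SUM s. - (\<Gamma> a b s p * T s c d p + \<Gamma> a c s p * T b s d p + \<Gamma> a d s p * T b c s p))"
  proof (rule sum.cong[OF refl])
    fix s
    show "\<Gamma> a c s p * T s b d p + \<Gamma> a b s p * T c s d p + \<Gamma> a d s p * T c b s p =
      - (\<Gamma> a b s p * T s c d p + \<Gamma> a c s p * T b s d p + \<Gamma> a d s p * T b c s p)"
      unfolding T_skew(1)[OF p, of b s d] T_skew(1)[OF p, of c s d] T_skew(1)[OF p, of c b s] by simp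
  qed
  then show "DT a c b d p = - DT a b c d p"
    unfolding DT_def sum_negf using dd_T_skew(1)[OF p, of a c b d] by linarith
  have "(SUM s. \<Gamma> a b s p * T s d c p + \<Gamma> a d s p * T b s c p + \<Gamma> a c s p * T b d s p) =
    (SUM s. - (\<Gamma> a b s p * T s c d p + \<Gamma> a c s p * T b s d p + \<Gamma> a d s p * T b c s p))"
  proof (rule sum.cong[OF refl])
    fix s
    show "\<Gamma> a b s p * T s d c p + \<Gamma> a d s p * T b s c p + \<Gamma> a c s p * T b d s p =
      - (\<Gamma> a b s p * T s c d p + \<Gamma> a c s p * T b s d p + \<Gamma> a d s p * T b c s p)"
      unfolding T_skew(2)[OF p, of s d c] T_skew(2)[OF p, of b d s] T_skew(2)[OF p, of b c s] by simp
  qed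
  then show "DT a b d c p = - DT a b c d p"
    unfolding DT_def sum_negf using dd_T_skew(2)[OF p, of a b d c] by linarith
qed

section \<open>The Jacobi, Bianchi and Ricci identities\<close>

lemma jacobi:
  "dd a (C b c s) p + dd b (C c a s) p + dd c (C a b s) p
    + (SUM r. C b c r p * C a r s p + C c a r p * C b r s p + C a b r p * C c r s p) = 0"
proof -
  note br = bracket[folded C_def]
  \<comment> \<open>The right-hand side is the double commutator of \<open>dd a\<close> with the
    commutator of \<open>dd b\<close> and \<open>dd c\<close>, applied to \<open>f\<close>; the
    left-hand side is its expression by structure functions.\<close>
  have jac: "(SUM s. (dd a (C b c s) p + (SUM r. C b c r p * C a r s p)) * dd s f p) =
      dd a (dd b (dd c f)) p - dd a (dd c (dd b f)) p - dd b (dd c (dd a f)) p + dd c (dd b (dd a f)) p"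
    if f: "sm f" for f a b c
  proof -
    have "dd a (\<lambda>q. dd b (dd c f) q - dd c (dd b f) q) p = dd a (\<lambda>q. SUM s. C b c s q * dd s f q) p"
      by (rule dd_cong[OF _ p]) (rule br[OF f])
    then have 1: "dd a (dd b (dd c f)) p - dd a (dd c (dd b f)) p =
       (SUM s. dd a (C b c s) p * dd s f p) + (SUM s. C b c s p * dd a (dd s f) p)"
      using f p by (simp add: dd_diff dd_sum dd_mult sm_dd sm_mult sm_C sum.distrib)
    have "dd b (dd c (dd a f)) p - dd c (dd b (dd a f)) p = (SUM s. C b c s p * dd s (dd a f) p)"
      by (rule br[OF sm_dd[OF f] p])
    moreover have "(SUM s. C b c s p * dd a (dd s f) p) - (SUM s. C b c s p * dd s (dd a f) p) =
       (SUM s. (SUM r. C b c r p * C a r s p) * dd s f p)"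
    proof -
      have "(SUM s. C b c s p * dd a (dd s f) p) - (SUM s. C b c s p * dd s (dd a f) p) =
        (SUM r. C b c r p * (dd a (dd r f) p - dd r (dd a f) p))"
        by (simp add: right_diff_distrib sum_subtractf)
      also have "\<dots> = (SUM r s. C b c r p * C a r s p * dd s f p)"
        by (simp add: br[OF f p] sum_distrib_left mult_ac)
      also have "\<dots> = (SUM s r. C b c r p * C a r s p * dd s f p)" by (rule sum.swap)
      finally show ?thesis by (simp add: sum_distrib_right)
    qed
    ultimately show ?thesis using 1 by (simp add: distrib_right sum.distrib)
  qed
  \<comment> \<open>The defect of the identity as the coefficients of a derivation. The cyclic sum
    of double commutators vanishes on every \<open>f\<close>, and independence of the frame
    derivations makes each coefficient vanish.\<close>
  define v where "v s = dd a (C b c s) p + dd b (C c a s) p + dd c (C a b s) p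
    + (SUM r. C b c r p * C a r s p + C c a r p * C b r s p + C a b r p * C c r s p)" for s
  have "(SUM s. v s * dd s f p) = 0" if f: "sm f" for f
  proof -
    have "(SUM s. v s * dd s f p) = (SUM s. (dd a (C b c s) p + (SUM r. C b c r p * C a r s p)) * dd s f p)
      + (SUM s. (dd b (C c a s) p + (SUM r. C c a r p * C b r s p)) * dd s f p)
      + (SUM s. (dd c (C a b s) p + (SUM r. C a b r p * C c r s p)) * dd s f p)"
      unfolding sum.distrib[symmetric] by (rule sum.cong) (simp_all add: v_def sum.distrib algebra_simps)
    then show ?thesis unfolding jac[OF f] by simp
  qed
  from dd_independent[OF p this] show ?thesis by (simp add: v_def)
qed

text \<open>The 4-form \<open>\<sigma>\<^sub>T\<close> quadratic in the torsion: half the sum over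
  \<open>r\<close> of the wedge square of the 2-form \<open>T r _ _\<close>.\<close>

definition \<sigma> where
  "\<sigma> a b c j = (SUM r. T a b r p * T r c j p + T b c r p * T r a j p + T c a r p * T r b j p)"

text \<open>The first Bianchi identity for a connection with skew torsion. The derivatives of
  \<Gamma> are eliminated by \<open>jacobi\<close>, since \<open>C\<close> contains their skew
  parts; the remaining quadratic terms agree for each value of the summation index.\<close>

lemma bianchi:
  "R a b c j p + R b c a j p + R c a b j p = DT a b c j p + DT b c a j p + DT c a b j p + \<sigma> a b c j"
proof -
  have dC: "dd e (C f h j) p = dd e (\<Gamma> f h j) p - dd e (\<Gamma> h f j) p - dd e (T f h j) p" for e f h
    unfolding C_def[abs_def] using p by (simp add: dd_diff sm_\<Gamma> sm_T sm_diff)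
  have "(SUM s. \<Gamma> b c s p * \<Gamma> a s j p - \<Gamma> a c s p * \<Gamma> b s j p - C a b s p * \<Gamma> s c j p)
     + (SUM s. \<Gamma> c a s p * \<Gamma> b s j p - \<Gamma> b a s p * \<Gamma> c s j p - C b c s p * \<Gamma> s a j p)
     + (SUM s. \<Gamma> a b s p * \<Gamma> c s j p - \<Gamma> c b s p * \<Gamma> a s j p - C c a s p * \<Gamma> s b j p)
     - (SUM r. C b c r p * C a r j p + C c a r p * C b r j p + C a b r p * C c r j p)
    = \<sigma> a b c j - (SUM s. \<Gamma> a b s p * T s c j p + \<Gamma> a c s p * T b s j p + \<Gamma> a j s p * T b c s p)
     - (SUM s. \<Gamma> b c s p * T s a j p + \<Gamma> b a s p * T c s j p + \<Gamma> b j s p * T c a s p)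
     - (SUM s. \<Gamma> c a s p * T s b j p + \<Gamma> c b s p * T a s j p + \<Gamma> c j s p * T a b s p)"
    unfolding \<sigma>_def sum.distrib[symmetric] sum_subtractf[symmetric]
  proof (rule sum.cong[OF refl])
    fix s
    show "\<Gamma> b c s p * \<Gamma> a s j p - \<Gamma> a c s p * \<Gamma> b s j p - C a b s p * \<Gamma> s c j p
     + (\<Gamma> c a s p * \<Gamma> b s j p - \<Gamma> b a s p * \<Gamma> c s j p - C b c s p * \<Gamma> s a j p)
     + (\<Gamma> a b s p * \<Gamma> c s j p - \<Gamma> c b s p * \<Gamma> a s j p - C c a s p * \<Gamma> s b j p)
     - (C b c s p * C a s j p + C c a s p * C b s j p + C a b s p * C c s j p)
    = T a b s p * T s c j p + T b c s p * T s a j p + T c a s p * T s b j p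
     - (\<Gamma> a b s p * T s c j p + \<Gamma> a c s p * T b s j p + \<Gamma> a j s p * T b c s p)
     - (\<Gamma> b c s p * T s a j p + \<Gamma> b a s p * T c s j p + \<Gamma> b j s p * T c a s p)
     - (\<Gamma> c a s p * T s b j p + \<Gamma> c b s p * T a s j p + \<Gamma> c j s p * T a b s p)"
      unfolding C_def \<Gamma>_skew[OF p, of a s j] \<Gamma>_skew[OF p, of b s j] \<Gamma>_skew[OF p, of c s j]
        T_skew(1)[OF p, of s a j] T_skew(1)[OF p, of s b j] T_skew(1)[OF p, of s c j]
      by (simp add: algebra_simps)
  qed
  then show ?thesis
    using jacobi[of a b c j] unfolding R_def DT_def dC by linarith
qed

lemma \<sigma>_skew: "\<sigma> b a c j = - \<sigma> a b c j" "\<sigma> a c b j = - \<sigma> a b c j" "\<sigma> a b j c = - \<sigma> a b c j"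
proof -
  note t1 = T_skew(1)[OF p] and t2 = T_skew(2)[OF p]
  show "\<sigma> b a c j = - \<sigma> a b c j"
    unfolding \<sigma>_def sum_negf[symmetric]
  proof (rule sum.cong[OF refl])
    fix r
    show "T b a r p * T r c j p + T a c r p * T r b j p + T c b r p * T r a j p =
      - (T a b r p * T r c j p + T b c r p * T r a j p + T c a r p * T r b j p)"
      unfolding t1[of b a r] t1[of c b r] t1[of c a r] by simp
  qed
  show "\<sigma> a c b j = - \<sigma> a b c j"
    unfolding \<sigma>_def sum_negf[symmetric]
  proof (rule sum.cong[OF refl])
    fix r
    show "T a c r p * T r b j p + T c b r p * T r a j p + T b a r p * T r c j p =
      - (T a b r p * T r c j p + T b c r p * T r a j p + T c a r p * T r b j p)"
      unfolding t1[of b a r] t1[of c b r] t1[of c a r] by simp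
  qed
  show "\<sigma> a b j c = - \<sigma> a b c j"
    unfolding \<sigma>_def sum_negf[symmetric]
  proof (rule sum.cong[OF refl])
    fix r
    have "T x y r p = T r x y p" for x y
      using t2[of x y r] t1[of x r y] by simp
    then show "T a b r p * T r j c p + T b j r p * T r a c p + T j a r p * T r b c p =
      - (T a b r p * T r c j p + T b c r p * T r a j p + T c a r p * T r b j p)"
      using t2[of r j c] t2[of r a c] t2[of r j a] by simp
  qed
qed

lemma R_minus_transpose:
  "2 * (R i j k l p - R k l i j p) = DT i j k l p - DT j i k l p - DT k l i j p + DT l k i j p"
  by (rule octahedron[where \<sigma> = \<sigma>, OF R_skew12 R_skew34 DT_skew \<sigma>_skew bianchi])

lemma S_sym: "S m l p = S l m p"
  unfolding S_def by (rule T_contraction_sym[OF p])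

text \<open>Contraction with \<open>phi0\<close> commutes with covariant differentiation because
  \<open>phi0\<close> is parallel. That is \<open>\<Gamma>_phi0\<close>, which moves the connection
  term from the free index \<open>m\<close> to the contracted indices.\<close>

lemma X_eq_DT: "X k l m p = (SUM a b. phi0 a b m * DT k l a b p)"
proof -
  have d: "dd k (S l m) p = (SUM a b. phi0 a b m * dd k (T l a b) p)"
    unfolding S_def[abs_def] using p by (simp add: dd_sum dd_cmult sm_sum sm_mult sm_const sm_T)
  have 1: "(SUM s. \<Gamma> k l s p * S s m p) = (SUM a b s. phi0 a b m * (\<Gamma> k l s p * T s a b p))"
  proof -
    have "(SUM s. \<Gamma> k l s p * S s m p) = (SUM s a b. phi0 a b m * (\<Gamma> k l s p * T s a b p))"
      by (simp add: S_def sum_distrib_left mult_ac)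
    also have "\<dots> = (SUM a s b. phi0 a b m * (\<Gamma> k l s p * T s a b p))" by (rule sum.swap)
    also have "\<dots> = (SUM a b s. phi0 a b m * (\<Gamma> k l s p * T s a b p))"
      by (rule sum.cong[OF refl], rule sum.swap)
    finally show ?thesis .
  qed
  have 2: "(SUM s. \<Gamma> k m s p * S l s p) = (SUM a b s. phi0 a b m * (\<Gamma> k a s p * T l s b p))
      + (SUM a b s. phi0 a b m * (\<Gamma> k b s p * T l a s p))"
  proof -
    have "(SUM s. \<Gamma> k m s p * S l s p) = (SUM s a b. T l a b p * (\<Gamma> k m s p * phi0 a b s))"
      by (simp add: S_def sum_distrib_left mult_ac)
    also have "\<dots> = (SUM a s b. T l a b p * (\<Gamma> k m s p * phi0 a b s))" by (rule sum.swap)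
    also have "\<dots> = (SUM a b s. T l a b p * (\<Gamma> k m s p * phi0 a b s))"
      by (rule sum.cong[OF refl], rule sum.swap)
    also have "\<dots> = (SUM a b. T l a b p * (SUM s. \<Gamma> k m s p * phi0 a b s))"
      by (simp add: sum_distrib_left)
    also have "\<dots> = (SUM a b. T l a b p * (- (SUM s. \<Gamma> k a s p * phi0 s b m) - (SUM s. \<Gamma> k b s p * phi0 a s m)))"
    proof (intro sum.cong refl)
      fix a b
      show "T l a b p * (SUM s. \<Gamma> k m s p * phi0 a b s) =
        T l a b p * (- (SUM s. \<Gamma> k a s p * phi0 s b m) - (SUM s. \<Gamma> k b s p * phi0 a s m))"
        using \<Gamma>_phi0[OF p, of k a b m] by (simp add: sum.distrib)
    qed
    also have "\<dots> = (SUM a b s. - (T l a b p * (\<Gamma> k a s p * phi0 s b m)))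
       + (SUM a b s. - (T l a b p * (\<Gamma> k b s p * phi0 a s m)))"
      by (simp add: right_diff_distrib sum_subtractf sum_negf sum_distrib_left)
    also have "(SUM a b s. - (T l a b p * (\<Gamma> k b s p * phi0 a s m))) =
       (SUM a s b. - (T l a b p * (\<Gamma> k b s p * phi0 a s m)))"
      by (rule sum.cong[OF refl], rule sum.swap)
    also have "\<dots> = (SUM a b s. phi0 a b m * (\<Gamma> k b s p * T l a s p))"
    proof (intro sum.cong refl)
      fix a b s
      show "- (T l a s p * (\<Gamma> k s b p * phi0 a b m)) = phi0 a b m * (\<Gamma> k b s p * T l a s p)"
        unfolding \<Gamma>_skew[OF p, of k s b] by simp
    qed
    also have "(SUM a b s. - (T l a b p * (\<Gamma> k a s p * phi0 s b m))) =
       (SUM a s b. - (T l a b p * (\<Gamma> k a s p * phi0 s b m)))"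
      by (rule sum.cong[OF refl], rule sum.swap)
    also have "\<dots> = (SUM s a b. - (T l a b p * (\<Gamma> k a s p * phi0 s b m)))" by (rule sum.swap)
    also have "\<dots> = (SUM s b a. - (T l a b p * (\<Gamma> k a s p * phi0 s b m)))"
      by (rule sum.cong[OF refl], rule sum.swap)
    also have "\<dots> = (SUM a b s. phi0 a b m * (\<Gamma> k a s p * T l s b p))"
    proof (intro sum.cong refl)
      fix a b s
      show "- (T l s b p * (\<Gamma> k s a p * phi0 a b m)) = phi0 a b m * (\<Gamma> k a s p * T l s b p)"
        unfolding \<Gamma>_skew[OF p, of k s a] by simp
    qed
    finally show ?thesis .
  qed
  show ?thesis
    unfolding X_def DT_def sum.distrib d 1 2
    by (simp add: right_diff_distrib distrib_left sum_subtractf sum.distrib sum_distrib_left)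
qed

text \<open>Second covariant derivatives commute up to the action of the curvature on each index of
  \<open>S\<close> and a derivative in the direction of the torsion. All sums are brought to a
  common shape, so that the end of the proof is linear in them.\<close>

lemma ricci:
  "Y i k j l p - Y k i j l p = - (SUM s. R i k j s p * S s l p + R i k l s p * S j s p + T i k s p * X s j l p)"
proof -
  define dS where "dS i j l = dd i (S j l) p" for i j l
  define G where "G i j l = \<Gamma> i j l p" for i j l
  define s0 where "s0 j l = S j l p" for j l
  define x0 where "x0 i j l = X i j l p" for i j l
  have X0: "x0 k j l = dS k j l - (SUM t. G k j t * s0 t l) - (SUM t. G k l t * s0 j t)" for k j l
    by (simp add: x0_def X_def dS_def G_def s0_def sum.distrib)
  have dX: "dd i (X k j l) p = dd i (dd k (S j l)) p
     - (SUM s. dd i (\<Gamma> k j s) p * s0 s l) - (SUM s. G k j s * dS i s l)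
     - (SUM s. dd i (\<Gamma> k l s) p * s0 j s) - (SUM s. G k l s * dS i j s)" for i k
    unfolding X_def[abs_def] using p
    by (simp add: dd_diff dd_sum dd_add dd_mult sm_dd sm_S sm_sum sm_add sm_mult sm_\<Gamma> sum.distrib
        dS_def G_def s0_def)
  have Yx: "Y i k j l p = dd i (dd k (S j l)) p
     - (SUM s. dd i (\<Gamma> k j s) p * s0 s l) - (SUM s. dd i (\<Gamma> k l s) p * s0 j s)
     - (SUM s. G k j s * dS i s l) - (SUM s. G k l s * dS i j s)
     - (SUM s. G i j s * dS k s l) - (SUM s. G i l s * dS k j s)
     - (SUM s. G i k s * x0 s j l)
     + (SUM s t. G i j s * G k s t * s0 t l) + (SUM s t. G i j s * G k l t * s0 s t)
     + (SUM s t. G i l s * G k j t * s0 t s) + (SUM s t. G i l s * G k s t * s0 j t)" for i k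
  proof -
    have "(SUM s. G i j s * x0 k s l) = (SUM s. G i j s * dS k s l)
      - (SUM s t. G i j s * G k s t * s0 t l) - (SUM s t. G i j s * G k l t * s0 s t)"
      unfolding X0 by (simp add: right_diff_distrib sum_subtractf sum_distrib_left mult_ac)
    moreover have "(SUM s. G i l s * x0 k j s) = (SUM s. G i l s * dS k j s)
      - (SUM s t. G i l s * G k j t * s0 t s) - (SUM s t. G i l s * G k s t * s0 j t)"
      unfolding X0 by (simp add: right_diff_distrib sum_subtractf sum_distrib_left mult_ac)
    ultimately show ?thesis
      unfolding Y_def dX by (simp add: sum.distrib G_def[symmetric] x0_def[symmetric])
  qed
  have br: "dd i (dd k (S j l)) p - dd k (dd i (S j l)) p = (SUM s. C i k s p * x0 s j l)
     + (SUM s t. C i k s p * G s j t * s0 t l) + (SUM s t. C i k s p * G s l t * s0 j t)"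
  proof -
    have "dd i (dd k (S j l)) p - dd k (dd i (S j l)) p = (SUM s. C i k s p * dS s j l)"
      using bracket[OF sm_S p, folded C_def] by (simp add: dS_def)
    then show ?thesis
      unfolding X0 by (simp add: right_diff_distrib sum_subtractf sum_distrib_left mult_ac)
  qed
  have R0: "R i k j t p = dd i (\<Gamma> k j t) p - dd k (\<Gamma> i j t) p
     + (SUM s. G k j s * G i s t) - (SUM s. G i j s * G k s t) - (SUM s. C i k s p * G s j t)" for j t
    by (simp add: R_def G_def sum_subtractf)
  have R1: "(SUM t. R i k j t p * s0 t l) = (SUM s. dd i (\<Gamma> k j s) p * s0 s l) - (SUM s. dd k (\<Gamma> i j s) p * s0 s l)
     + (SUM s t. G k j s * G i s t * s0 t l) - (SUM s t. G i j s * G k s t * s0 t l)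
     - (SUM s t. C i k s p * G s j t * s0 t l)"
  proof -
    have "(SUM t. R i k j t p * s0 t l) = (SUM s. dd i (\<Gamma> k j s) p * s0 s l) - (SUM s. dd k (\<Gamma> i j s) p * s0 s l)
     + (SUM t s. G k j s * G i s t * s0 t l) - (SUM t s. G i j s * G k s t * s0 t l)
     - (SUM t s. C i k s p * G s j t * s0 t l)"
      unfolding R0 by (simp add: left_diff_distrib distrib_right sum.distrib sum_subtractf sum_distrib_right)
    then show ?thesis
      unfolding sum.swap[of "\<lambda>t s. G k j s * G i s t * s0 t l"] sum.swap[of "\<lambda>t s. G i j s * G k s t * s0 t l"]
        sum.swap[of "\<lambda>t s. C i k s p * G s j t * s0 t l"] .
  qed
  have R2: "(SUM t. R i k l t p * s0 j t) = (SUM s. dd i (\<Gamma> k l s) p * s0 j s) - (SUM s. dd k (\<Gamma> i l s) p * s0 j s)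
     + (SUM s t. G k l s * G i s t * s0 j t) - (SUM s t. G i l s * G k s t * s0 j t)
     - (SUM s t. C i k s p * G s l t * s0 j t)"
  proof -
    have "(SUM t. R i k l t p * s0 j t) = (SUM s. dd i (\<Gamma> k l s) p * s0 j s) - (SUM s. dd k (\<Gamma> i l s) p * s0 j s)
     + (SUM t s. G k l s * G i s t * s0 j t) - (SUM t s. G i l s * G k s t * s0 j t)
     - (SUM t s. C i k s p * G s l t * s0 j t)"
      unfolding R0 by (simp add: left_diff_distrib distrib_right sum.distrib sum_subtractf sum_distrib_right)
    then show ?thesis
      unfolding sum.swap[of "\<lambda>t s. G k l s * G i s t * s0 j t"] sum.swap[of "\<lambda>t s. G i l s * G k s t * s0 j t"]
        sum.swap[of "\<lambda>t s. C i k s p * G s l t * s0 j t"] .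
  qed
  \<comment> \<open>The mixed quadratic terms, with one \<Gamma> acting on each index of
    \<open>S\<close>; they cancel when \<open>i\<close> and \<open>k\<close> are
    antisymmetrized.\<close>
  have cross: "(SUM s t. G i l s * G k j t * s0 t s) = (SUM s t. G k j s * G i l t * s0 s t)" for i k
    by (subst sum.swap) (simp add: mult_ac)
  have tor: "(SUM s. G i k s * x0 s j l) - (SUM s. G k i s * x0 s j l) - (SUM s. C i k s p * x0 s j l) =
      (SUM s. T i k s p * x0 s j l)"
    unfolding sum_subtractf[symmetric] by (rule sum.cong) (simp_all add: C_def G_def algebra_simps)
  show ?thesis
    unfolding sum.distrib s0_def[symmetric] x0_def[symmetric] R1 R2 tor[symmetric]
    using Yx[of i k] Yx[of k i] br cross[of i k] cross[of k i] by linarith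
qed

end

end

section \<open>Vanishing of \<open>\<nabla>S\<close> and \<open>\<nabla>T\<close> under the
  instanton condition\<close>

locale g2_instanton_frame = g2_frame +
  assumes instanton: "p \<in> V \<Longrightarrow> (SUM a b. phi0 a b k * R a b i j p) = 0"
begin

lemma DT_contraction:
  assumes p: "p \<in> V"
  shows "2 * (SUM i j. phi0 i j m * DT i j k l p) = X k l m p - X l k m p"
proof -
  have "(SUM i j. phi0 i j m * R k l i j p) = 0" by (rule R_in_g2[OF p])
  then have "(SUM i j. phi0 i j m * (2 * (R i j k l p - R k l i j p))) = 0"
    using instanton[OF p, of m k l]
    by (simp add: right_diff_distrib sum_subtractf mult.left_commute[of _ 2] sum_distrib_left[symmetric])
  then have z: "(SUM i j. phi0 i j m * (DT i j k l p - DT j i k l p - DT k l i j p + DT l k i j p)) = 0"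
    by (simp only: R_minus_transpose[OF p])
  have sw: "(SUM i j. phi0 i j m * DT j i k l p) = - (SUM i j. phi0 i j m * DT i j k l p)"
  proof -
    have "(SUM i j. phi0 i j m * DT j i k l p) = (SUM j i. phi0 i j m * DT j i k l p)"
      by (rule sum.swap)
    also have "\<dots> = (SUM j i. - (phi0 j i m * DT j i k l p))"
      by (intro sum.cong refl) (subst phi0_skew12, simp)
    finally show ?thesis by (simp add: sum_negf)
  qed
  show ?thesis
    using z sw unfolding X_eq_DT[OF p]
    by (simp add: right_diff_distrib distrib_left sum_subtractf sum.distrib)
qed

lemma X_sym:
  assumes p: "p \<in> V"
  shows "X l k m p = X k l m p" "X k m l p = X k l m p" "(SUM l. X k l l p) = 0"
proof -
  have s: "X k m l p = X k l m p" for k l m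
  proof -
    have "dd k (S m l) p = dd k (S l m) p" by (rule dd_cong[OF _ p]) (rule S_sym)
    then show ?thesis by (simp add: X_def S_sym[OF p, of m] add.commute S_sym[OF p, of _ l])
  qed
  show "X k m l p = X k l m p" by (rule s)
  note lin = skew_torsion_linear[where x = "\<lambda>i j k l. DT i j k l p", folded X_eq_DT[OF p],
      OF DT_skew[OF p] s DT_contraction[OF p]]
  show "X l k m p = X k l m p" by (rule lin(1))
  show "(SUM l. X k l l p) = 0" by (rule lin(2))
qed

lemma Y_sym:
  assumes p: "p \<in> V"
  shows "Y i j k l p = Y i k j l p" "Y i k l j p = Y i k j l p" "(SUM l. Y i k l l p) = 0"
proof -
  have "dd i (X j k l) p = dd i (X k j l) p" by (rule dd_cong[OF _ p]) (rule X_sym)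
  then show "Y i j k l p = Y i k j l p"
    by (simp add: Y_def X_sym(1)[OF p, of j] X_sym(1)[OF p, of _ k] add_ac)
  have "dd i (X k l j) p = dd i (X k j l) p" by (rule dd_cong[OF _ p]) (rule X_sym)
  then show "Y i k l j p = Y i k j l p"
    by (simp add: Y_def X_sym(2)[OF p, of _ l j] X_sym(2)[OF p, of _ _ j] X_sym(2)[OF p, of _ l] add_ac)
  have "dd i (\<lambda>p. SUM l. X k l l p) p = dd i (\<lambda>p. 0) p" by (rule dd_cong[OF _ p]) (rule X_sym(3))
  then have "(SUM l. dd i (X k l l) p) = 0" using p by (simp add: dd_sum sm_X dd_const)
  moreover have "(SUM l s. \<Gamma> i k s p * X s l l p) = 0"
    by (subst sum.swap) (simp add: sum_distrib_left[symmetric] X_sym(3)[OF p])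
  moreover have "(SUM l s. \<Gamma> i l s p * (X k s l p + X k l s p)) = 0"
  proof (rule skew_sum2)
    fix l s
    show "\<Gamma> i s l p * (X k l s p + X k s l p) = - (\<Gamma> i l s p * (X k s l p + X k l s p))"
      unfolding \<Gamma>_skew[OF p, of i s l] by (simp add: algebra_simps)
  qed
  ultimately show "(SUM l. Y i k l l p) = 0"
    by (simp add: Y_def sum_subtractf sum.distrib distrib_left)
qed

text \<open>The instanton condition removes the curvature on both indices of \<open>S\<close>. In
  the torsion term, cyclic symmetry of \<open>T\<close> makes the contraction with
  \<open>phi0\<close> equal to \<open>S s m\<close>.\<close>

lemma contracted_ricci:
  assumes p: "p \<in> V"
  shows "(SUM i j. phi0 i j m * (Y i j k l p - Y j i k l p)) = - (SUM s. S s m p * X s k l p)"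
proof -
  have a: "(SUM i j s. phi0 i j m * (R i j k s p * S s l p)) = 0" for k l
  proof -
    have "(SUM i j s. phi0 i j m * (R i j k s p * S s l p)) =
        (SUM i s j. phi0 i j m * (R i j k s p * S s l p))"
      by (rule sum.cong[OF refl], rule sum.swap)
    also have "\<dots> = (SUM s i j. phi0 i j m * (R i j k s p * S s l p))" by (rule sum.swap)
    also have "\<dots> = (SUM s. S s l p * (SUM i j. phi0 i j m * R i j k s p))"
      by (simp add: sum_distrib_left mult_ac)
    finally show ?thesis by (simp add: instanton[OF p])
  qed
  have b: "(SUM i j s. phi0 i j m * (T i j s p * X s k l p)) = (SUM s. S s m p * X s k l p)"
  proof -
    have cyc: "T i j s p = T s i j p" for i j s
      using T_skew(2)[OF p, of i s j] T_skew(1)[OF p, of i s j] by simp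
    have "(SUM i j s. phi0 i j m * (T i j s p * X s k l p)) =
        (SUM i s j. phi0 i j m * (T i j s p * X s k l p))"
      by (rule sum.cong[OF refl], rule sum.swap)
    also have "\<dots> = (SUM s i j. phi0 i j m * (T i j s p * X s k l p))" by (rule sum.swap)
    finally show ?thesis by (simp add: S_def cyc sum_distrib_left mult_ac)
  qed
  have "(SUM i j. phi0 i j m * (Y i j k l p - Y j i k l p)) =
     - ((SUM i j s. phi0 i j m * (R i j k s p * S s l p))
      + (SUM i j s. phi0 i j m * (R i j l s p * S k s p))
      + (SUM i j s. phi0 i j m * (T i j s p * X s k l p)))"
    unfolding ricci[OF p]
    by (simp add: sum_negf sum.distrib sum_subtractf distrib_left right_diff_distrib sum_distrib_left)
  then show ?thesis unfolding S_sym[OF p, of k] a b by simp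
qed

lemma S_X_contraction:
  assumes p: "p \<in> V"
  shows "(SUM s m. S s m p * X s k m p) = 0" and "(SUM k l. S k l p * (SUM i. Y i i k l p)) = 0"
  using contracted_ricci_consequences[where S = "\<lambda>i j. S i j p" and X = "\<lambda>i j k. X i j k p"
      and Y = "\<lambda>i j k l. Y i j k l p", OF S_sym[OF p] X_sym(1,2)[OF p] Y_sym[OF p] contracted_ricci[OF p]]
  by blast+

lemma X_zero:
  assumes p: "p \<in> V"
  shows "X i k m p = 0"
proof -
  text \<open>The divergence of \<open>S\<^sub>s\<^sub>m \<nabla>\<^sub>s S\<^sub>k\<^sub>m = 0\<close> is \<open>\<bar>\<nabla>S\<bar>\<^sup>2 + S\<^sub>s\<^sub>m \<nabla>\<^sub>i \<nabla>\<^sub>i S\<^sub>s\<^sub>m\<close>, and the second term vanishes.\<close>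
  have "dd i (\<lambda>p. SUM s m. S s m p * X s k m p) p = dd i (\<lambda>p. 0) p" for i k
    by (rule dd_cong[OF _ p]) (rule S_X_contraction)
  then have d: "(SUM s m. dd i (S s m) p * X s k m p + S s m p * dd i (X s k m) p) = 0" for i k
    using p by (simp add: dd_sum dd_mult sm_sum sm_mult sm_S sm_X dd_const)
  have dS: "dd i (S s m) p = X i s m p + (SUM t. \<Gamma> i s t p * S t m p) + (SUM t. \<Gamma> i m t p * S s t p)" for i s m
    by (simp add: X_def sum.distrib)
  have dX: "dd i (X s k m) p = Y i s k m p + (SUM t. \<Gamma> i s t p * X t k m p) + (SUM t. \<Gamma> i k t p * X s t m p)
     + (SUM t. \<Gamma> i m t p * X s k t p)" for i s k m
    by (simp add: Y_def sum.distrib)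
  \<comment> \<open>Here and in \<open>c2\<close> the connection terms of the summed indices
    \<open>s\<close> and \<open>m\<close> cancel by skewness of \<Gamma>. The one of the free index
    \<open>k\<close>, in \<open>c3\<close>, is a combination of contractions that already
    vanish.\<close>
  have c1: "(SUM s m. (SUM t. \<Gamma> i s t p * S t m p) * X s k m p)
     + (SUM s m. S s m p * (SUM t. \<Gamma> i s t p * X t k m p)) = 0" for i k
  proof -
    have "(SUM s t. (SUM m. \<Gamma> i s t p * (S t m p * X s k m p + S s m p * X t k m p))) = 0"
    proof (rule skew_sum2)
      fix s t
      show "(SUM m. \<Gamma> i t s p * (S s m p * X t k m p + S t m p * X s k m p)) =
        - (SUM m. \<Gamma> i s t p * (S t m p * X s k m p + S s m p * X t k m p))"
        unfolding \<Gamma>_skew[OF p, of i t s] sum_negf[symmetric] by (simp add: add.commute)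
    qed
    moreover have "(SUM s m. (SUM t. \<Gamma> i s t p * S t m p) * X s k m p) =
        (SUM s t m. \<Gamma> i s t p * (S t m p * X s k m p))"
      unfolding sum_distrib_right mult.assoc by (rule sum.cong[OF refl], rule sum.swap)
    moreover have "(SUM s m. S s m p * (SUM t. \<Gamma> i s t p * X t k m p)) =
        (SUM s t m. \<Gamma> i s t p * (S s m p * X t k m p))"
      unfolding sum_distrib_left mult.left_commute[of "S _ _ _"] by (rule sum.cong[OF refl], rule sum.swap)
    ultimately show ?thesis by (simp add: distrib_left sum.distrib)
  qed
  have c2: "(SUM s m. (SUM t. \<Gamma> i m t p * S s t p) * X s k m p)
     + (SUM s m. S s m p * (SUM t. \<Gamma> i m t p * X s k t p)) = 0" for i k
  proof -
    have "(SUM m t. \<Gamma> i m t p * (S s t p * X s k m p + S s m p * X s k t p)) = 0" for s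
    proof (rule skew_sum2)
      fix m t
      show "\<Gamma> i t m p * (S s m p * X s k t p + S s t p * X s k m p) =
        - (\<Gamma> i m t p * (S s t p * X s k m p + S s m p * X s k t p))"
        unfolding \<Gamma>_skew[OF p, of i t m] by (simp add: algebra_simps)
    qed
    then have "(SUM s m t. \<Gamma> i m t p * (S s t p * X s k m p + S s m p * X s k t p)) = 0" by simp
    then show ?thesis
      by (simp add: distrib_left sum.distrib sum_distrib_left sum_distrib_right mult_ac)
  qed
  have c3: "(SUM s m. S s m p * (SUM t. \<Gamma> i k t p * X s t m p)) = 0" for i k
  proof -
    have "(SUM s m. S s m p * (SUM t. \<Gamma> i k t p * X s t m p)) =
      (SUM s m t. \<Gamma> i k t p * (S s m p * X s t m p))"
      by (simp add: sum_distrib_left mult_ac)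
    also have "\<dots> = (SUM s t m. \<Gamma> i k t p * (S s m p * X s t m p))"
      by (rule sum.cong[OF refl], rule sum.swap)
    also have "\<dots> = (SUM t s m. \<Gamma> i k t p * (S s m p * X s t m p))" by (rule sum.swap)
    also have "\<dots> = 0"
      by (simp add: sum_distrib_left[symmetric] S_X_contraction(1)[OF p])
    finally show ?thesis .
  qed
  have e: "(SUM s m. X i s m p * X s k m p) + (SUM s m. S s m p * Y i s k m p) = 0" for i k
    using d[of i k] c1[of i k] c2[of i k] c3[of i k] unfolding dS dX
    by (simp add: distrib_left distrib_right sum.distrib)
  have "(SUM i s m. X i s m p * X s i m p) + (SUM i s m. S s m p * Y i s i m p) = 0"
    unfolding sum.distrib[symmetric] using e by (simp add: sum.distrib)
  moreover have "(SUM i s m. S s m p * Y i s i m p) = (SUM s m. S s m p * (SUM i. Y i i s m p))"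
  proof -
    have "(SUM i s m. S s m p * Y i s i m p) = (SUM s i m. S s m p * Y i s i m p)" by (rule sum.swap)
    also have "\<dots> = (SUM s m i. S s m p * Y i s i m p)"
      by (rule sum.cong[OF refl], rule sum.swap)
    also have "\<dots> = (SUM s m i. S s m p * Y i i s m p)"
      by (intro sum.cong refl) (simp add: Y_sym(1)[OF p])
    finally show ?thesis by (simp add: sum_distrib_left)
  qed
  ultimately have "(SUM i s m. X i s m p * X s i m p) = 0"
    using S_X_contraction(2)[OF p] by simp
  moreover have "(SUM i s m. X i s m p * X s i m p) = (SUM i s m. (X i s m p)\<^sup>2)"
    by (intro sum.cong refl) (simp add: X_sym(1)[OF p, of _ i for i] power2_eq_square)
  ultimately have "(SUM i s m. (X i s m p)\<^sup>2) = 0" by simp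
  then show ?thesis by (simp add: sum_nonneg_eq_0_iff sum_nonneg)
qed

theorem DT_zero:
  assumes p: "p \<in> V"
  shows "DT d a b c p = 0"
  by (rule skew_zero_if_phi0_contraction_zero[where t = "\<lambda>a b c. DT d a b c p", OF DT_skew[OF p]])
    (metis X_eq_DT[OF p] X_zero[OF p])

end

section \<open>Smooth functions on Euclidean space\<close>

lemma linear_euclidean_sum:
  fixes L :: "'a::euclidean_space \<Rightarrow> 'b::real_vector"
  assumes "linear L"
  shows "(\<Sum>b\<in>Basis. (v \<bullet> b) *\<^sub>R L b) = L v"
proof -
  have "L v = L (\<Sum>b\<in>Basis. (v \<bullet> b) *\<^sub>R b)" by (simp only: euclidean_representation)
  also have "\<dots> = (\<Sum>b\<in>Basis. (v \<bullet> b) *\<^sub>R L b)"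
    by (simp add: linear_sum[OF assms] linear_scale[OF assms])
  finally show ?thesis ..
qed

section \<open>Closure properties of smooth maps\<close>

lemma Ck_on_cong:
  assumes "open S" "Ck_on k f S" "\<And>x. x \<in> S \<Longrightarrow> f x = g x"
  shows "Ck_on k g S"
  using assms(2,3)
proof (induction k arbitrary: f g)
  case 0
  then show ?case using continuous_on_cong by fastforce
next
  case (Suc k)
  have d: "(g has_derivative frechet_derivative f (at x)) (at x)" if "x \<in> S" for x
  proof (rule has_derivative_transform_within_open[OF _ assms(1) that])
    show "(f has_derivative frechet_derivative f (at x)) (at x)"
      using Suc.prems(1) that frechet_derivative_works by auto
  qed (use Suc.prems(2) in auto)
  have e: "frechet_derivative g (at x) = frechet_derivative f (at x)" if "x \<in> S" for x
    using frechet_derivative_at[OF d[OF that]] by simp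
  have "Ck_on k (\<lambda>x. frechet_derivative g (at x) b) S" if "b \<in> Basis" for b
    by (rule Suc.IH[of "\<lambda>x. frechet_derivative f (at x) b"]) (use Suc.prems(1) that e in auto)
  then show ?case using d by (auto simp: differentiable_def)
qed

text \<open>Lets the derivative be given by any formula, whereas the definition of
  \<open>Ck_on\<close> refers to the selected \<open>frechet_derivative\<close>.\<close>

lemma Ck_on_SucI:
  assumes "open S" "\<And>x. x \<in> S \<Longrightarrow> (f has_derivative f' x) (at x)"
    and "\<And>b. b \<in> Basis \<Longrightarrow> Ck_on k (\<lambda>x. f' x b) S"
  shows "Ck_on (Suc k) f S"
proof -
  have "Ck_on k (\<lambda>x. frechet_derivative f (at x) b) S" if "b \<in> Basis" for b
    by (rule Ck_on_cong[OF assms(1) assms(3)[OF that]]) (metis assms(2) frechet_derivative_at)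
  then show ?thesis
    using assms(2) by (auto simp: differentiable_def)
qed

lemma Ck_on_subset: "Ck_on k f S \<Longrightarrow> T \<subseteq> S \<Longrightarrow> Ck_on k f T"
  by (induction k arbitrary: f) (auto intro: continuous_on_subset)

lemma Ck_on_local:
  assumes "\<And>x. x \<in> S \<Longrightarrow> \<exists>U. open U \<and> x \<in> U \<and> Ck_on k f U"
  shows "Ck_on k f S"
  using assms
proof (induction k arbitrary: f)
  case 0
  then show ?case
    by (metis Ck_on.simps(1) continuous_at_imp_continuous_on continuous_on_eq_continuous_at)
next
  case (Suc k)
  show ?case
    by (auto intro!: Suc.IH) (use Suc.prems in fastforce)+
qed

lemma Ck_on_SucD: "Ck_on (Suc k) f S \<Longrightarrow> Ck_on k f S"
  by (induction k arbitrary: f)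
    (auto intro!: continuous_at_imp_continuous_on differentiable_imp_continuous_within)

lemma Ck_on_const: "open S \<Longrightarrow> Ck_on k (\<lambda>x. c) S"
  by (induction k arbitrary: c) (auto simp: frechet_derivative_const)

lemma Ck_on_bounded_linear: "open S \<Longrightarrow> bounded_linear f \<Longrightarrow> Ck_on k f S"
proof (cases k)
  case 0
  then show "bounded_linear f \<Longrightarrow> ?thesis" by (simp add: linear_continuous_on)
next
  case (Suc j)
  assume "open S" "bounded_linear f"
  then show ?thesis unfolding Suc
    by (intro Ck_on_SucI) (auto intro: bounded_linear_imp_has_derivative Ck_on_const)
qed

lemma Ck_on_add:
  assumes "open S" "Ck_on k f S" "Ck_on k g S"
  shows "Ck_on k (\<lambda>x. f x + g x) S"
  using assms(2,3)
proof (induction k arbitrary: f g)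
  case (Suc k)
  show ?case
    by (rule Ck_on_SucI[OF assms(1), where f' = "\<lambda>x b. frechet_derivative f (at x) b + frechet_derivative g (at x) b"])
      (use Suc in \<open>auto simp: frechet_derivative_works[symmetric] intro!: has_derivative_add\<close>)
qed (auto intro: continuous_intros)

lemma Ck_on_bilinear:
  assumes "bounded_bilinear pr" and "open S" "Ck_on k f S" "Ck_on k g S"
  shows "Ck_on k (\<lambda>x. pr (f x) (g x)) S"
  using assms(3,4)
proof (induction k arbitrary: f g)
  case 0
  then show ?case using bounded_bilinear.continuous_on[OF assms(1)] by auto
next
  case (Suc k)
  note s = Ck_on_SucD[OF Suc.prems(1)] Ck_on_SucD[OF Suc.prems(2)]
  show ?case
    by (rule Ck_on_SucI[OF assms(2), where f' = "\<lambda>x b. pr (f x) (frechet_derivative g (at x) b)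
         + pr (frechet_derivative f (at x) b) (g x)"])
      (use Suc s in \<open>auto simp: frechet_derivative_works[symmetric]
          intro!: bounded_bilinear.FDERIV[OF assms(1)] Ck_on_add[OF assms(2)]\<close>)
qed

lemma Ck_on_sum:
  assumes "open S" "\<And>i. i \<in> I \<Longrightarrow> Ck_on k (f i) S"
  shows "Ck_on k (\<lambda>x. \<Sum>i\<in>I. f i x) S"
  using assms(2) by (induction I rule: infinite_finite_induct) (auto intro: Ck_on_const Ck_on_add assms(1))

lemma Ck_on_linear_compose:
  assumes "bounded_linear L" "open S" "Ck_on k f S"
  shows "Ck_on k (\<lambda>x. L (f x)) S"
  using assms(3)
proof (induction k arbitrary: f)
  case 0
  then show ?case using bounded_linear.continuous_on[OF assms(1)] by auto
next
  case (Suc k)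
  show ?case
    by (rule Ck_on_SucI[OF assms(2), where f' = "\<lambda>x b. L (frechet_derivative f (at x) b)"])
      (use Suc in \<open>auto simp: frechet_derivative_works[symmetric] intro!: bounded_linear.has_derivative[OF assms(1)]\<close>)
qed

lemma Ck_on_inverse:
  fixes f :: "'a::euclidean_space \<Rightarrow> real"
  assumes "open S" "Ck_on k f S" "\<And>x. x \<in> S \<Longrightarrow> f x \<noteq> 0"
  shows "Ck_on k (\<lambda>x. inverse (f x)) S"
  using assms(2)
proof (induction k)
  case 0
  then show ?case using assms(3) by (auto intro: continuous_intros)
next
  case (Suc k)
  have i: "Ck_on k (\<lambda>x. inverse (f x)) S" using Suc Ck_on_SucD by blast
  have "Ck_on k (\<lambda>x. - (inverse (f x) * frechet_derivative f (at x) b * inverse (f x))) S" if "b \<in> Basis" for b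
    using Suc.prems that i assms(1)
    by (intro Ck_on_linear_compose[OF bounded_linear_minus[OF bounded_linear_ident]]
        Ck_on_bilinear[OF bounded_bilinear_mult]) auto
  then show ?case
    by (intro Ck_on_SucI[OF assms(1), where f' = "\<lambda>x b. - (inverse (f x) * frechet_derivative f (at x) b * inverse (f x))"])
      (use Suc.prems assms(3) in \<open>auto simp: frechet_derivative_works[symmetric] intro!: has_derivative_inverse\<close>)
qed

text \<open>The chain rule has the derivative of \<open>f\<close> in a direction that varies with
  the point. Expanding this direction in the basis leaves derivatives of \<open>f\<close> in fixed
  directions composed with \<open>g\<close>, to which the induction hypothesis for other
  \<open>f\<close> applies.\<close>

lemma Ck_on_compose:
  fixes f :: "'b::euclidean_space \<Rightarrow> 'c::real_normed_vector" and g :: "'a::euclidean_space \<Rightarrow> 'b"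
  assumes "open S" "open T" "g ` S \<subseteq> T" "Ck_on k f T" "Ck_on k g S"
  shows "Ck_on k (\<lambda>x. f (g x)) S"
  using assms(4,5)
proof (induction k arbitrary: f)
  case 0
  then show ?case using assms(3) by (auto intro: continuous_on_compose2)
next
  case (Suc k)
  note gk = Ck_on_SucD[OF Suc.prems(2)]
  have d: "((\<lambda>x. f (g x)) has_derivative
      (\<lambda>b. frechet_derivative f (at (g x)) (frechet_derivative g (at x) b))) (at x)" if "x \<in> S" for x
  proof (rule has_derivative_compose[of g _ x UNIV f])
    show "(g has_derivative frechet_derivative g (at x)) (at x)"
      using Suc.prems(2) that frechet_derivative_works by auto
    show "(f has_derivative frechet_derivative f (at (g x))) (at (g x))"
      using Suc.prems(1) that assms(3) frechet_derivative_works by auto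
  qed
  have e: "frechet_derivative f (at (g x)) (frechet_derivative g (at x) b) =
     (\<Sum>i\<in>Basis. (frechet_derivative g (at x) b \<bullet> i) *\<^sub>R frechet_derivative f (at (g x)) i)"
    if "x \<in> S" for x b
  proof -
    have "linear (frechet_derivative f (at (g x)))"
      using Suc.prems(1) that assms(3) by (intro linear_frechet_derivative) auto
    then show ?thesis by (simp add: linear_euclidean_sum)
  qed
  show ?case
  proof (rule Ck_on_SucI[OF assms(1) d])
    fix b :: 'a assume b: "b \<in> Basis"
    have "Ck_on k (\<lambda>x. \<Sum>i\<in>Basis. (frechet_derivative g (at x) b \<bullet> i) *\<^sub>R frechet_derivative f (at (g x)) i) S"
      using Suc gk b
      by (intro Ck_on_sum assms(1) Ck_on_bilinear[OF bounded_bilinear_scaleR]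
        Ck_on_linear_compose[OF bounded_linear_inner_left]) auto
    then show "Ck_on k (\<lambda>x. frechet_derivative f (at (g x)) (frechet_derivative g (at x) b)) S"
      by (rule Ck_on_cong[OF assms(1)]) (simp add: e)
  qed
qed

lemma smooth_on_cong: "open S \<Longrightarrow> smooth_on S f \<Longrightarrow> (\<And>x. x \<in> S \<Longrightarrow> f x = g x) \<Longrightarrow> smooth_on S g"
  unfolding smooth_on_def by (blast intro: Ck_on_cong)

lemma smooth_on_subset: "smooth_on S f \<Longrightarrow> T \<subseteq> S \<Longrightarrow> smooth_on T f"
  unfolding smooth_on_def by (blast intro: Ck_on_subset)

lemma smooth_on_local:
  assumes "\<And>x. x \<in> S \<Longrightarrow> \<exists>U. open U \<and> x \<in> U \<and> smooth_on U f"
  shows "smooth_on S f"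
  unfolding smooth_on_def
proof
  fix k
  show "Ck_on k f S" by (rule Ck_on_local) (use assms in \<open>meson smooth_on_def\<close>)
qed

lemma smooth_on_const: "open S \<Longrightarrow> smooth_on S (\<lambda>x. c)"
  unfolding smooth_on_def by (blast intro: Ck_on_const)

lemma smooth_on_bounded_linear: "open S \<Longrightarrow> bounded_linear f \<Longrightarrow> smooth_on S f"
  unfolding smooth_on_def by (blast intro: Ck_on_bounded_linear)

lemma smooth_on_add: "open S \<Longrightarrow> smooth_on S f \<Longrightarrow> smooth_on S g \<Longrightarrow> smooth_on S (\<lambda>x. f x + g x)"
  unfolding smooth_on_def by (blast intro: Ck_on_add)

lemma smooth_on_bilinear:
  "bounded_bilinear pr \<Longrightarrow> open S \<Longrightarrow> smooth_on S f \<Longrightarrow> smooth_on S g \<Longrightarrow> smooth_on S (\<lambda>x. pr (f x) (g x))"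
  unfolding smooth_on_def by (blast intro: Ck_on_bilinear)

lemma smooth_on_mult:
  fixes f g :: "_ \<Rightarrow> real"
  shows "open S \<Longrightarrow> smooth_on S f \<Longrightarrow> smooth_on S g \<Longrightarrow> smooth_on S (\<lambda>x. f x * g x)"
  by (rule smooth_on_bilinear[OF bounded_bilinear_mult])

lemma smooth_on_scaleR:
  "open S \<Longrightarrow> smooth_on S f \<Longrightarrow> smooth_on S g \<Longrightarrow> smooth_on S (\<lambda>x. f x *\<^sub>R g x)"
  by (rule smooth_on_bilinear[OF bounded_bilinear_scaleR])

lemma smooth_on_sum:
  "open S \<Longrightarrow> (\<And>i. i \<in> I \<Longrightarrow> smooth_on S (f i)) \<Longrightarrow> smooth_on S (\<lambda>x. \<Sum>i\<in>I. f i x)"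
  unfolding smooth_on_def by (blast intro: Ck_on_sum)

lemma smooth_on_prod:
  fixes f :: "'i \<Rightarrow> 'a::euclidean_space \<Rightarrow> real"
  shows "open S \<Longrightarrow> (\<And>i. i \<in> I \<Longrightarrow> smooth_on S (f i)) \<Longrightarrow> smooth_on S (\<lambda>x. \<Prod>i\<in>I. f i x)"
  by (induction I rule: infinite_finite_induct) (auto intro: smooth_on_const smooth_on_mult)

lemma smooth_on_linear_compose:
  "bounded_linear L \<Longrightarrow> open S \<Longrightarrow> smooth_on S f \<Longrightarrow> smooth_on S (\<lambda>x. L (f x))"
  unfolding smooth_on_def by (blast intro: Ck_on_linear_compose)

lemma smooth_on_inverse:
  fixes f :: "'a::euclidean_space \<Rightarrow> real"
  shows "open S \<Longrightarrow> smooth_on S f \<Longrightarrow> (\<And>x. x \<in> S \<Longrightarrow> f x \<noteq> 0) \<Longrightarrow> smooth_on S (\<lambda>x. inverse (f x))"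
  unfolding smooth_on_def by (blast intro: Ck_on_inverse)

lemma smooth_on_compose:
  fixes f :: "'b::euclidean_space \<Rightarrow> 'c::real_normed_vector" and g :: "'a::euclidean_space \<Rightarrow> 'b"
  shows "open S \<Longrightarrow> open T \<Longrightarrow> g ` S \<subseteq> T \<Longrightarrow> smooth_on T f \<Longrightarrow> smooth_on S g \<Longrightarrow> smooth_on S (\<lambda>x. f (g x))"
  unfolding smooth_on_def by (blast intro: Ck_on_compose)

lemma smooth_on_differentiable: "smooth_on S f \<Longrightarrow> x \<in> S \<Longrightarrow> f differentiable (at x)"
  unfolding smooth_on_def by (metis Ck_on.simps(2))

lemma smooth_on_has_derivative:
  "smooth_on S f \<Longrightarrow> x \<in> S \<Longrightarrow> (f has_derivative frechet_derivative f (at x)) (at x)"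
  using smooth_on_differentiable frechet_derivative_works by blast

lemma smooth_on_continuous_on: "smooth_on S f \<Longrightarrow> continuous_on S f"
  unfolding smooth_on_def by (metis Ck_on.simps(1))

lemma smooth_on_frechet:
  assumes "open S" "smooth_on S f"
  shows "smooth_on S (\<lambda>x. frechet_derivative f (at x) v)"
proof -
  have b: "smooth_on S (\<lambda>x. frechet_derivative f (at x) b)" if "b \<in> Basis" for b
    using assms(2) that unfolding smooth_on_def by (metis Ck_on.simps(2))
  have "smooth_on S (\<lambda>x. \<Sum>b\<in>Basis. (v \<bullet> b) *\<^sub>R frechet_derivative f (at x) b)"
    by (intro smooth_on_sum smooth_on_scaleR smooth_on_const assms(1) b)
  then show ?thesis
  proof (rule smooth_on_cong[OF assms(1)])
    fix x assume "x \<in> S"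
    then have "linear (frechet_derivative f (at x))"
      using smooth_on_differentiable[OF assms(2)] linear_frechet_derivative by blast
    then show "(\<Sum>b\<in>Basis. (v \<bullet> b) *\<^sub>R frechet_derivative f (at x) b) = frechet_derivative f (at x) v"
      by (rule linear_euclidean_sum)
  qed
qed

lemma smooth_on_frechet_field:
  fixes f :: "'a::euclidean_space \<Rightarrow> 'b::real_normed_vector"
  assumes "open S" "smooth_on S f" "smooth_on S w"
  shows "smooth_on S (\<lambda>x. frechet_derivative f (at x) (w x))"
proof -
  have "smooth_on S (\<lambda>x. \<Sum>b\<in>Basis. (w x \<bullet> b) *\<^sub>R frechet_derivative f (at x) b)"
    by (intro smooth_on_sum smooth_on_scaleR smooth_on_frechet
        smooth_on_linear_compose[OF bounded_linear_inner_left] assms)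
  then show ?thesis
  proof (rule smooth_on_cong[OF assms(1)])
    fix x assume "x \<in> S"
    then have "linear (frechet_derivative f (at x))"
      using smooth_on_differentiable[OF assms(2)] linear_frechet_derivative by blast
    then show "(\<Sum>b\<in>Basis. (w x \<bullet> b) *\<^sub>R frechet_derivative f (at x) b) = frechet_derivative f (at x) (w x)"
      by (rule linear_euclidean_sum)
  qed
qed

lemma smooth_on_vec_iff:
  fixes f :: "'a::euclidean_space \<Rightarrow> real^'n"
  assumes "open S"
  shows "smooth_on S f \<longleftrightarrow> (\<forall>i. smooth_on S (\<lambda>x. f x $ i))"
proof
  show "smooth_on S f \<Longrightarrow> \<forall>i. smooth_on S (\<lambda>x. f x $ i)"
    using smooth_on_linear_compose[OF bounded_linear_vec_nth assms] by blast
  assume "\<forall>i. smooth_on S (\<lambda>x. f x $ i)"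
  then have "smooth_on S (\<lambda>x. SUM i. f x $ i *\<^sub>R axis i 1)"
    by (intro smooth_on_sum smooth_on_scaleR smooth_on_const assms) auto
  then show "smooth_on S f"
    by (rule smooth_on_cong[OF assms])
      (simp add: vec_eq_iff axis_def if_distrib[of "\<lambda>x. _ * x"] cong: if_cong)
qed

text \<open>The mean value theorem is applied along \<open>u\<close> to a difference in the
  direction \<open>v\<close>, and then along \<open>v\<close>. The second difference is symmetric in
  the two directions, which is what the symmetry of second derivatives rests on.\<close>

lemma second_difference_mean_value:
  fixes f :: "'a::euclidean_space \<Rightarrow> real"
  assumes "open S" "smooth_on S f" "h > 0" and ball: "cball x (h * (norm u + norm v)) \<subseteq> S"
  obtains p where "p \<in> cball x (h * (norm u + norm v))"
    "f (x + h *\<^sub>R u + h *\<^sub>R v) - f (x + h *\<^sub>R u) - f (x + h *\<^sub>R v) + f x =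
     h * (h * frechet_derivative (\<lambda>y. frechet_derivative f (at y) u) (at p) v)"
proof -
  have inb: "x + s *\<^sub>R u + t *\<^sub>R v \<in> cball x (h * (norm u + norm v))"
    if "0 \<le> s" "s \<le> h" "0 \<le> t" "t \<le> h" for s t
  proof -
    have "norm (s *\<^sub>R u + t *\<^sub>R v) \<le> s * norm u + t * norm v"
      using that norm_triangle_ineq[of "s *\<^sub>R u" "t *\<^sub>R v"] by simp
    also have "\<dots> \<le> h * norm u + h * norm v"
      using that by (intro add_mono mult_right_mono) auto
    finally show ?thesis
      by (simp add: dist_norm norm_minus_commute[of x] algebra_simps)
        (metis add.commute norm_minus_cancel minus_add_distrib uminus_add_conv_diff diff_minus_eq_add)
  qed
  then have inS: "x + s *\<^sub>R u + t *\<^sub>R v \<in> S" if "0 \<le> s" "s \<le> h" "0 \<le> t" "t \<le> h" for s t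
    using that ball by blast
  have der: "((\<lambda>t. g (y + t *\<^sub>R w)) has_field_derivative frechet_derivative g (at (y + t *\<^sub>R w)) w) (at t)"
    if "smooth_on S g" "y + t *\<^sub>R w \<in> S" for g :: "'a \<Rightarrow> real" and y w t
  proof -
    have g: "(g has_derivative frechet_derivative g (at (y + t *\<^sub>R w))) (at (y + t *\<^sub>R w))"
      by (rule smooth_on_has_derivative[OF that])
    have "((\<lambda>t. y + t *\<^sub>R w) has_derivative (\<lambda>t. t *\<^sub>R w)) (at t)"
      by (auto intro!: derivative_eq_intros)
    from has_derivative_compose[OF this g]
    have "((\<lambda>t. g (y + t *\<^sub>R w)) has_derivative (\<lambda>s. frechet_derivative g (at (y + t *\<^sub>R w)) (s *\<^sub>R w))) (at t)" .
    moreover have "linear (frechet_derivative g (at (y + t *\<^sub>R w)))"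
      using g has_derivative_linear by blast
    then have "(\<lambda>s. frechet_derivative g (at (y + t *\<^sub>R w)) (s *\<^sub>R w)) =
        (*) (frechet_derivative g (at (y + t *\<^sub>R w)) w)"
      by (simp add: linear_scale fun_eq_iff)
    ultimately show ?thesis by (simp add: has_field_derivative_def)
  qed
  let ?Du = "\<lambda>y. frechet_derivative f (at y) u"
  let ?\<phi> = "\<lambda>s. f ((x + h *\<^sub>R v) + s *\<^sub>R u) - f (x + s *\<^sub>R u)"
  have "\<exists>z. 0 < z \<and> z < h \<and> ?\<phi> h - ?\<phi> 0 = (h - 0) * (?Du ((x + h *\<^sub>R v) + z *\<^sub>R u) - ?Du (x + z *\<^sub>R u))"
  proof (rule MVT2[OF \<open>h > 0\<close>])
    fix s assume s: "0 \<le> s" "s \<le> h"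
    show "(?\<phi> has_field_derivative ?Du ((x + h *\<^sub>R v) + s *\<^sub>R u) - ?Du (x + s *\<^sub>R u)) (at s)"
      using inS[OF s, of h] inS[OF s, of 0] \<open>h > 0\<close>
      by (intro DERIV_diff der assms(2)) (auto simp: add_ac)
  qed
  then obtain z where z: "0 < z" "z < h"
    and e1: "?\<phi> h - ?\<phi> 0 = h * (?Du ((x + z *\<^sub>R u) + h *\<^sub>R v) - ?Du ((x + z *\<^sub>R u) + 0 *\<^sub>R v))"
    by (auto simp: add_ac)
  have "\<exists>w. 0 < w \<and> w < h \<and> ?Du ((x + z *\<^sub>R u) + h *\<^sub>R v) - ?Du ((x + z *\<^sub>R u) + 0 *\<^sub>R v)
     = (h - 0) * frechet_derivative ?Du (at ((x + z *\<^sub>R u) + w *\<^sub>R v)) v"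
    by (rule MVT2[OF \<open>h > 0\<close>], rule der[OF smooth_on_frechet[OF assms(1,2)]], rule inS)
      (use z in auto)
  then obtain w where w: "0 < w" "w < h"
    and e2: "?Du ((x + z *\<^sub>R u) + h *\<^sub>R v) - ?Du ((x + z *\<^sub>R u) + 0 *\<^sub>R v)
     = h * frechet_derivative ?Du (at ((x + z *\<^sub>R u) + w *\<^sub>R v)) v" by auto
  show thesis
  proof (rule that[OF inb])
    show "f (x + h *\<^sub>R u + h *\<^sub>R v) - f (x + h *\<^sub>R u) - f (x + h *\<^sub>R v) + f x =
      h * (h * frechet_derivative ?Du (at (x + z *\<^sub>R u + w *\<^sub>R v)) v)"
      using e1 unfolding e2 by (simp add: add_ac)
  qed (use z w in auto)
qed

text \<open>Both mixed derivatives, taken at two points near \<open>x\<close>, equal the same second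
  difference divided by the square of the step. With tolerance half the assumed gap, continuity at
  \<open>x\<close> leaves no room for a difference.\<close>

lemma frechet_derivative_commute:
  fixes f :: "'a::euclidean_space \<Rightarrow> real"
  assumes S: "open S" "smooth_on S f" "x \<in> S"
  shows "frechet_derivative (\<lambda>y. frechet_derivative f (at y) u) (at x) v =
         frechet_derivative (\<lambda>y. frechet_derivative f (at y) v) (at x) u" (is "?A x = ?B x")
proof (rule ccontr)
  assume ne: "?A x \<noteq> ?B x"
  define e where "e = \<bar>?A x - ?B x\<bar> / 2"
  have e: "e > 0" using ne by (simp add: e_def)
  have cont: "isCont (\<lambda>z. frechet_derivative (\<lambda>y. frechet_derivative f (at y) a) (at z) b) x" for a b
    using smooth_on_continuous_on[OF smooth_on_frechet[OF S(1) smooth_on_frechet[OF S(1,2)]]] S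
    by (simp add: continuous_on_eq_continuous_at)
  obtain d1 where d1: "d1 > 0" "\<And>y. dist y x < d1 \<Longrightarrow> dist (?A y) (?A x) < e"
    using cont[of u v] e unfolding continuous_at_eps_delta by blast
  obtain d2 where d2: "d2 > 0" "\<And>y. dist y x < d2 \<Longrightarrow> dist (?B y) (?B x) < e"
    using cont[of v u] e unfolding continuous_at_eps_delta by blast
  obtain d3 where d3: "d3 > 0" "cball x d3 \<subseteq> S"
    using S open_contains_cball by blast
  define r where "r = min (min d1 d2) d3 / 2"
  have r: "r > 0" "r < d1" "r < d2" "r \<le> d3" using d1 d2 d3 by (auto simp: r_def)
  \<comment> \<open>The summand 1 keeps the denominator positive when both directions are
    zero.\<close>
  define h where "h = r / (norm u + norm v + 1)"
  have h: "h > 0" using r by (simp add: h_def add_nonneg_pos)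
  have "0 < norm u + norm v + 1" by (simp add: add_nonneg_pos)
  then have "h * (norm u + norm v) \<le> r"
    using r by (simp add: h_def pos_divide_le_eq)
  then have sub: "cball x (h * (norm u + norm v)) \<subseteq> S" "h * (norm u + norm v) \<le> r"
    using d3(2) r(4) subset_cball[of "h * (norm u + norm v)" d3 x] by auto
  obtain p where p: "p \<in> cball x (h * (norm u + norm v))"
    "f (x + h *\<^sub>R u + h *\<^sub>R v) - f (x + h *\<^sub>R u) - f (x + h *\<^sub>R v) + f x = h * (h * ?A p)"
    using second_difference_mean_value[OF S(1,2) h sub(1)] .
  obtain q where q: "q \<in> cball x (h * (norm v + norm u))"
    "f (x + h *\<^sub>R v + h *\<^sub>R u) - f (x + h *\<^sub>R v) - f (x + h *\<^sub>R u) + f x = h * (h * ?B q)"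
    using second_difference_mean_value[OF S(1,2) h, of x v u] sub(1) by (metis add.commute)
  have swap: "x + h *\<^sub>R v + h *\<^sub>R u = x + h *\<^sub>R u + h *\<^sub>R v" by (simp add: add_ac)
  have "h * (h * ?A p) = h * (h * ?B q)"
    using p(2) q(2)[unfolded swap] by linarith
  then have "?A p = ?B q" using h by simp
  moreover have "dist (?A p) (?A x) < e"
    using p(1) sub(2) r by (intro d1(2)) (auto simp: dist_commute)
  moreover have "dist (?B q) (?B x) < e"
    using q(1) sub(2) r by (intro d2(2)) (auto simp: dist_commute add.commute)
  ultimately show False unfolding dist_real_def e_def by argo
qed

text \<open>The functions \<open>exp (-1/t) / t^n\<close>, extended by 0, form a family closed under differentiation up to
  linear combinations; this gives smoothness of the cutoff.\<close>

definition flat_exp :: "nat \<Rightarrow> real \<Rightarrow> real" where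
  "flat_exp n t = (if t > 0 then exp (- inverse t) * inverse t ^ n else 0)"

lemma power_le_fact_exp: "x \<ge> 0 \<Longrightarrow> x ^ n \<le> fact n * exp (x::real)"
proof -
  assume x: "x \<ge> 0"
  have "(\<Sum>k\<in>{n}. x ^ k /\<^sub>R fact k) \<le> (\<Sum>k. x ^ k /\<^sub>R fact k)"
    by (rule sum_le_suminf) (use x summable_exp[of x] in auto)
  then show ?thesis by (simp add: exp_def field_simps)
qed

text \<open>A quadratic bound makes the difference quotient at 0 at most a multiple of the distance
  to 0. It costs two additional powers of \<open>inverse t\<close>, which the exponential
  absorbs.\<close>

lemma flat_exp_bound: "\<bar>flat_exp n t\<bar> \<le> fact (n + 2) * t\<^sup>2"
proof (cases "t > 0")
  case True
  have "inverse t ^ (n + 2) \<le> fact (n + 2) * exp (inverse t)"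
    by (rule power_le_fact_exp) (use True in simp)
  then have "exp (- inverse t) * inverse t ^ (n + 2) \<le> exp (- inverse t) * (fact (n + 2) * exp (inverse t))"
    by (rule mult_left_mono) simp
  also have "\<dots> = fact (n + 2)"
    by (simp only: mult.left_commute[of "exp _" "fact _"] exp_add[symmetric]) simp
  finally have "exp (- inverse t) * inverse t ^ (n + 2) \<le> fact (n + 2)" .
  then have "exp (- inverse t) * inverse t ^ (n + 2) * t\<^sup>2 \<le> fact (n + 2) * t\<^sup>2"
    by (rule mult_right_mono) simp
  moreover have "inverse t ^ (n + 2) * t\<^sup>2 = inverse t ^ n"
    using True by (simp add: power_add power2_eq_square field_simps)
  ultimately have "exp (- inverse t) * inverse t ^ n \<le> fact (n + 2) * t\<^sup>2"
    by (simp only: mult.assoc)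
  then show ?thesis using True by (simp add: flat_exp_def)
qed (simp add: flat_exp_def)

lemma flat_exp_deriv:
  "(flat_exp n has_field_derivative (flat_exp (n + 2) t - n * flat_exp (n + 1) t)) (at t)"
proof -
  consider "t > 0" | "t < 0" | "t = 0" by linarith
  then show ?thesis
  proof cases
    case 1
    have i: "(inverse has_field_derivative - (inverse t * inverse t)) (at t)"
      using 1 DERIV_inverse[of t] by (simp add: power2_eq_square)
    have e: "((\<lambda>t. exp (- inverse t)) has_field_derivative exp (- inverse t) * (- (- (inverse t * inverse t)))) (at t)"
      by (rule DERIV_chain2[OF DERIV_exp DERIV_minus[OF i]])
    have "((\<lambda>t. exp (- inverse t) * inverse t ^ n) has_field_derivative
      (flat_exp (n + 2) t - n * flat_exp (n + 1) t)) (at t)"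
      using DERIV_mult[OF e DERIV_power[OF i, of n]] 1
      by (cases n) (simp_all add: flat_exp_def algebra_simps)
    then show ?thesis
      by (rule has_field_derivative_transform_within_open[where S = "{0<..}"])
        (use 1 in \<open>auto simp: flat_exp_def\<close>)
  next
    case 2
    have "((\<lambda>t. 0) has_field_derivative (flat_exp (n + 2) t - n * flat_exp (n + 1) t)) (at t)"
      using 2 by (simp add: flat_exp_def)
    then show ?thesis
      by (rule has_field_derivative_transform_within_open[where S = "{..<0}"])
        (use 2 in \<open>auto simp: flat_exp_def\<close>)
  next
    case 3
    have "(\<lambda>h. (flat_exp n h - flat_exp n 0) / (h - 0)) \<midarrow>0\<rightarrow> 0"
    proof (rule tendsto_rabs_zero_cancel, rule tendsto_sandwich[where f = "\<lambda>h. 0" and h = "\<lambda>h. fact (n + 2) * \<bar>h\<bar>"])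
      show "\<forall>\<^sub>F h in at 0. \<bar>(flat_exp n h - flat_exp n 0) / (h - 0)\<bar> \<le> fact (n + 2) * \<bar>h\<bar>"
        unfolding eventually_at_filter
      proof (rule always_eventually, intro allI impI)
        fix h :: real assume "h \<noteq> 0"
        then show "\<bar>(flat_exp n h - flat_exp n 0) / (h - 0)\<bar> \<le> fact (n + 2) * \<bar>h\<bar>"
          using flat_exp_bound[of n h] unfolding power2_abs[of h, symmetric]
          by (simp add: flat_exp_def[of n 0] abs_divide divide_le_eq power2_eq_square mult.assoc)
      qed
    qed (auto intro!: tendsto_eq_intros)
    then show ?thesis
      unfolding 3 has_field_derivative_iff by (simp add: flat_exp_def[of _ 0])
  qed
qed

lemma smooth_on_flat_exp: "smooth_on UNIV (flat_exp n)"
  unfolding smooth_on_def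
proof
  fix k
  show "Ck_on k (flat_exp n) UNIV"
  proof (induction k arbitrary: n)
    case 0
    then show ?case
      using flat_exp_deriv by (auto intro!: continuous_at_imp_continuous_on DERIV_isCont)
  next
    case (Suc k)
    have "Ck_on k (\<lambda>t. b * (flat_exp (n + 2) t + (- real n) * flat_exp (n + 1) t)) UNIV" for b :: real
      by (intro Ck_on_bilinear[OF bounded_bilinear_mult] Ck_on_add Ck_on_const Suc) auto
    moreover have "(flat_exp n has_derivative (\<lambda>b. b * (flat_exp (n + 2) t + (- real n) * flat_exp (n + 1) t))) (at t)" for t
    proof -
      have "(\<lambda>b. b * (flat_exp (n + 2) t + (- real n) * flat_exp (n + 1) t)) =
          (*) (flat_exp (n + 2) t - n * flat_exp (n + 1) t)"
        by (simp add: fun_eq_iff mult.commute)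
      then show ?thesis
        using flat_exp_deriv[of n t] unfolding has_field_derivative_def by simp
    qed
    ultimately show ?case by (intro Ck_on_SucI) auto
  qed
qed

lemma smooth_cutoff:
  fixes a :: "'a::euclidean_space"
  assumes "r > 0"
  obtains h :: "'a \<Rightarrow> real" where "smooth_on UNIV h"
    "\<And>x. dist a x \<le> r \<Longrightarrow> h x = 1" "\<And>x. dist a x \<ge> 2 * r \<Longrightarrow> h x = 0"
proof -
  \<comment> \<open>The squared distance is smooth also at the centre. This \<open>w\<close> is at
    least 1 on the ball of radius \<open>r\<close> and at most 0 beyond \<open>sqrt 2 * r\<close>,
    hence beyond \<open>2 * r\<close>; \<open>h\<close> composes it with the usual smooth step from
    0 to 1.\<close>
  define w where "w = (\<lambda>x::'a. 2 + (- (1 / r\<^sup>2)) * ((x - a) \<bullet> (x - a)))"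
  define h where "h = (\<lambda>x. flat_exp 0 (w x) * inverse (flat_exp 0 (w x) + flat_exp 0 (1 + - 1 * w x)))"
  have lin: "smooth_on UNIV (\<lambda>x::'a. x - a)"
    using smooth_on_add[OF open_UNIV smooth_on_bounded_linear[OF open_UNIV bounded_linear_ident]
      smooth_on_const[OF open_UNIV, of "- a"]] by simp
  have w: "smooth_on UNIV w" unfolding w_def
    by (intro smooth_on_add smooth_on_mult smooth_on_const smooth_on_bilinear[OF bounded_bilinear_inner] lin open_UNIV)
  have w': "smooth_on UNIV (\<lambda>x. 1 + - 1 * w x)"
    by (intro smooth_on_add smooth_on_mult smooth_on_const w open_UNIV)
  note c = smooth_on_compose[OF open_UNIV open_UNIV subset_UNIV smooth_on_flat_exp]
  have pos: "flat_exp 0 t + flat_exp 0 (1 + - 1 * t) > 0" for t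
    by (auto simp: flat_exp_def intro: add_pos_pos)
  have "smooth_on UNIV h" unfolding h_def
    using pos by (intro smooth_on_mult smooth_on_inverse smooth_on_add c w w' open_UNIV) (metis less_irrefl)
  moreover have wd: "w x = 2 - (dist a x)\<^sup>2 / r\<^sup>2" for x
    by (simp add: w_def dist_norm norm_minus_commute[of a] power2_norm_eq_inner)
  have "h x = 1" if "dist a x \<le> r" for x
  proof -
    have "(dist a x)\<^sup>2 \<le> r\<^sup>2" using that by (simp add: power_mono)
    then have "w x \<ge> 1" using assms by (simp add: wd field_simps)
    then show ?thesis by (simp add: h_def flat_exp_def)
  qed
  moreover have "h x = 0" if "dist a x \<ge> 2 * r" for x
  proof -
    have "(2 * r)\<^sup>2 \<le> (dist a x)\<^sup>2" using that assms by (intro power_mono) auto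
    then have "4 * r\<^sup>2 \<le> (dist a x)\<^sup>2" by (simp add: power_mult_distrib)
    then have "2 * r\<^sup>2 \<le> (dist a x)\<^sup>2" using zero_le_power2[of r] by linarith
    then have "w x \<le> 0" using assms by (simp add: wd field_simps)
    then show ?thesis by (simp add: h_def flat_exp_def)
  qed
  ultimately show thesis by (rule that)
qed

section \<open>Derivatives in a varying direction\<close>

lemma frechet_derivative_cong_open:
  assumes "open S" "x \<in> S" "\<And>y. y \<in> S \<Longrightarrow> f y = g y" "f differentiable (at x)"
  shows "frechet_derivative f (at x) = frechet_derivative g (at x)"
  using frechet_derivative_transform_within_open[OF assms(4,1,2,3)] .

lemma frechet_derivative_field:
  fixes f :: "'a::euclidean_space \<Rightarrow> 'b::real_normed_vector"
  assumes S: "open S" "x \<in> S" and f: "smooth_on S f" and w: "smooth_on S w"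
  shows "frechet_derivative (\<lambda>y. frechet_derivative f (at y) (w y)) (at x) v =
    frechet_derivative (\<lambda>y. frechet_derivative f (at y) (w x)) (at x) v
    + frechet_derivative f (at x) (frechet_derivative w (at x) v)"
proof -
  let ?D = "\<lambda>b y. frechet_derivative f (at y) b"
  have lin: "linear (\<lambda>b. ?D b y)" if "y \<in> S" for y
    using smooth_on_differentiable[OF f that] linear_frechet_derivative by blast
  have D: "(?D b has_derivative frechet_derivative (?D b) (at x)) (at x)" for b
    by (rule smooth_on_has_derivative[OF smooth_on_frechet[OF S(1) f] S(2)])
  have wd: "(w has_derivative frechet_derivative w (at x)) (at x)"
    by (rule smooth_on_has_derivative[OF w S(2)])
  have "((\<lambda>y. \<Sum>b\<in>Basis. (w y \<bullet> b) *\<^sub>R ?D b y) has_derivative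
      (\<lambda>v. \<Sum>b\<in>Basis. (w x \<bullet> b) *\<^sub>R frechet_derivative (?D b) (at x) v
        + (frechet_derivative w (at x) v \<bullet> b) *\<^sub>R ?D b x)) (at x)"
    by (intro has_derivative_sum has_derivative_scaleR D bounded_linear.has_derivative[OF bounded_linear_inner_left wd])
  then have "((\<lambda>y. ?D (w y) y) has_derivative
      (\<lambda>v. \<Sum>b\<in>Basis. (w x \<bullet> b) *\<^sub>R frechet_derivative (?D b) (at x) v
        + (frechet_derivative w (at x) v \<bullet> b) *\<^sub>R ?D b x)) (at x)"
    by (rule has_derivative_transform_within_open[OF _ S]) (simp add: linear_euclidean_sum lin)
  from frechet_derivative_at[OF this, symmetric]
  have 1: "frechet_derivative (\<lambda>y. ?D (w y) y) (at x) v = (\<Sum>b\<in>Basis. (w x \<bullet> b) *\<^sub>R frechet_derivative (?D b) (at x) v)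
        + (\<Sum>b\<in>Basis. (frechet_derivative w (at x) v \<bullet> b) *\<^sub>R ?D b x)"
    by (simp add: sum.distrib)
  have "((\<lambda>y. \<Sum>b\<in>Basis. (w x \<bullet> b) *\<^sub>R ?D b y) has_derivative
      (\<lambda>v. \<Sum>b\<in>Basis. (w x \<bullet> b) *\<^sub>R frechet_derivative (?D b) (at x) v)) (at x)"
    by (intro has_derivative_sum has_derivative_scaleR_right D)
  then have "((\<lambda>y. ?D (w x) y) has_derivative
      (\<lambda>v. \<Sum>b\<in>Basis. (w x \<bullet> b) *\<^sub>R frechet_derivative (?D b) (at x) v)) (at x)"
    by (rule has_derivative_transform_within_open[OF _ S]) (simp add: linear_euclidean_sum lin)
  from frechet_derivative_at[OF this, symmetric]
  have "frechet_derivative (\<lambda>y. ?D (w x) y) (at x) v =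
     (\<Sum>b\<in>Basis. (w x \<bullet> b) *\<^sub>R frechet_derivative (?D b) (at x) v)"
    by simp
  with 1 show ?thesis by (simp add: linear_euclidean_sum lin[OF S(2)])
qed

section \<open>Functions and vector fields on a manifold\<close>

text \<open>Smoothness on an open subset, because the components of tensors in a frame are
  controlled only on the domain of that frame.\<close>

definition sm_on :: "('m, 'n::finite) chart set \<Rightarrow> 'm set \<Rightarrow> ('m \<Rightarrow> real) \<Rightarrow> bool" where
  "sm_on A V f \<longleftrightarrow> (\<forall>c\<in>A. smooth_on (snd c ` (fst c \<inter> V)) (f \<circ> inv_chart c))"

definition vsm_on :: "('m, 'n::finite) chart set \<Rightarrow> 'm set \<Rightarrow> ('m, 'n) vfield \<Rightarrow> bool" where
  "vsm_on A V X \<longleftrightarrow> (\<forall>c\<in>A. smooth_on (snd c ` (fst c \<inter> V)) (vf_rep A c X))"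

lemma smooth_fun_iff: "smooth_fun A f \<longleftrightarrow> sm_on A UNIV f"
  by (simp add: smooth_fun_def sm_on_def)

lemma smooth_vf_iff: "smooth_vf A X \<longleftrightarrow> vsm_on A UNIV X"
  by (simp add: smooth_vf_def vsm_on_def)

section \<open>Charts, coordinate changes and tangent vectors\<close>

locale smooth_mfd =
  fixes A :: "('m::{t2_space,second_countable_topology}, 'n::finite) chart set"
  assumes atlas: "smooth_atlas A"
begin

abbreviation J :: "('m, 'n) chart \<Rightarrow> ('m, 'n) chart \<Rightarrow> real^'n \<Rightarrow> real^'n \<Rightarrow> real^'n" where
  "J c d x \<equiv> frechet_derivative (snd d \<circ> inv_chart c) (at x)"

lemma chart_at: "chart_at A p \<in> A" "p \<in> fst (chart_at A p)"
proof -
  have "\<exists>c. c \<in> A \<and> p \<in> fst c" using atlas unfolding smooth_atlas_def by blast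
  then have "chart_at A p \<in> A \<and> p \<in> fst (chart_at A p)"
    unfolding chart_at_def by (rule someI_ex)
  then show "chart_at A p \<in> A" "p \<in> fst (chart_at A p)" by auto
qed

context
  fixes c assumes c: "c \<in> A"
begin

lemma homeo: "homeomorphism (fst c) (snd c ` fst c) (snd c) (inv_chart c)"
  and open_dom: "open (fst c)" and open_ran: "open (snd c ` fst c)"
  using atlas c unfolding smooth_atlas_def by auto

lemma inv_chart [simp]: "p \<in> fst c \<Longrightarrow> inv_chart c (snd c p) = p"
  using homeo unfolding homeomorphism_def by auto

lemma chart_inv [simp]: "x \<in> snd c ` fst c \<Longrightarrow> snd c (inv_chart c x) = x"
  using homeo unfolding homeomorphism_def by auto

lemma inv_chart_in: "x \<in> snd c ` fst c \<Longrightarrow> inv_chart c x \<in> fst c"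
  by auto

lemma image_Int_iff: "x \<in> snd c ` (fst c \<inter> V) \<longleftrightarrow> x \<in> snd c ` fst c \<and> inv_chart c x \<in> V"
  by (force simp: image_iff)

lemma open_image: "open V \<Longrightarrow> open (snd c ` (fst c \<inter> V))"
proof -
  assume V: "open V"
  have "continuous_on (snd c ` fst c) (inv_chart c)"
    using homeo unfolding homeomorphism_def by auto
  then have "open (inv_chart c -` V \<inter> snd c ` fst c)"
    using continuous_on_open_vimage[OF open_ran] V by blast
  moreover have "inv_chart c -` V \<inter> snd c ` fst c = snd c ` (fst c \<inter> V)"
    using image_Int_iff by auto
  ultimately show ?thesis by simp
qed

end

lemma transition_smooth:
  "c \<in> A \<Longrightarrow> d \<in> A \<Longrightarrow> smooth_on (snd c ` (fst c \<inter> fst d)) (snd d \<circ> inv_chart c)"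
  using atlas unfolding smooth_atlas_def by blast

lemma J_has_derivative:
  assumes "c \<in> A" "d \<in> A" "p \<in> fst c" "p \<in> fst d"
  shows "((snd d \<circ> inv_chart c) has_derivative J c d (snd c p)) (at (snd c p))"
  by (rule smooth_on_has_derivative[OF transition_smooth]) (use assms in auto)

lemma J_linear:
  "c \<in> A \<Longrightarrow> d \<in> A \<Longrightarrow> p \<in> fst c \<Longrightarrow> p \<in> fst d \<Longrightarrow> linear (J c d (snd c p))"
  using J_has_derivative has_derivative_linear by blast

lemma J_comp:
  assumes "c \<in> A" "d \<in> A" "e \<in> A" and p: "p \<in> fst c" "p \<in> fst d" "p \<in> fst e"
  shows "J d e (snd d p) (J c d (snd c p) v) = J c e (snd c p) v"
proof -
  let ?S = "snd c ` (fst c \<inter> (fst d \<inter> fst e))"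
  have o: "open ?S" by (intro open_image open_Int open_dom assms)
  have g: "((snd e \<circ> inv_chart d) has_derivative J d e (snd d p)) (at ((snd d \<circ> inv_chart c) (snd c p)))"
    using J_has_derivative[of d e p] assms by simp
  have "((\<lambda>x. (snd e \<circ> inv_chart d) ((snd d \<circ> inv_chart c) x)) has_derivative
      (\<lambda>v. J d e (snd d p) (J c d (snd c p) v))) (at (snd c p))"
    by (rule has_derivative_compose[OF J_has_derivative g]) (use assms in auto)
  then have "((snd e \<circ> inv_chart c) has_derivative (\<lambda>v. J d e (snd d p) (J c d (snd c p) v))) (at (snd c p))"
    by (rule has_derivative_transform_within_open[OF _ o]) (use assms in auto)
  from frechet_derivative_at[OF this] show ?thesis by metis
qed

lemma J_self:
  assumes "c \<in> A" "p \<in> fst c"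
  shows "J c c (snd c p) v = v"
proof -
  have "((\<lambda>x. x) has_derivative (\<lambda>v. v)) (at (snd c p))" by simp
  then have "((snd c \<circ> inv_chart c) has_derivative (\<lambda>v. v)) (at (snd c p))"
    by (rule has_derivative_transform_within_open[OF _ open_ran[OF assms(1)]]) (use assms in auto)
  from frechet_derivative_at[OF this] show ?thesis by metis
qed

lemma to_chart_eq: "to_chart A c p v = J (chart_at A p) c (snd (chart_at A p) p) v"
  by (simp add: to_chart_def)

lemma from_chart_eq: "from_chart A c p w = J c (chart_at A p) (snd c p) w"
  by (simp add: from_chart_def)

lemma to_chart_linear: "c \<in> A \<Longrightarrow> p \<in> fst c \<Longrightarrow> linear (to_chart A c p)"
  unfolding to_chart_eq[abs_def] by (rule J_linear) (auto simp: chart_at)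

lemma from_chart_linear: "c \<in> A \<Longrightarrow> p \<in> fst c \<Longrightarrow> linear (from_chart A c p)"
  unfolding from_chart_eq[abs_def] by (rule J_linear) (auto simp: chart_at)

lemma to_from_chart [simp]: "c \<in> A \<Longrightarrow> p \<in> fst c \<Longrightarrow> to_chart A c p (from_chart A c p w) = w"
  unfolding to_chart_eq from_chart_eq by (simp add: J_comp J_self chart_at)

lemma from_to_chart [simp]: "c \<in> A \<Longrightarrow> p \<in> fst c \<Longrightarrow> from_chart A c p (to_chart A c p w) = w"
  unfolding to_chart_eq from_chart_eq by (simp add: J_comp J_self chart_at)

lemma to_chart_change:
  "c \<in> A \<Longrightarrow> d \<in> A \<Longrightarrow> p \<in> fst c \<Longrightarrow> p \<in> fst d \<Longrightarrow> to_chart A d p v = J c d (snd c p) (to_chart A c p v)"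
  unfolding to_chart_eq by (simp add: J_comp chart_at)

lemma to_chart_at [simp]: "to_chart A (chart_at A p) p v = v"
  unfolding to_chart_eq by (simp add: J_self chart_at)

lemma from_chart_at [simp]: "from_chart A (chart_at A p) p v = v"
  unfolding from_chart_eq by (simp add: J_self chart_at)

section \<open>Local smoothness of functions and vector fields\<close>

lemma sm_on_subset: "sm_on A V f \<Longrightarrow> W \<subseteq> V \<Longrightarrow> sm_on A W f"
  unfolding sm_on_def by (meson Int_mono image_mono order_refl smooth_on_subset)

lemma vsm_on_subset: "vsm_on A V X \<Longrightarrow> W \<subseteq> V \<Longrightarrow> vsm_on A W X"
  unfolding vsm_on_def by (meson Int_mono image_mono order_refl smooth_on_subset)

lemma sm_on_cong:
  assumes "open V" "sm_on A V f" "\<And>p. p \<in> V \<Longrightarrow> f p = g p"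
  shows "sm_on A V g"
  unfolding sm_on_def
proof
  fix c assume c: "c \<in> A"
  show "smooth_on (snd c ` (fst c \<inter> V)) (g \<circ> inv_chart c)"
    by (rule smooth_on_cong[OF open_image[OF c assms(1)], where f = "f \<circ> inv_chart c"])
      (use assms(2,3) c in \<open>auto simp: sm_on_def\<close>)
qed

lemma vsm_on_cong:
  assumes "open V" "vsm_on A V X" "\<And>p. p \<in> V \<Longrightarrow> X p = Y p"
  shows "vsm_on A V Y"
  unfolding vsm_on_def
proof
  fix c assume c: "c \<in> A"
  show "smooth_on (snd c ` (fst c \<inter> V)) (vf_rep A c Y)"
    by (rule smooth_on_cong[OF open_image[OF c assms(1)], of "vf_rep A c X"])
      (use assms c in \<open>auto simp: vsm_on_def vf_rep_def\<close>)
qed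

lemma sm_on_local:
  assumes "\<And>p. p \<in> V \<Longrightarrow> \<exists>W. open W \<and> p \<in> W \<and> sm_on A W f"
  shows "sm_on A V f"
  unfolding sm_on_def
proof
  fix c assume c: "c \<in> A"
  show "smooth_on (snd c ` (fst c \<inter> V)) (f \<circ> inv_chart c)"
  proof (rule smooth_on_local)
    fix x assume x: "x \<in> snd c ` (fst c \<inter> V)"
    then obtain p where p: "p \<in> fst c" "p \<in> V" "x = snd c p" by auto
    obtain W where "open W" "p \<in> W" "sm_on A W f" using assms[OF p(2)] by auto
    then show "\<exists>U. open U \<and> x \<in> U \<and> smooth_on U (f \<circ> inv_chart c)"
      using p c open_image[OF c] unfolding sm_on_def
      by (intro exI[of _ "snd c ` (fst c \<inter> W)"]) auto
  qed
qed

lemma vsm_on_local: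
  assumes "\<And>p. p \<in> V \<Longrightarrow> \<exists>W. open W \<and> p \<in> W \<and> vsm_on A W X"
  shows "vsm_on A V X"
  unfolding vsm_on_def
proof
  fix c assume c: "c \<in> A"
  show "smooth_on (snd c ` (fst c \<inter> V)) (vf_rep A c X)"
  proof (rule smooth_on_local)
    fix x assume x: "x \<in> snd c ` (fst c \<inter> V)"
    then obtain p where p: "p \<in> fst c" "p \<in> V" "x = snd c p" by auto
    obtain W where "open W" "p \<in> W" "vsm_on A W X" using assms[OF p(2)] by auto
    then show "\<exists>U. open U \<and> x \<in> U \<and> smooth_on U (vf_rep A c X)"
      using p c open_image[OF c] unfolding vsm_on_def
      by (intro exI[of _ "snd c ` (fst c \<inter> W)"]) auto
  qed
qed

lemma sm_on_chart:
  assumes "d \<in> A" "open V" "V \<subseteq> fst d" "smooth_on (snd d ` V) (f \<circ> inv_chart d)"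
  shows "sm_on A V f"
  unfolding sm_on_def
proof
  fix c assume c: "c \<in> A"
  let ?S = "snd c ` (fst c \<inter> V)"
  have oV: "open (snd d ` V)"
    using open_image[OF assms(1,2)] assms(3) by (simp add: Int_absorb1)
  have t: "smooth_on ?S (snd d \<circ> inv_chart c)"
    by (rule smooth_on_subset[OF transition_smooth[OF c assms(1)]]) (use assms(3) in auto)
  have "smooth_on ?S (\<lambda>x. (f \<circ> inv_chart d) ((snd d \<circ> inv_chart c) x))"
    by (rule smooth_on_compose[OF open_image[OF c assms(2)] oV _ assms(4) t]) (use c assms in auto)
  then show "smooth_on ?S (f \<circ> inv_chart c)"
    by (rule smooth_on_cong[OF open_image[OF c assms(2)]]) (use c assms in auto)
qed

text \<open>The representation in another chart is the Jacobian of the coordinate change applied to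
  the given one, at the transported point; every ingredient is smooth.\<close>

lemma vsm_on_chart:
  assumes "d \<in> A" "open V" "V \<subseteq> fst d" "smooth_on (snd d ` V) (vf_rep A d X)"
  shows "vsm_on A V X"
  unfolding vsm_on_def
proof
  fix c assume c: "c \<in> A"
  let ?S = "snd c ` (fst c \<inter> V)" and ?T = "snd d ` (fst d \<inter> (V \<inter> fst c))"
  have oT: "open ?T"
    by (intro open_image open_Int open_dom assms c)
  have t: "smooth_on ?S (snd d \<circ> inv_chart c)"
    by (rule smooth_on_subset[OF transition_smooth[OF c assms(1)]]) (use assms(3) in auto)
  have "smooth_on ?T (snd c \<circ> inv_chart d)"
    by (rule smooth_on_subset[OF transition_smooth[OF assms(1) c]]) auto
  moreover have "smooth_on ?T (vf_rep A d X)"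
    by (rule smooth_on_subset[OF assms(4)]) auto
  ultimately have j: "smooth_on ?T (\<lambda>y. J d c y (vf_rep A d X y))"
    by (rule smooth_on_frechet_field[OF oT])
  have "smooth_on ?S (\<lambda>x. (\<lambda>y. J d c y (vf_rep A d X y)) ((snd d \<circ> inv_chart c) x))"
    by (rule smooth_on_compose[OF open_image[OF c assms(2)] oT _ j t]) (use c assms in auto)
  then show "smooth_on ?S (vf_rep A c X)"
    by (rule smooth_on_cong[OF open_image[OF c assms(2)]])
      (use c assms in \<open>auto simp: vf_rep_def to_chart_change[of d c]\<close>)
qed

context
  fixes V :: "'m set" assumes V: "open V"
begin

lemma sm_const: "sm_on A V (\<lambda>p. r)"
  unfolding sm_on_def comp_def by (auto intro!: smooth_on_const open_image V)

lemma sm_add: "sm_on A V f \<Longrightarrow> sm_on A V g \<Longrightarrow> sm_on A V (\<lambda>p. f p + g p)"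
  unfolding sm_on_def comp_def by (auto intro!: smooth_on_add open_image V)

lemma sm_mult: "sm_on A V f \<Longrightarrow> sm_on A V g \<Longrightarrow> sm_on A V (\<lambda>p. f p * g p)"
  unfolding sm_on_def comp_def by (auto intro!: smooth_on_mult open_image V)

lemma sm_sum: "(\<And>i. i \<in> I \<Longrightarrow> sm_on A V (f i)) \<Longrightarrow> sm_on A V (\<lambda>p. \<Sum>i\<in>I. f i p)"
  by (induction I rule: infinite_finite_induct) (auto intro: sm_const sm_add)

lemma vsm_zero: "vsm_on A V (\<lambda>p. 0)"
  unfolding vsm_on_def
proof
  fix c assume c: "c \<in> A"
  show "smooth_on (snd c ` (fst c \<inter> V)) (vf_rep A c (\<lambda>p. 0))"
    by (rule smooth_on_cong[OF open_image[OF c V] smooth_on_const[OF open_image[OF c V], of 0]])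
      (auto simp: vf_rep_def c linear_0[OF to_chart_linear])
qed

lemma vsm_add:
  assumes "vsm_on A V X" "vsm_on A V Y"
  shows "vsm_on A V (\<lambda>p. X p + Y p)"
  unfolding vsm_on_def
proof
  fix c assume c: "c \<in> A"
  have "smooth_on (snd c ` (fst c \<inter> V)) (\<lambda>x. vf_rep A c X x + vf_rep A c Y x)"
    using assms c unfolding vsm_on_def by (auto intro!: smooth_on_add open_image V)
  then show "smooth_on (snd c ` (fst c \<inter> V)) (vf_rep A c (\<lambda>p. X p + Y p))"
    by (rule smooth_on_cong[OF open_image[OF c V]])
      (auto simp: vf_rep_def c linear_add[OF to_chart_linear])
qed

lemma vsm_scaleR:
  assumes "sm_on A V f" "vsm_on A V X"
  shows "vsm_on A V (\<lambda>p. f p *\<^sub>R X p)"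
  unfolding vsm_on_def
proof
  fix c assume c: "c \<in> A"
  have "smooth_on (snd c ` (fst c \<inter> V)) (\<lambda>x. (f \<circ> inv_chart c) x *\<^sub>R vf_rep A c X x)"
    by (rule smooth_on_scaleR[OF open_image[OF c V]])
      (use assms c in \<open>unfold sm_on_def vsm_on_def, blast+\<close>)
  then show "smooth_on (snd c ` (fst c \<inter> V)) (vf_rep A c (\<lambda>p. f p *\<^sub>R X p))"
    by (rule smooth_on_cong[OF open_image[OF c V]])
      (auto simp: vf_rep_def c linear_scale[OF to_chart_linear])
qed

lemma vsm_sum: "(\<And>i. i \<in> I \<Longrightarrow> vsm_on A V (X i)) \<Longrightarrow> vsm_on A V (\<lambda>p. \<Sum>i\<in>I. X i p)"
  by (induction I rule: infinite_finite_induct) (auto intro: vsm_zero vsm_add)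

section \<open>Derivatives along vector fields and the Lie bracket\<close>

lemma sm_differentiable:
  "sm_on A V f \<Longrightarrow> c \<in> A \<Longrightarrow> p \<in> fst c \<Longrightarrow> p \<in> V \<Longrightarrow> (f \<circ> inv_chart c) differentiable (at (snd c p))"
  unfolding sm_on_def by (auto intro: smooth_on_differentiable)

text \<open>The definition uses the chart selected at \<open>p\<close>, about whose dependence on
  \<open>p\<close> nothing is known. Smoothness in \<open>p\<close> has to be read in one chart
  \<open>c\<close> for all nearby points.\<close>

lemma vf_apply_chart:
  assumes f: "sm_on A V f" and c: "c \<in> A" and p: "p \<in> fst c" "p \<in> V"
  shows "vf_apply A X f p = frechet_derivative (f \<circ> inv_chart c) (at (snd c p)) (to_chart A c p (X p))"
proof -
  let ?e = "chart_at A p"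
  let ?S = "snd ?e ` (fst ?e \<inter> (V \<inter> fst c))"
  have o: "open ?S" by (intro open_image open_Int open_dom V c chart_at)
  have g: "((f \<circ> inv_chart c) has_derivative frechet_derivative (f \<circ> inv_chart c) (at (snd c p)))
      (at ((snd c \<circ> inv_chart ?e) (snd ?e p)))"
    using sm_differentiable[OF f c p] by (simp add: frechet_derivative_works[symmetric] chart_at)
  have "((\<lambda>x. (f \<circ> inv_chart c) ((snd c \<circ> inv_chart ?e) x)) has_derivative
      (\<lambda>v. frechet_derivative (f \<circ> inv_chart c) (at (snd c p)) (J ?e c (snd ?e p) v))) (at (snd ?e p))"
    by (rule has_derivative_compose[OF J_has_derivative g]) (use c p chart_at in auto)
  then have "((f \<circ> inv_chart ?e) has_derivative
      (\<lambda>v. frechet_derivative (f \<circ> inv_chart c) (at (snd c p)) (J ?e c (snd ?e p) v))) (at (snd ?e p))"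
    by (rule has_derivative_transform_within_open[OF _ o]) (use c p in \<open>auto simp: chart_at\<close>)
  from frechet_derivative_at[OF this] show ?thesis
    unfolding vf_apply_def to_chart_eq by metis
qed

lemma sm_vf_apply:
  assumes "sm_on A V f" "vsm_on A V X"
  shows "sm_on A V (vf_apply A X f)"
  unfolding sm_on_def
proof
  fix c assume c: "c \<in> A"
  have "smooth_on (snd c ` (fst c \<inter> V)) (\<lambda>x. frechet_derivative (f \<circ> inv_chart c) (at x) (vf_rep A c X x))"
    by (rule smooth_on_frechet_field[OF open_image[OF c V]])
      (use assms c in \<open>unfold sm_on_def vsm_on_def, blast+\<close>)
  then show "smooth_on (snd c ` (fst c \<inter> V)) (vf_apply A X f \<circ> inv_chart c)"
    by (rule smooth_on_cong[OF open_image[OF c V]])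
      (use c in \<open>auto simp: vf_rep_def vf_apply_chart[OF assms(1) c]\<close>)
qed

lemma vf_apply_linear_field:
  assumes "sm_on A V f" "p \<in> V" "X p = (\<Sum>s\<in>I. v s *\<^sub>R E s p)"
  shows "vf_apply A X f p = (\<Sum>s\<in>I. v s * vf_apply A (E s) f p)"
proof -
  have "linear (frechet_derivative (f \<circ> inv_chart (chart_at A p)) (at (snd (chart_at A p) p)))"
    using sm_differentiable[OF assms(1) chart_at assms(2)] linear_frechet_derivative by blast
  then show ?thesis unfolding vf_apply_def assms(3) by (simp add: linear_sum linear_scale)
qed

lemma vf_apply_cong:
  assumes "p \<in> V" "\<And>q. q \<in> V \<Longrightarrow> f q = g q" "X p = Y p"
  shows "vf_apply A X f p = vf_apply A Y g p"
proof -
  let ?c = "chart_at A p"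
  let ?S = "snd ?c ` (fst ?c \<inter> V)"
  have o: "open ?S" "snd ?c p \<in> ?S" using open_image[OF chart_at(1) V] chart_at assms(1) by auto
  have eq: "(f \<circ> inv_chart ?c) x = (g \<circ> inv_chart ?c) x" if "x \<in> ?S" for x
    using that image_Int_iff[OF chart_at(1), of x p V] assms(2) by auto
  \<comment> \<open>Both functions have the same derivatives, hence
    \<open>frechet_derivative\<close> selects the same value for both, even at a point where they
    have none.\<close>
  have "((f \<circ> inv_chart ?c) has_derivative f') (at (snd ?c p)) \<longleftrightarrow>
      ((g \<circ> inv_chart ?c) has_derivative f') (at (snd ?c p))" for f'
    using has_derivative_transform_within_open[OF _ o, of "f \<circ> inv_chart ?c" f' UNIV "g \<circ> inv_chart ?c"]
      has_derivative_transform_within_open[OF _ o, of "g \<circ> inv_chart ?c" f' UNIV "f \<circ> inv_chart ?c"] eq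
    by auto
  then show ?thesis by (simp add: vf_apply_def frechet_derivative_def assms(3))
qed

lemma vf_apply_const: "vf_apply A X (\<lambda>p. r) p = 0"
  by (simp add: vf_apply_def comp_def frechet_derivative_const)

lemma vf_apply_has_derivative:
  assumes "sm_on A V f" "p \<in> V"
  shows "((f \<circ> inv_chart (chart_at A p)) has_derivative
     frechet_derivative (f \<circ> inv_chart (chart_at A p)) (at (snd (chart_at A p) p))) (at (snd (chart_at A p) p))"
  using sm_differentiable[OF assms(1) chart_at assms(2)] by (simp add: frechet_derivative_works[symmetric])

lemma vf_apply_add:
  assumes "sm_on A V f" "sm_on A V g" "p \<in> V"
  shows "vf_apply A X (\<lambda>p. f p + g p) p = vf_apply A X f p + vf_apply A X g p"
  using frechet_derivative_at[OF has_derivative_add[OF vf_apply_has_derivative[OF assms(1,3)]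
        vf_apply_has_derivative[OF assms(2,3)]], symmetric]
  by (simp add: vf_apply_def comp_def)

lemma vf_apply_mult:
  assumes "sm_on A V f" "sm_on A V g" "p \<in> V"
  shows "vf_apply A X (\<lambda>p. f p * g p) p = vf_apply A X f p * g p + f p * vf_apply A X g p"
  using frechet_derivative_at[OF has_derivative_mult[OF vf_apply_has_derivative[OF assms(1,3)]
        vf_apply_has_derivative[OF assms(2,3)]], symmetric]
  by (simp add: vf_apply_def comp_def chart_at)

lemma vf_apply_sum:
  assumes "\<And>i. i \<in> I \<Longrightarrow> sm_on A V (f i)" "p \<in> V"
  shows "vf_apply A X (\<lambda>p. \<Sum>i\<in>I. f i p) p = (\<Sum>i\<in>I. vf_apply A X (f i) p)"
  using assms(1)
  by (induction I rule: infinite_finite_induct) (auto simp: vf_apply_const vf_apply_add sm_sum assms(2))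

text \<open>In the chart at \<open>p\<close> each iterated derivative splits by
  \<open>frechet_derivative_field\<close>. The second derivatives of \<open>f\<close> cancel by
  symmetry, and what is left is the coordinate formula that defines the bracket.\<close>

lemma vf_apply_lie_bracket:
  assumes f: "sm_on A V f" and X: "vsm_on A V X" and Y: "vsm_on A V Y" and p: "p \<in> V"
  shows "vf_apply A (lie_bracket A X Y) f p = vf_apply A X (vf_apply A Y f) p - vf_apply A Y (vf_apply A X f) p"
proof -
  let ?e = "chart_at A p"
  let ?S = "snd ?e ` (fst ?e \<inter> V)" and ?x = "snd (chart_at A p) p"
  define F where "F = f \<circ> inv_chart ?e"
  have o: "open ?S" by (rule open_image[OF chart_at(1) V])
  have x: "?x \<in> ?S" using p chart_at by auto
  have F: "smooth_on ?S F" using f chart_at by (auto simp: F_def sm_on_def)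
  have sX: "smooth_on ?S (vf_rep A ?e Z)" if "vsm_on A V Z" for Z
    using that chart_at by (auto simp: vsm_on_def)
  have rep: "vf_rep A ?e Z ?x = Z p" for Z
    by (simp add: vf_rep_def chart_at)
  have app: "vf_apply A Z (vf_apply A Z' f) p =
      frechet_derivative (\<lambda>y. frechet_derivative F (at y) (Z' p)) (at ?x) (Z p)
      + frechet_derivative F (at ?x) (frechet_derivative (vf_rep A ?e Z') (at ?x) (Z p))"
    if Z': "vsm_on A V Z'" for Z Z'
  proof -
    have "frechet_derivative (vf_apply A Z' f \<circ> inv_chart ?e) (at ?x) =
        frechet_derivative (\<lambda>y. frechet_derivative F (at y) (vf_rep A ?e Z' y)) (at ?x)"
    proof (rule frechet_derivative_cong_open[OF o x])
      show "(vf_apply A Z' f \<circ> inv_chart ?e) y = frechet_derivative F (at y) (vf_rep A ?e Z' y)"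
        if y: "y \<in> ?S" for y
      proof -
        have "y \<in> snd ?e ` fst ?e" using y by auto
        then have q: "inv_chart ?e y \<in> fst ?e" "inv_chart ?e y \<in> V" "snd ?e (inv_chart ?e y) = y"
          using y chart_at image_Int_iff[OF chart_at(1)] by auto
        show ?thesis
          using vf_apply_chart[OF f chart_at(1) q(1,2), of Z'] q(3)
          by (simp add: vf_rep_def F_def)
      qed
      show "(vf_apply A Z' f \<circ> inv_chart ?e) differentiable (at ?x)"
        by (rule sm_differentiable[OF sm_vf_apply[OF f Z'] chart_at p])
    qed
    then show ?thesis
      unfolding vf_apply_def[of A Z] using frechet_derivative_field[OF o x F sX[OF Z']] by (simp add: rep)
  qed
  have lin: "linear (frechet_derivative F (at ?x))"
    using smooth_on_differentiable[OF F x] linear_frechet_derivative by blast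
  have "frechet_derivative (\<lambda>y. frechet_derivative F (at y) (Y p)) (at ?x) (X p) =
    frechet_derivative (\<lambda>y. frechet_derivative F (at y) (X p)) (at ?x) (Y p)"
    by (rule frechet_derivative_commute[OF o F x])
  then show ?thesis
    unfolding app[OF X] app[OF Y]
    by (simp add: vf_apply_def lie_bracket_def Let_def F_def[symmetric] linear_diff[OF lin])
qed

end

section \<open>Coordinate functions, cutoffs and extension of local data\<close>

lemma coordinate_sm:
  assumes c: "c \<in> A"
  shows "sm_on A (fst c) (\<lambda>q. snd c q $ i)"
proof (rule sm_on_chart[OF c open_dom[OF c] order_refl])
  show "smooth_on (snd c ` fst c) ((\<lambda>q. snd c q $ i) \<circ> inv_chart c)"
    by (rule smooth_on_cong[OF open_ran[OF c] smooth_on_bounded_linear[OF open_ran[OF c] bounded_linear_vec_nth[of i]]])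
      (use c in auto)
qed

lemma vf_apply_coordinate:
  assumes c: "c \<in> A" and p: "p \<in> fst c"
  shows "vf_apply A X (\<lambda>q. snd c q $ i) p = to_chart A c p (X p) $ i"
proof -
  have "((\<lambda>x. x $ i) has_derivative (\<lambda>v. v $ i)) (at (snd c p))"
    by (rule bounded_linear_imp_has_derivative[OF bounded_linear_vec_nth])
  then have "(((\<lambda>q. snd c q $ i) \<circ> inv_chart c) has_derivative (\<lambda>v. v $ i)) (at (snd c p))"
    by (rule has_derivative_transform_within_open[OF _ open_ran[OF c]]) (use c p in auto)
  from frechet_derivative_at[OF this] show ?thesis
    using vf_apply_chart[OF open_dom[OF c] coordinate_sm[OF c] c p p, of X i] by metis
qed

text \<open>A Euclidean cutoff is transported by the chart at \<open>p\<close>. The closed ball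
  \<open>K\<close> containing its support is compact, hence closed in a Hausdorff space, so
  extension by zero is smooth. \<open>N\<close> is the complement of \<open>K\<close>; together with
  \<open>V\<close> it covers everything, which is the form needed for gluing.\<close>

lemma bump:
  assumes V: "open V" and p: "p \<in> V"
  obtains \<rho> W N where "smooth_fun A \<rho>" "open W" "p \<in> W" "W \<subseteq> V" "\<And>q. q \<in> W \<Longrightarrow> \<rho> q = 1"
    "open N" "V \<union> N = UNIV" "\<And>q. q \<in> N \<Longrightarrow> \<rho> q = 0"
proof -
  let ?e = "chart_at A p"
  let ?S = "snd ?e ` (fst ?e \<inter> V)" and ?x = "snd (chart_at A p) p"
  have o: "open ?S" by (rule open_image[OF chart_at(1) V])
  have x: "?x \<in> ?S" using p chart_at by auto
  obtain r where r: "r > 0" "cball ?x r \<subseteq> ?S" using o x open_contains_cball by blast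
  obtain h :: "real^'n \<Rightarrow> real" where h: "smooth_on UNIV h"
    "\<And>y. dist ?x y \<le> r / 2 \<Longrightarrow> h y = 1" "\<And>y. dist ?x y \<ge> 2 * (r / 2) \<Longrightarrow> h y = 0"
    using smooth_cutoff[of "r / 2" ?x] r(1) by auto
  define K where "K = inv_chart ?e ` cball ?x r"
  define W where "W = snd ?e -` ball ?x (r / 2) \<inter> fst ?e"
  define \<rho> where "\<rho> q = (if q \<in> fst ?e then h (snd ?e q) else 0)" for q
  have sub: "cball ?x r \<subseteq> snd ?e ` fst ?e" using r(2) by auto
  have hm: "homeomorphism (fst ?e) (snd ?e ` fst ?e) (snd ?e) (inv_chart ?e)"
    by (rule homeo[OF chart_at(1)])
  have KV: "K \<subseteq> fst ?e \<inter> V"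
    using r(2) image_Int_iff[OF chart_at(1)] inv_chart_in[OF chart_at(1)] by (fastforce simp: K_def)
  have "compact K" unfolding K_def
    by (rule compact_continuous_image[OF continuous_on_subset[OF _ sub]])
      (use hm in \<open>auto simp: homeomorphism_def\<close>)
  then have cl: "closed K" by (rule compact_imp_closed)
  have \<rho>0: "\<rho> q = 0" if "q \<notin> K" for q
  proof (cases "q \<in> fst ?e")
    case True
    have "snd ?e q \<notin> cball ?x r"
      using that True chart_at(1) unfolding K_def by (metis imageI inv_chart)
    then show ?thesis using True h(3)[of "snd ?e q"] by (simp add: \<rho>_def)
  qed (simp add: \<rho>_def)
  have "sm_on A UNIV \<rho>"
  proof (rule sm_on_local)
    fix q :: 'm
    show "\<exists>W. open W \<and> q \<in> W \<and> sm_on A W \<rho>"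
    proof (cases "q \<in> K")
      case True
      have "smooth_on (snd ?e ` fst ?e) (\<rho> \<circ> inv_chart ?e)"
        by (rule smooth_on_cong[OF open_ran[OF chart_at(1)] smooth_on_subset[OF h(1)]])
          (use chart_at in \<open>auto simp: \<rho>_def\<close>)
      then have "sm_on A (fst ?e) \<rho>"
        by (rule sm_on_chart[OF chart_at(1) open_dom[OF chart_at(1)] order_refl])
      then show ?thesis using True KV open_dom[OF chart_at(1)] by blast
    next
      case False
      have "sm_on A (- K) \<rho>"
        by (rule sm_on_cong[OF open_Compl[OF cl] sm_const[OF open_Compl[OF cl], of 0]]) (use \<rho>0 in auto)
      then show ?thesis using False open_Compl[OF cl] by blast
    qed
  qed
  moreover have "open W"
    unfolding W_def using hm continuous_on_open_vimage[OF open_dom[OF chart_at(1)]]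
    by (auto simp: homeomorphism_def)
  moreover have "p \<in> W" using r chart_at by (auto simp: W_def)
  moreover have "W \<subseteq> V"
  proof
    fix q assume "q \<in> W"
    then have q: "q \<in> fst ?e" "snd ?e q \<in> cball ?x r" using r(1) by (auto simp: W_def)
    then have "snd ?e q \<in> ?S" using r(2) by blast
    then show "q \<in> V" using image_Int_iff[OF chart_at(1)] chart_at(1) q(1) by auto
  qed
  moreover have "\<rho> q = 1" if "q \<in> W" for q using that h(2)[of "snd ?e q"] by (simp add: W_def \<rho>_def)
  moreover have "open (- K)" "V \<union> - K = UNIV" using cl KV by auto
  moreover have "\<rho> q = 0" if "q \<in> - K" for q using \<rho>0 that by auto
  ultimately show thesis using that[of \<rho> W "- K"] by (simp add: smooth_fun_iff)
qed

text \<open>Connections and their axioms accept global functions and fields only. One cutoff serves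
  the whole family, so that all members agree with the given ones on a common neighbourhood.\<close>

lemma extend_sm:
  assumes V: "open V" "p \<in> V" and f: "\<And>i. sm_on A V (f i)"
  obtains h W where "\<And>i. smooth_fun A (h i)" "open W" "p \<in> W" "W \<subseteq> V" "\<And>q i. q \<in> W \<Longrightarrow> h i q = f i q"
proof -
  obtain \<rho> W N where b: "smooth_fun A \<rho>" "open W" "p \<in> W" "W \<subseteq> V" "\<And>q. q \<in> W \<Longrightarrow> \<rho> q = 1"
    "open N" "V \<union> N = UNIV" "\<And>q. q \<in> N \<Longrightarrow> \<rho> q = 0" using bump[OF V] by blast
  define h where "h i q = (if q \<in> V then \<rho> q * f i q else 0)" for i q
  have "sm_on A UNIV (h i)" for i
  proof (rule sm_on_local)
    fix q :: 'm
    have "sm_on A V (\<lambda>q. \<rho> q * f i q)"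
      by (intro sm_mult V f sm_on_subset[OF b(1)[unfolded smooth_fun_iff] subset_UNIV])
    then have "sm_on A V (h i)" by (rule sm_on_cong[OF V(1)]) (simp add: h_def)
    moreover have "sm_on A N (h i)"
      by (rule sm_on_cong[OF b(6) sm_const[OF b(6), of 0]]) (use b(8) in \<open>auto simp: h_def\<close>)
    ultimately show "\<exists>W. open W \<and> q \<in> W \<and> sm_on A W (h i)" using b(6,7) V(1) by blast
  qed
  moreover have "h i q = f i q" if "q \<in> W" for q i using b(4,5) that by (auto simp: h_def)
  ultimately show thesis using that[of h W] b(2-4) by (simp add: smooth_fun_iff)
qed

lemma extend_vsm:
  assumes V: "open V" "p \<in> V" and X: "\<And>i. vsm_on A V (X i)"
  obtains Y W where "\<And>i. smooth_vf A (Y i)" "open W" "p \<in> W" "W \<subseteq> V" "\<And>q i. q \<in> W \<Longrightarrow> Y i q = X i q"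
proof -
  obtain \<rho> W N where b: "smooth_fun A \<rho>" "open W" "p \<in> W" "W \<subseteq> V" "\<And>q. q \<in> W \<Longrightarrow> \<rho> q = 1"
    "open N" "V \<union> N = UNIV" "\<And>q. q \<in> N \<Longrightarrow> \<rho> q = 0" using bump[OF V] by blast
  define Y where "Y i q = (if q \<in> V then \<rho> q *\<^sub>R X i q else 0)" for i q
  have "vsm_on A UNIV (Y i)" for i
  proof (rule vsm_on_local)
    fix q :: 'm
    have "vsm_on A V (\<lambda>q. \<rho> q *\<^sub>R X i q)"
      by (intro vsm_scaleR V X sm_on_subset[OF b(1)[unfolded smooth_fun_iff] subset_UNIV])
    then have "vsm_on A V (Y i)" by (rule vsm_on_cong[OF V(1)]) (simp add: Y_def)
    moreover have "vsm_on A N (Y i)"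
      by (rule vsm_on_cong[OF b(6) vsm_zero[OF b(6)]]) (use b(8) in \<open>auto simp: Y_def\<close>)
    ultimately show "\<exists>W. open W \<and> q \<in> W \<and> vsm_on A W (Y i)" using b(6,7) V(1) by blast
  qed
  moreover have "Y i q = X i q" if "q \<in> W" for q i using b(4,5) that by (auto simp: Y_def)
  ultimately show thesis using that[of Y W] b(2-4) by (simp add: smooth_vf_iff)
qed

end

section \<open>Dual frames and linear connections\<close>

lemma vec_axis_sum: "(SUM b. w $ b *\<^sub>R axis b 1) = (w :: real^'n)"
  by (simp add: vec_eq_iff axis_def if_distrib[of "\<lambda>x. _ * x"] cong: if_cong)

section \<open>Smooth forms and dual frames\<close>

lemma smooth_on_det:
  fixes F :: "'a::euclidean_space \<Rightarrow> real^'n^'n"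
  assumes "open S" "\<And>i j. smooth_on S (\<lambda>x. F x $ i $ j)"
  shows "smooth_on S (\<lambda>x. det (F x))"
  unfolding det_def
  by (intro smooth_on_sum smooth_on_mult smooth_on_const smooth_on_prod assms)

lemma smooth_form_subset: "smooth_form A U k \<omega> \<Longrightarrow> V \<subseteq> U \<Longrightarrow> smooth_form A V k \<omega>"
  unfolding smooth_form_def by (meson Int_mono image_mono order_refl smooth_on_subset subsetD)

lemma smooth_form_linear:
  assumes "smooth_form A U k \<omega>" "p \<in> U" "length vs = k" "i < k"
  shows "linear (\<lambda>v. \<omega> p (vs[i := v]))"
  using assms unfolding smooth_form_def by blast

lemma smooth_form1_linear: "smooth_form A U 1 \<omega> \<Longrightarrow> p \<in> U \<Longrightarrow> linear (\<lambda>v. \<omega> p [v])"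
  using smooth_form_linear[of A U 1 \<omega> p "[0]" 0] by simp

lemma smooth_form3_linear:
  assumes "smooth_form A U 3 \<omega>" "p \<in> U"
  shows "linear (\<lambda>v. \<omega> p [v, y, z])" "linear (\<lambda>v. \<omega> p [x, v, z])" "linear (\<lambda>v. \<omega> p [x, y, v])"
  using smooth_form_linear[OF assms, of "[x, y, z]" 0] smooth_form_linear[OF assms, of "[x, y, z]" 1]
    smooth_form_linear[OF assms, of "[x, y, z]" 2]
  by (simp_all add: numeral_2_eq_2)

lemma smooth_form3_skew:
  assumes "smooth_form A U 3 \<omega>" "p \<in> U"
  shows "\<omega> p [y, x, z] = - \<omega> p [x, y, z]" "\<omega> p [x, z, y] = - \<omega> p [x, y, z]"
proof -
  note lin = smooth_form3_linear[OF assms]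
  have z: "\<omega> p [x, x, z] = 0" "\<omega> p [x, y, y] = 0" for x y z
  proof -
    have a: "\<forall>vs. length vs = 3 \<longrightarrow> (\<forall>i<3. \<forall>j<3. i \<noteq> j \<and> vs ! i = vs ! j \<longrightarrow> \<omega> p vs = 0)"
      using assms unfolding smooth_form_def by blast
    show "\<omega> p [x, x, z] = 0"
      using a[rule_format, of "[x, x, z]" 0 1] by simp
    show "\<omega> p [x, y, y] = 0"
      using a[rule_format, of "[x, y, y]" 1 2] by (simp add: numeral_2_eq_2)
  qed
  have "\<omega> p [x + y, x + y, z] = \<omega> p [x, x, z] + \<omega> p [x, y, z] + (\<omega> p [y, x, z] + \<omega> p [y, y, z])"
    by (simp add: linear_add[OF lin(1)] linear_add[OF lin(2)])
  then show "\<omega> p [y, x, z] = - \<omega> p [x, y, z]" by (simp add: z)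
  have "\<omega> p [x, y + z, y + z] = \<omega> p [x, y, y] + \<omega> p [x, y, z] + (\<omega> p [x, z, y] + \<omega> p [x, z, z])"
    by (simp add: linear_add[OF lin(2)] linear_add[OF lin(3)])
  then show "\<omega> p [x, z, y] = - \<omega> p [x, y, z]" by (simp add: z)
qed

context smooth_mfd
begin

lemma sm_form1:
  assumes U: "open U" and e: "smooth_form A U 1 \<omega>" and X: "vsm_on A U X"
  shows "sm_on A U (\<lambda>p. \<omega> p [X p])"
  unfolding sm_on_def
proof
  fix c assume c: "c \<in> A"
  let ?S = "snd c ` (fst c \<inter> U)"
  have "smooth_on ?S (\<lambda>x. SUM b. vf_rep A c X x $ b * form_rep A c \<omega> x [axis b 1])"
  proof (intro smooth_on_sum smooth_on_mult open_image[OF c U])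
    show "smooth_on ?S (\<lambda>x. vf_rep A c X x $ b)" for b
      using X c smooth_on_vec_iff[OF open_image[OF c U]] unfolding vsm_on_def by blast
    show "smooth_on ?S (\<lambda>x. form_rep A c \<omega> x [axis b 1])" for b
      using e c unfolding smooth_form_def by auto
  qed
  then show "smooth_on ?S ((\<lambda>p. \<omega> p [X p]) \<circ> inv_chart c)"
  proof (rule smooth_on_cong[OF open_image[OF c U]])
    fix x assume "x \<in> ?S"
    then have q: "inv_chart c x \<in> fst c" "inv_chart c x \<in> U" using c by auto
    let ?q = "inv_chart c x"
    note lin = smooth_form1_linear[OF e q(2)] and fl = from_chart_linear[OF c q(1)]
    have "X ?q = from_chart A c ?q (SUM b. vf_rep A c X x $ b *\<^sub>R axis b 1)"
      unfolding vec_axis_sum by (simp add: vf_rep_def c q)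
    also have "\<dots> = (SUM b. vf_rep A c X x $ b *\<^sub>R from_chart A c ?q (axis b 1))"
      by (simp add: linear_sum[OF fl] linear_scale[OF fl])
    finally show "(SUM b. vf_rep A c X x $ b * form_rep A c \<omega> x [axis b 1]) = ((\<lambda>p. \<omega> p [X p]) \<circ> inv_chart c) x"
      by (simp add: form_rep_def linear_sum[OF lin] linear_scale[OF lin])
  qed
qed

lemma sm_form3:
  assumes U: "open U" and e: "smooth_form A U 3 \<omega>" and X: "vsm_on A U X" and Y: "vsm_on A U Y" and Z: "vsm_on A U Z"
  shows "sm_on A U (\<lambda>p. \<omega> p [X p, Y p, Z p])"
  unfolding sm_on_def
proof
  fix c assume c: "c \<in> A"
  let ?S = "snd c ` (fst c \<inter> U)"
  let ?r = "\<lambda>X x b. vf_rep A c X x $ b"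
  have "smooth_on ?S (\<lambda>x. SUM i j k. ?r X x i * (?r Y x j * (?r Z x k *
      form_rep A c \<omega> x [axis i 1, axis j 1, axis k 1])))"
  proof (intro smooth_on_sum smooth_on_mult open_image[OF c U])
    show "smooth_on ?S (\<lambda>x. ?r X x b)" "smooth_on ?S (\<lambda>x. ?r Y x b)" "smooth_on ?S (\<lambda>x. ?r Z x b)" for b
      using X Y Z c smooth_on_vec_iff[OF open_image[OF c U]] unfolding vsm_on_def by blast+
    show "smooth_on ?S (\<lambda>x. form_rep A c \<omega> x [axis i 1, axis j 1, axis k 1])" for i j k
      using e c unfolding smooth_form_def by auto
  qed
  then show "smooth_on ?S ((\<lambda>p. \<omega> p [X p, Y p, Z p]) \<circ> inv_chart c)"
  proof (rule smooth_on_cong[OF open_image[OF c U]])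
    fix x assume "x \<in> ?S"
    then have q: "inv_chart c x \<in> fst c" "inv_chart c x \<in> U" using c by auto
    let ?q = "inv_chart c x"
    note lin = smooth_form3_linear[OF e q(2)] and fl = from_chart_linear[OF c q(1)]
    have rep: "X ?q = (SUM b. ?r X x b *\<^sub>R from_chart A c ?q (axis b 1))" for X
    proof -
      have "X ?q = from_chart A c ?q (SUM b. ?r X x b *\<^sub>R axis b 1)"
        unfolding vec_axis_sum by (simp add: vf_rep_def c q)
      also have "\<dots> = (SUM b. ?r X x b *\<^sub>R from_chart A c ?q (axis b 1))"
        by (simp add: linear_sum[OF fl] linear_scale[OF fl])
      finally show ?thesis .
    qed
    show "(SUM i j k. ?r X x i * (?r Y x j * (?r Z x k *
      form_rep A c \<omega> x [axis i 1, axis j 1, axis k 1]))) = ((\<lambda>p. \<omega> p [X p, Y p, Z p]) \<circ> inv_chart c) x"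
    proof -
      have 1: "\<omega> ?q [X ?q, y, z] = (SUM b. ?r X x b * \<omega> ?q [from_chart A c ?q (axis b 1), y, z])" for y z
        by (subst rep[of X]) (simp add: linear_sum[OF lin(1)] linear_scale[OF lin(1)])
      have 2: "\<omega> ?q [u, Y ?q, z] = (SUM b. ?r Y x b * \<omega> ?q [u, from_chart A c ?q (axis b 1), z])" for u z
        by (subst rep[of Y]) (simp add: linear_sum[OF lin(2)] linear_scale[OF lin(2)])
      have 3: "\<omega> ?q [u, y, Z ?q] = (SUM b. ?r Z x b * \<omega> ?q [u, y, from_chart A c ?q (axis b 1)])" for u y
        by (subst rep[of Z]) (simp add: linear_sum[OF lin(3)] linear_scale[OF lin(3)])
      show ?thesis
        unfolding comp_apply 1 unfolding 2 unfolding 3 form_rep_def by (simp add: sum_distrib_left)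
    qed
  qed
qed

text \<open>The matrix \<open>M\<close> of the coframe in the coordinates at \<open>p\<close> is
  invertible by pointwise independence. The columns of its inverse are the coordinates of the dual
  frame, which is then cut off to global fields.\<close>

lemma dual_frame:
  assumes U: "open U" "p \<in> U" and e: "coframe_on A U e"
  obtains E W where "\<And>a. smooth_vf A (E a)" "open W" "p \<in> W" "W \<subseteq> U" "W \<subseteq> fst (chart_at A p)"
    "\<And>q i j. q \<in> W \<Longrightarrow> e i q [E j q] = (if i = j then 1 else 0)"
proof -
  let ?c = "chart_at A p"
  note c = chart_at(1)[of p]
  define V where "V = U \<inter> fst ?c"
  have V: "open V" "p \<in> V" "V \<subseteq> fst ?c" "V \<subseteq> U" using U open_dom[OF c] chart_at by (auto simp: V_def)
  let ?S = "snd ?c ` V"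
  have S: "open ?S" using open_image[OF c V(1)] V(3) by (simp add: Int_absorb1)
  define M where "M x = (\<chi> i b. form_rep A ?c (e i) x [axis b 1])" for x
  have e1: "smooth_form A U 1 (e i)" for i using e by (simp add: coframe_on_def)
  have sM: "smooth_on ?S (\<lambda>x. M x $ i $ b)" for i b
  proof -
    have "smooth_on (snd ?c ` (fst ?c \<inter> U)) (\<lambda>x. form_rep A ?c (e i) x [axis b 1])"
      using e1[of i] c unfolding smooth_form_def by simp
    moreover have "?S \<subseteq> snd ?c ` (fst ?c \<inter> U)" by (auto simp: V_def)
    ultimately show ?thesis unfolding M_def by (simp add: smooth_on_subset)
  qed
  have Mv: "(M x *v w) $ i = e i (inv_chart ?c x) [from_chart A ?c (inv_chart ?c x) w]" if x: "x \<in> ?S" for x w i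
  proof -
    have q: "inv_chart ?c x \<in> fst ?c" "inv_chart ?c x \<in> U"
      using x V(3,4) by (auto simp: inv_chart[OF c] subset_iff)
    note lin = smooth_form1_linear[OF e1 q(2), of i] and fl = from_chart_linear[OF c q(1)]
    have "from_chart A ?c (inv_chart ?c x) w = from_chart A ?c (inv_chart ?c x) (SUM b. w $ b *\<^sub>R axis b 1)"
      unfolding vec_axis_sum ..
    then show ?thesis
      by (simp add: M_def matrix_vector_mult_def form_rep_def linear_sum[OF lin] linear_scale[OF lin]
          linear_sum[OF fl] linear_scale[OF fl] mult.commute)
  qed
  have det: "det (M x) \<noteq> 0" if x: "x \<in> ?S" for x
  proof -
    have q: "inv_chart ?c x \<in> fst ?c" "inv_chart ?c x \<in> U"
      using x V(3,4) by (auto simp: inv_chart[OF c] subset_iff)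
    have "\<forall>a. (SUM i. a i *s row i (M x)) = 0 \<longrightarrow> (\<forall>i. a i = 0)"
    proof (intro allI impI)
      fix a i assume a: "(SUM i. a i *s row i (M x)) = 0"
      have "(SUM i. a i * e i (inv_chart ?c x) [v]) = 0" for v
      proof -
        let ?w = "to_chart A ?c (inv_chart ?c x) v"
        have "e i (inv_chart ?c x) [v] = (SUM b. M x $ i $ b * ?w $ b)" for i
          using Mv[OF x, of ?w i] by (simp add: q c matrix_vector_mult_def)
        then have "(SUM i. a i * e i (inv_chart ?c x) [v]) = (SUM i b. a i * M x $ i $ b * ?w $ b)"
          by (simp add: sum_distrib_left mult.assoc)
        also have "\<dots> = (SUM b. (SUM i. a i * M x $ i $ b) * ?w $ b)"
          by (subst sum.swap) (simp add: sum_distrib_right)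
        also have "\<dots> = (SUM b. (SUM i. a i *s row i (M x)) $ b * ?w $ b)"
          by (simp add: row_def)
        finally show ?thesis by (simp add: a)
      qed
      then show "a i = 0" using e q(2) unfolding coframe_on_def by blast
    qed
    then obtain B where "M x ** B = mat 1"
      using matrix_right_invertible_independent_rows by blast
    then show ?thesis using invertible_det_nz[of "M x"] invertible_right_inverse by blast
  qed
  \<comment> \<open>The columns of the inverse matrix in Cramer's form, a quotient of determinants,
    from which smoothness can be read off.\<close>
  define W where "W j x = (\<chi> k. det (\<chi> i l. if l = k then axis j (1::real) $ i else M x $ i $ l) / det (M x))" for j x
  have MW: "M x *v W j x = axis j 1" if "x \<in> ?S" for j x
    using cramer[OF det[OF that], of "W j x" "axis j 1"] by (simp add: W_def)
  have sW: "smooth_on ?S (W j)" for j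
    unfolding smooth_on_vec_iff[OF S]
  proof
    fix k
    have e: "smooth_on ?S (\<lambda>x. if l = k then axis j (1::real) $ i else M x $ i $ l)" for i l
      by (cases "l = k") (simp_all add: smooth_on_const[OF S] sM)
    have "smooth_on ?S (\<lambda>x. det (\<chi> i l. if l = k then axis j (1::real) $ i else M x $ i $ l) * inverse (det (M x)))"
      by (intro smooth_on_mult smooth_on_inverse smooth_on_det S det sM) (simp add: e)
    then show "smooth_on ?S (\<lambda>x. W j x $ k)" by (simp add: W_def divide_inverse)
  qed
  define E0 where "E0 j q = from_chart A ?c q (W j (snd ?c q))" for j q
  have "vsm_on A V (E0 j)" for j
  proof (rule vsm_on_chart[OF c V(1,3)])
    show "smooth_on ?S (vf_rep A ?c (E0 j))"
      by (rule smooth_on_cong[OF S sW[of j]]) (use c V(3) in \<open>auto simp: vf_rep_def E0_def\<close>)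
  qed
  then obtain E :: "'n \<Rightarrow> ('m, 'n) vfield" and O' where
    E: "\<And>a. smooth_vf A (E a)" "open O'" "p \<in> O'" "O' \<subseteq> V" "\<And>q a. q \<in> O' \<Longrightarrow> E a q = E0 a q"
    by (rule extend_vsm[where X = E0, OF V(1,2)]) blast
  have "e i q [E j q] = (if i = j then 1 else 0)" if q: "q \<in> O'" for q i j
  proof -
    have qV: "q \<in> V" "q \<in> fst ?c" "snd ?c q \<in> ?S" using q E(4) V(3) by auto
    show ?thesis
      using Mv[OF qV(3), of "W j (snd ?c q)" i] MW[OF qV(3), of j] c qV E(5)[OF q]
      by (simp add: E0_def axis_def)
  qed
  then show thesis using that[of E O'] E V by blast
qed

end

section \<open>Locality of linear connections\<close>

locale mfd_connection = smooth_mfd A for A :: "('m::{t2_space,second_countable_topology}, 'n::finite) chart set" +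
  fixes D :: "('m, 'n) conn"
  assumes conn: "linear_connection A D"
begin

lemma vsm_UNIV: "smooth_vf A X \<Longrightarrow> vsm_on A V X"
  using vsm_on_subset[of UNIV X V] by (simp add: smooth_vf_iff)

lemma smooth_vf_add: "smooth_vf A X \<Longrightarrow> smooth_vf A Y \<Longrightarrow> smooth_vf A (\<lambda>p. X p + Y p)"
  by (simp add: smooth_vf_iff vsm_add)

lemma smooth_vf_scaleR: "smooth_fun A f \<Longrightarrow> smooth_vf A X \<Longrightarrow> smooth_vf A (\<lambda>p. f p *\<^sub>R X p)"
  by (simp add: smooth_vf_iff smooth_fun_iff vsm_scaleR)

lemma smooth_vf_sum: "(\<And>i. i \<in> I \<Longrightarrow> smooth_vf A (X i)) \<Longrightarrow> smooth_vf A (\<lambda>p. \<Sum>i\<in>I. X i p)"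
  by (simp add: smooth_vf_iff vsm_sum)

lemma smooth_vf_minus: "smooth_vf A X \<Longrightarrow> smooth_vf A (\<lambda>p. - X p)"
  using smooth_vf_scaleR[of "\<lambda>p. - 1" X] sm_const[OF open_UNIV] by (simp add: smooth_fun_iff)

lemma smooth_vf_diff: "smooth_vf A X \<Longrightarrow> smooth_vf A Y \<Longrightarrow> smooth_vf A (\<lambda>p. X p - Y p)"
  using smooth_vf_add[OF _ smooth_vf_minus] by simp

lemmas conn_props = conn[unfolded linear_connection_def]

lemma D_smooth: "smooth_vf A X \<Longrightarrow> smooth_vf A Y \<Longrightarrow> smooth_vf A (D X Y)"
  by (rule conn_props[THEN conjunct1, rule_format]) simp

lemma D_add1:
  "smooth_vf A X \<Longrightarrow> smooth_vf A X' \<Longrightarrow> smooth_vf A Y \<Longrightarrow>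
    D (\<lambda>p. X p + X' p) Y p = D X Y p + D X' Y p"
  using fun_cong[OF conn_props[THEN conjunct2, THEN conjunct1, rule_format]] by simp

lemma D_scale1:
  "smooth_fun A f \<Longrightarrow> smooth_vf A X \<Longrightarrow> smooth_vf A Y \<Longrightarrow>
    D (\<lambda>p. f p *\<^sub>R X p) Y p = f p *\<^sub>R D X Y p"
  using fun_cong[OF conn_props[THEN conjunct2, THEN conjunct2, THEN conjunct1, rule_format]] by simp

lemma D_add2:
  "smooth_vf A X \<Longrightarrow> smooth_vf A Y \<Longrightarrow> smooth_vf A Y' \<Longrightarrow>
    D X (\<lambda>p. Y p + Y' p) p = D X Y p + D X Y' p"
  using fun_cong[OF conn_props[THEN conjunct2, THEN conjunct2, THEN conjunct2, THEN conjunct1, rule_format]] by simp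

lemma D_scale2:
  "smooth_fun A f \<Longrightarrow> smooth_vf A X \<Longrightarrow> smooth_vf A Y \<Longrightarrow>
    D X (\<lambda>p. f p *\<^sub>R Y p) p = vf_apply A X f p *\<^sub>R Y p + f p *\<^sub>R D X Y p"
  using fun_cong[OF conn_props[THEN conjunct2, THEN conjunct2, THEN conjunct2, THEN conjunct2, rule_format]] by simp

text \<open>With \<open>h\<close> one minus a bump function at \<open>p\<close>, a field vanishing
  near \<open>p\<close> equals \<open>h\<close> times itself. Function-linearity and the Leibniz
  rule at \<open>p\<close> then show that a connection depends only on germs.\<close>

lemma vanishing_cutoff:
  assumes W: "open W" "p \<in> W" and Z: "\<And>q. q \<in> W \<Longrightarrow> Z q = 0"
  obtains h where "smooth_fun A h" "h p = 0" "Z = (\<lambda>q. h q *\<^sub>R (Z q :: real^'n))"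
proof -
  obtain \<rho> W' N where b: "smooth_fun A \<rho>" "p \<in> W'" "\<And>q. q \<in> W' \<Longrightarrow> \<rho> q = 1"
    "W \<union> N = UNIV" "\<And>q. q \<in> N \<Longrightarrow> \<rho> q = 0" using bump[OF W] by metis
  have "smooth_fun A (\<lambda>q. 1 + - 1 * \<rho> q)"
    using b(1) unfolding smooth_fun_iff by (intro sm_add sm_mult sm_const open_UNIV)
  moreover have "Z = (\<lambda>q. (1 + - 1 * \<rho> q) *\<^sub>R Z q)"
  proof
    fix q
    have "q \<in> W \<or> q \<in> N" using b(4) by blast
    then show "Z q = (1 + - 1 * \<rho> q) *\<^sub>R Z q" using Z b(5) by auto
  qed
  ultimately show thesis using that b(2,3) by simp
qed

lemma D_local1:
  assumes "smooth_vf A X" "smooth_vf A X'" "smooth_vf A Y" "open W" "p \<in> W" "\<And>q. q \<in> W \<Longrightarrow> X q = X' q"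
  shows "D X Y p = D X' Y p"
proof -
  define Z where "Z q = X q - X' q" for q
  have Z: "smooth_vf A Z" unfolding Z_def[abs_def] by (rule smooth_vf_diff[OF assms(1,2)])
  obtain h where h: "smooth_fun A h" "h p = 0" "Z = (\<lambda>q. h q *\<^sub>R Z q)"
    using vanishing_cutoff[OF assms(4,5), of Z] assms(6) by (metis Z_def right_minus_eq)
  have "D Z Y p = h p *\<^sub>R D Z Y p"
    using D_scale1[OF h(1) Z assms(3), of p, folded h(3)] .
  then have "D Z Y p = 0" using h(2) by simp
  moreover have "(\<lambda>q. Z q + X' q) = X" by (simp add: Z_def)
  ultimately show ?thesis using D_add1[OF Z assms(2,3), of p] by simp
qed

lemma D_local2:
  assumes "smooth_vf A X" "smooth_vf A Y" "smooth_vf A Y'" "open W" "p \<in> W" "\<And>q. q \<in> W \<Longrightarrow> Y q = Y' q"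
  shows "D X Y p = D X Y' p"
proof -
  define Z where "Z q = Y q - Y' q" for q
  have Z: "smooth_vf A Z" unfolding Z_def[abs_def] by (rule smooth_vf_diff[OF assms(2,3)])
  obtain h where h: "smooth_fun A h" "h p = 0" "Z = (\<lambda>q. h q *\<^sub>R Z q)"
    using vanishing_cutoff[OF assms(4,5), of Z] assms(6) by (metis Z_def right_minus_eq)
  have "D X Z p = vf_apply A X h p *\<^sub>R Z p + h p *\<^sub>R D X Z p"
    using D_scale2[OF h(1) assms(1) Z, of p, folded h(3)] .
  moreover have "Z p = 0" using assms(5,6) by (simp add: Z_def)
  ultimately have "D X Z p = 0" using h(2) by simp
  moreover have "(\<lambda>q. Z q + Y' q) = Y" by (simp add: Z_def)
  ultimately show ?thesis using D_add2[OF assms(1) Z assms(3), of p] by simp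
qed

lemma smooth_vf_zero: "smooth_vf A (\<lambda>p. 0)"
  by (simp add: smooth_vf_iff vsm_zero)

lemma D_sum1:
  assumes "finite I" "\<And>i. i \<in> I \<Longrightarrow> smooth_vf A (X i)" "smooth_vf A Y"
  shows "D (\<lambda>p. \<Sum>i\<in>I. X i p) Y p = (\<Sum>i\<in>I. D (X i) Y p)"
  using assms(1,2)
proof (induction I)
  case empty
  show ?case using D_add1[OF smooth_vf_zero smooth_vf_zero assms(3), of p] by simp
qed (simp add: D_add1 smooth_vf_sum assms(3))

lemma D_sum2:
  assumes "finite I" "\<And>i. i \<in> I \<Longrightarrow> smooth_vf A (Y i)" "smooth_vf A X"
  shows "D X (\<lambda>p. \<Sum>i\<in>I. Y i p) p = (\<Sum>i\<in>I. D X (Y i) p)"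
  using assms(1,2)
proof (induction I)
  case empty
  show ?case using D_add2[OF assms(3) smooth_vf_zero smooth_vf_zero, of p] by simp
qed (simp add: D_add2 smooth_vf_sum assms(3))

text \<open>The coefficients \<open>f\<close> live on \<open>V\<close>. They are replaced by global
  functions with the same germs at \<open>p\<close>, so that the axioms of a connection
  apply.\<close>

lemma D_expand1:
  fixes E :: "'i::finite \<Rightarrow> ('m, 'n) vfield"
  assumes V: "open V" "p \<in> V" and f: "\<And>s. sm_on A V (f s)" and E: "\<And>s. smooth_vf A (E s)"
    and X: "smooth_vf A X" "\<And>q. q \<in> V \<Longrightarrow> X q = (SUM s. f s q *\<^sub>R E s q)" and Y: "smooth_vf A Y"
  shows "D X Y p = (SUM s. f s p *\<^sub>R D (E s) Y p)"
proof -
  obtain h W where h: "\<And>i. smooth_fun A (h i)" "open W" "p \<in> W" "W \<subseteq> V" "\<And>q i. q \<in> W \<Longrightarrow> h i q = f i q"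
    by (rule extend_sm[where f = f, OF V f]) blast
  have "D X Y p = D (\<lambda>q. SUM s. h s q *\<^sub>R E s q) Y p"
    using X(2) h(4,5)
    by (intro D_local1[OF X(1) smooth_vf_sum Y h(2,3)] smooth_vf_scaleR h(1) E) auto
  also have "\<dots> = (SUM s. h s p *\<^sub>R D (E s) Y p)"
    by (simp add: D_sum1 D_scale1 smooth_vf_scaleR h(1) E Y)
  finally show ?thesis using h(3,5) by simp
qed

lemma D_expand2:
  fixes E :: "'i::finite \<Rightarrow> ('m, 'n) vfield"
  assumes V: "open V" "p \<in> V" and f: "\<And>s. sm_on A V (f s)" and E: "\<And>s. smooth_vf A (E s)"
    and Y: "smooth_vf A Y" "\<And>q. q \<in> V \<Longrightarrow> Y q = (SUM s. f s q *\<^sub>R E s q)" and X: "smooth_vf A X"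
  shows "D X Y p = (SUM s. vf_apply A X (f s) p *\<^sub>R E s p + f s p *\<^sub>R D X (E s) p)"
proof -
  obtain h W where h: "\<And>i. smooth_fun A (h i)" "open W" "p \<in> W" "W \<subseteq> V" "\<And>q i. q \<in> W \<Longrightarrow> h i q = f i q"
    by (rule extend_sm[where f = f, OF V f]) blast
  have hf: "vf_apply A X (h s) p = vf_apply A X (f s) p" for s
    by (rule vf_apply_cong[OF h(2,3)]) (simp_all add: h(5))
  have "D X Y p = D X (\<lambda>q. SUM s. h s q *\<^sub>R E s q) p"
    using Y(2) h(4,5)
    by (intro D_local2[OF X Y(1) smooth_vf_sum h(2,3)] smooth_vf_scaleR h(1) E) auto
  also have "\<dots> = (SUM s. vf_apply A X (h s) p *\<^sub>R E s p + h s p *\<^sub>R D X (E s) p)"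
    by (simp add: D_sum2 D_scale2 smooth_vf_scaleR h(1) E X)
  finally show ?thesis using h(3,5) by (simp add: hf)
qed

end

section \<open>Adapted frames\<close>

lemma wedge1_3:
  "wedge1 [a, b, c] p [u, v, w] =
     a p [u] * b p [v] * c p [w] + a p [v] * b p [w] * c p [u] + a p [w] * b p [u] * c p [v]
     - a p [v] * b p [u] * c p [w] - a p [u] * b p [w] * c p [v] - a p [w] * b p [v] * c p [u]"
proof -
  have l3: "{..<length [a, b, c]} = {0, 1, 2::nat}" by auto
  have f12: "finite {1, 2::nat}" "0 \<notin> {1, 2::nat}" by auto
  have f2: "finite {2::nat}" "1 \<notin> {2::nat}" by auto
  show ?thesis
    unfolding wedge1_def l3
    unfolding sum_over_permutations_insert[OF f12] sum_over_permutations_insert[OF f2] permutes_sing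
    by (simp add: sign_swap_id sign_compose permutation_swap_id sign_id transpose_def numeral_2_eq_2)
qed

section \<open>Connection and torsion components in an adapted frame\<close>

locale g2_setup = mfd_connection A D
  for A :: "('m::{t2_space,second_countable_topology}, 7) chart set" and D :: "('m, 7) conn" +
  fixes \<phi> g vol \<tau> :: "('m, 7) tensor"
  assumes coframes: "\<exists>U e. p \<in> U \<and> adapted_coframe A \<phi> U e"
    and phi_form: "smooth_form A UNIV 3 \<phi>"
    and metric: "induced_metric A \<phi> g"
    and volume: "induced_volume A \<phi> vol"
    and cocal: "cocalibrated A \<phi> g vol"
    and parallel_g: "parallel A D 2 (on_fields g)"
    and parallel_phi: "parallel A D 3 (on_fields \<phi>)"
    and tau_form: "smooth_form A UNIV 3 \<tau>"
    and torsion_tau: "length Ys = 3 \<Longrightarrow> (\<forall>Y\<in>set Ys. smooth_vf A Y) \<Longrightarrow> torsion A g D Ys p = on_fields \<tau> Ys p"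
    and inst: "g2_instanton A \<phi> g D"
begin

text \<open>The domain lies in a single chart so that coordinate functions are available on all of
  it; they separate tangent vectors in \<open>independent\<close>.\<close>

definition is_frame :: "'m set \<Rightarrow> (7 \<Rightarrow> ('m, 7) tensor) \<Rightarrow> (7 \<Rightarrow> ('m, 7) vfield) \<Rightarrow> bool" where
  "is_frame V e E \<longleftrightarrow> open V \<and> (\<exists>c\<in>A. V \<subseteq> fst c) \<and> adapted_coframe A \<phi> V e \<and> (\<forall>a. smooth_vf A (E a)) \<and>
     (\<forall>q\<in>V. \<forall>i j. e i q [E j q] = kdelta i j)"

lemma frame_exists:
  obtains V e E where "p \<in> V" "is_frame V e E"
proof -
  obtain U e where U: "p \<in> U" "open U" "coframe_on A U e"
    and m: "\<forall>q\<in>U. \<forall>vs. length vs = 3 \<longrightarrow> \<phi> q vs = g2_model e q vs"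
    using coframes[of p] unfolding adapted_coframe_def by blast
  obtain E V where E: "\<And>a. smooth_vf A (E a)" "open V" "p \<in> V" "V \<subseteq> U" "V \<subseteq> fst (chart_at A p)"
    "\<And>q i j. q \<in> V \<Longrightarrow> e i q [E j q] = (if i = j then 1 else 0)"
    by (rule dual_frame[OF U(2,1,3)]) blast
  have "coframe_on A V e"
    using U(3) E(4) unfolding coframe_on_def by (meson smooth_form_subset subsetD)
  then have "adapted_coframe A \<phi> V e"
    unfolding adapted_coframe_def using E(2,4) m by blast
  then have "is_frame V e E"
    unfolding is_frame_def using E chart_at(1)[of p] by (auto simp: kdelta_def)
  then show thesis using that E(3) by blast
qed

end

locale g2_local_frame = g2_setup +
  fixes V e E
  assumes frame: "is_frame V e E"
begin

lemma V: "open V" and E_smooth: "smooth_vf A (E a)" and coframe: "adapted_coframe A \<phi> V e"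
  and dual: "q \<in> V \<Longrightarrow> e i q [E j q] = kdelta i j"
  using frame unfolding is_frame_def by auto

lemma e_form: "smooth_form A V 1 (e i)"
  using coframe unfolding adapted_coframe_def coframe_on_def by blast

lemma E_vsm: "vsm_on A V (E a)"
  by (rule vsm_UNIV[OF E_smooth])

definition \<Gamma> where "\<Gamma> a b c q = e c q [D (E a) (E b) q]"

definition T where "T a b c q = \<tau> q [E a q, E b q, E c q]"

lemma sm_coef: "smooth_vf A X \<Longrightarrow> sm_on A V (\<lambda>q. e c q [X q])"
  by (rule sm_form1[OF V e_form vsm_UNIV])

lemma sm_\<Gamma>: "sm_on A V (\<Gamma> a b c)"
  unfolding \<Gamma>_def by (rule sm_coef[OF D_smooth[OF E_smooth E_smooth]])

lemma sm_tau: "smooth_vf A X \<Longrightarrow> smooth_vf A Y \<Longrightarrow> smooth_vf A Z \<Longrightarrow> sm_on A V (\<lambda>q. \<tau> q [X q, Y q, Z q])"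
  by (rule sm_form3[OF V smooth_form_subset[OF tau_form subset_UNIV]]) (rule vsm_UNIV, assumption)+

lemma sm_T: "sm_on A V (T a b c)"
  unfolding T_def by (rule sm_tau[OF E_smooth E_smooth E_smooth])

context
  fixes q assumes q: "q \<in> V"
begin

lemma e_linear: "linear (\<lambda>v. e i q [v])"
  by (rule smooth_form1_linear[OF e_form q])

lemma e_sum: "e i q [(SUM s. v s *\<^sub>R E s q)] = v i"
  using q by (simp add: linear_sum[OF e_linear] linear_scale[OF e_linear] dual mult.commute[of "v _"] sum_kdelta)

text \<open>Duality says that the coframe matrix times the frame matrix is the identity. For square
  matrices the product in the other order is then the identity too, which is the expansion.\<close>

lemma frame_expansion: "v = (SUM s. e s q [v] *\<^sub>R E s q)"
proof -
  define M :: "real^7^7" where "M = (\<chi> i b. e i q [axis b 1])"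
  define N :: "real^7^7" where "N = (\<chi> b i. E i q $ b)"
  have Mv: "(M *v w) $ i = e i q [w]" for w i
  proof -
    have "e i q [w] = e i q [(SUM b. w $ b *\<^sub>R axis b 1)]" unfolding vec_axis_sum ..
    then show ?thesis
      by (simp add: M_def matrix_vector_mult_def linear_sum[OF e_linear] linear_scale[OF e_linear] mult.commute)
  qed
  have Nv: "(N *v w) $ i = (SUM s. E s q $ i * w $ s)" for w i
    by (simp add: matrix_vector_mult_def N_def)
  have "(M ** N) $ i $ j = e i q [E j q]" for i j
    using Mv[of "E j q" i] by (simp add: matrix_matrix_mult_def matrix_vector_mult_def N_def)
  then have "M ** N = mat 1"
    by (simp add: vec_eq_iff dual[OF q] mat_def kdelta_def)
  then have "N ** M = mat 1" using matrix_left_right_inverse by blast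
  then have "v = N *v (M *v v)" by (simp add: matrix_vector_mul_assoc)
  also have "\<dots> = (SUM s. e s q [v] *\<^sub>R E s q)"
    by (simp add: vec_eq_iff Nv Mv mult.commute)
  finally show ?thesis .
qed

lemma g_frame: "g q [u, v] = (SUM i. e i q [u] * e i q [v])"
  using metric coframe q unfolding induced_metric_def by blast

lemma g_E: "g q [v, E s q] = e s q [v]" "g q [E s q, v] = e s q [v]"
  by (simp_all add: g_frame dual[OF q] mult.commute[of "kdelta _ _"] sum_kdelta sum_kdelta2
      sum_kdelta2[where f = "\<lambda>i. e i q [v]", unfolded mult.commute[of "kdelta _ _"]])

lemma phi_frame: "\<phi> q [E i q, E j q, E k q] = phi0 i j k"
proof -
  have "\<phi> q [E i q, E j q, E k q] = g2_model e q [E i q, E j q, E k q]"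
    using coframe q unfolding adapted_coframe_def by simp
  then show ?thesis
    by (simp add: g2_model_def wedge1_3 dual[OF q] phi0_def wedge3_def)
qed

lemma D_frame: "D (E a) (E b) q = (SUM s. \<Gamma> a b s q *\<^sub>R E s q)"
  unfolding \<Gamma>_def by (rule frame_expansion)

text \<open>The bracket is recovered from the torsion, whose components are values of the smooth
  form \<tau>. Smoothness of the bracket of smooth fields follows from this expansion.\<close>

lemma bracket_frame:
  assumes "smooth_vf A X" "smooth_vf A Y"
  shows "lie_bracket A X Y q =
    (SUM s. (e s q [D X Y q] - e s q [D Y X q] - \<tau> q [X q, Y q, E s q]) *\<^sub>R E s q)"
proof -
  have "e s q [lie_bracket A X Y q] = e s q [D X Y q] - e s q [D Y X q] - \<tau> q [X q, Y q, E s q]" for s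
  proof -
    have "torsion A g D [X, Y, E s] q = on_fields \<tau> [X, Y, E s] q"
      by (rule torsion_tau) (use assms E_smooth in auto)
    then have "e s q [D X Y q - D Y X q - lie_bracket A X Y q] = \<tau> q [X q, Y q, E s q]"
      by (simp add: torsion_def Let_def on_fields_def g_E numeral_2_eq_2)
    then show ?thesis by (simp add: linear_diff[OF e_linear])
  qed
  then show ?thesis using frame_expansion[of "lie_bracket A X Y q"] by simp
qed

end

text \<open>The components of the metric in the frame are constant, so only the connection terms of
  its covariant derivative remain. The same applied to \<open>\<phi>\<close> gives
  \<open>\<Gamma>_phi0\<close>.\<close>

lemma \<Gamma>_skew:
  assumes q: "q \<in> V"
  shows "\<Gamma> a c b q = - \<Gamma> a b c q"
proof -
  have "cov_deriv A D (on_fields g) (E a) [E b, E c] q = 0"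
    using parallel_g E_smooth unfolding parallel_def by auto
  moreover have "vf_apply A (E a) (on_fields g [E b, E c]) q = vf_apply A (E a) (\<lambda>q. kdelta c b) q"
  proof (rule vf_apply_cong[OF V q, symmetric])
    fix r assume "r \<in> V"
    then show "kdelta c b = on_fields g [E b, E c] r"
      by (simp add: on_fields_def g_E dual)
  qed simp
  ultimately have "g q [D (E a) (E b) q, E c q] + g q [E b q, D (E a) (E c) q] = 0"
    by (simp add: cov_deriv_def on_fields_def vf_apply_const[OF V] numeral_2_eq_2)
  then show ?thesis by (simp add: g_E[OF q] \<Gamma>_def)
qed

lemma \<Gamma>_phi0:
  assumes q: "q \<in> V"
  shows "(SUM s. \<Gamma> a b s q * phi0 s c d + \<Gamma> a c s q * phi0 b s d + \<Gamma> a d s q * phi0 b c s) = 0"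
proof -
  note lin = smooth_form3_linear[OF phi_form UNIV_I]
  have "cov_deriv A D (on_fields \<phi>) (E a) [E b, E c, E d] q = 0"
    using parallel_phi E_smooth unfolding parallel_def by auto
  moreover have "vf_apply A (E a) (on_fields \<phi> [E b, E c, E d]) q = vf_apply A (E a) (\<lambda>q. phi0 b c d) q"
  proof (rule vf_apply_cong[OF V q, symmetric])
    fix r assume "r \<in> V"
    then show "phi0 b c d = on_fields \<phi> [E b, E c, E d] r"
      by (simp add: on_fields_def phi_frame)
  qed simp
  ultimately have "\<phi> q [D (E a) (E b) q, E c q, E d q] + \<phi> q [E b q, D (E a) (E c) q, E d q]
     + \<phi> q [E b q, E c q, D (E a) (E d) q] = 0"
    by (simp add: cov_deriv_def on_fields_def vf_apply_const[OF V] numeral_3_eq_3)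
  then show ?thesis
    unfolding D_frame[OF q] by (simp add: linear_sum[OF lin(1)] linear_scale[OF lin(1)] linear_sum[OF lin(2)]
      linear_scale[OF lin(2)] linear_sum[OF lin(3)] linear_scale[OF lin(3)] phi_frame[OF q] sum.distrib)
qed

lemma T_skew: "T b a c q = - T a b c q" "T a c b q = - T a b c q"
  unfolding T_def by (rule smooth_form3_skew[OF tau_form UNIV_I])+

lemma vsm_bracket:
  assumes "smooth_vf A X" "smooth_vf A Y"
  shows "vsm_on A V (lie_bracket A X Y)"
proof (rule vsm_on_cong[OF V])
  have "sm_on A V (\<lambda>q. e s q [D X Y q] + - 1 * e s q [D Y X q] + - 1 * \<tau> q [X q, Y q, E s q])" for s
    by (intro sm_add sm_mult sm_const V sm_coef D_smooth sm_tau assms E_smooth)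
  then show "vsm_on A V (\<lambda>q. SUM s. (e s q [D X Y q] + - 1 * e s q [D Y X q] + - 1 * \<tau> q [X q, Y q, E s q]) *\<^sub>R E s q)"
    by (intro vsm_sum vsm_scaleR V E_vsm)
qed (simp add: bracket_frame assms)

end

context g2_setup
begin

lemma smooth_bracket:
  assumes "smooth_vf A X" "smooth_vf A Y"
  shows "smooth_vf A (lie_bracket A X Y)"
  unfolding smooth_vf_iff
proof (rule vsm_on_local)
  fix p :: 'm
  obtain V e E where f: "p \<in> V" "is_frame V e E" by (rule frame_exists)
  interpret g2_local_frame A D \<phi> g vol \<tau> V e E by unfold_locales (rule f)
  show "\<exists>W. open W \<and> p \<in> W \<and> vsm_on A W (lie_bracket A X Y)"
    using V f(1) vsm_bracket[OF assms] by blast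
qed

end

section \<open>Brackets and curvature in the frame\<close>

context g2_local_frame
begin

definition C where "C a b s q = \<Gamma> a b s q - \<Gamma> b a s q - T a b s q"

lemma sm_C: "sm_on A V (C a b s)"
proof -
  have "sm_on A V (\<lambda>q. \<Gamma> a b s q + - 1 * \<Gamma> b a s q + - 1 * T a b s q)"
    by (intro sm_add sm_mult sm_const V sm_\<Gamma> sm_T)
  then show ?thesis by (simp add: C_def[abs_def])
qed

lemma bracket_E: "q \<in> V \<Longrightarrow> lie_bracket A (E a) (E b) q = (SUM s. C a b s q *\<^sub>R E s q)"
  by (simp add: bracket_frame E_smooth C_def \<Gamma>_def T_def)

lemma commutator:
  assumes "sm_on A V f" "q \<in> V"
  shows "vf_apply A (E a) (vf_apply A (E b) f) q - vf_apply A (E b) (vf_apply A (E a) f) q =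
    (SUM s. C a b s q * vf_apply A (E s) f q)"
  using vf_apply_lie_bracket[OF V assms(1) E_vsm E_vsm assms(2), of a b]
    vf_apply_linear_field[where E = E and v = "\<lambda>s. C a b s q" and I = UNIV and X = "lie_bracket A (E a) (E b)",
      OF V assms bracket_E[OF assms(2)]]
  by simp

text \<open>The coordinate functions of a chart containing \<open>V\<close>, used as test functions,
  recover the chart components of the vector with coefficients \<open>v\<close>.\<close>

lemma independent:
  assumes q: "q \<in> V" and v: "\<And>f. sm_on A V f \<Longrightarrow> (SUM s. v s * vf_apply A (E s) f q) = 0"
  shows "v s = 0"
proof -
  obtain c where c: "c \<in> A" "V \<subseteq> fst c" using frame unfolding is_frame_def by blast
  have qc: "q \<in> fst c" using c q by auto
  note lin = to_chart_linear[OF c(1) qc]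
  have "to_chart A c q (SUM s. v s *\<^sub>R E s q) $ i = 0" for i
    using v[OF sm_on_subset[OF coordinate_sm[OF c(1), of i] c(2)]]
    by (simp add: vf_apply_coordinate[OF c(1) qc] linear_sum[OF lin] linear_scale[OF lin])
  then have "to_chart A c q (SUM s. v s *\<^sub>R E s q) = 0" by (simp add: vec_eq_iff)
  then have "(SUM s. v s *\<^sub>R E s q) = 0"
    using from_to_chart[OF c(1) qc] linear_0[OF from_chart_linear[OF c(1) qc]] by metis
  then show "v s = 0" using e_sum[OF q, of s v] linear_0[OF e_linear[OF q], of s] by simp
qed

lemma curvature_E:
  assumes q: "q \<in> V"
  shows "curvature A g D (E a) (E b) (E i) (E j) q =
    vf_apply A (E a) (\<Gamma> b i j) q - vf_apply A (E b) (\<Gamma> a i j) q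
     + (SUM s. \<Gamma> b i s q * \<Gamma> a s j q - \<Gamma> a i s q * \<Gamma> b s j q - C a b s q * \<Gamma> s i j q)"
proof -
  note lin = e_linear[OF q]
  have DD: "e j q [D (E a) (D (E b) (E i)) q] = vf_apply A (E a) (\<Gamma> b i j) q + (SUM s. \<Gamma> b i s q * \<Gamma> a s j q)" for a b
  proof -
    have "D (E a) (D (E b) (E i)) q =
        (SUM s. vf_apply A (E a) (\<Gamma> b i s) q *\<^sub>R E s q + \<Gamma> b i s q *\<^sub>R D (E a) (E s) q)"
      by (rule D_expand2[OF V q sm_\<Gamma> E_smooth D_smooth[OF E_smooth E_smooth] D_frame E_smooth])
    then show ?thesis
      by (simp add: sum.distrib linear_add[OF lin] e_sum[OF q] linear_sum[OF lin] linear_scale[OF lin] \<Gamma>_def)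
        (simp add: linear_sum[OF lin] linear_scale[OF lin] dual[OF q] mult.commute[of _ "kdelta _ _"] sum_kdelta)
  qed
  have "D (lie_bracket A (E a) (E b)) (E i) q = (SUM s. C a b s q *\<^sub>R D (E s) (E i) q)"
    by (rule D_expand1[OF V q sm_C E_smooth smooth_bracket[OF E_smooth E_smooth] bracket_E E_smooth])
  then have "e j q [D (lie_bracket A (E a) (E b)) (E i) q] = (SUM s. C a b s q * \<Gamma> s i j q)"
    by (simp add: linear_sum[OF lin] linear_scale[OF lin] \<Gamma>_def)
  then show ?thesis
    by (simp add: curvature_def g_E[OF q] linear_diff[OF lin] DD sum_subtractf)
qed

lemma instanton_E:
  assumes q: "q \<in> V"
  shows "(SUM a b. phi0 a b k * curvature A g D (E a) (E b) (E i) (E j) q) = 0"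
proof -
  have "\<forall>p\<in>V. \<forall>a b. g p [E a p, E b p] = (if a = b then 1 else 0)"
    by (simp add: g_E dual) (simp add: kdelta_def)
  then have "\<forall>p\<in>V. \<forall>i j k. (SUM a b. curvature A g D (E a) (E b) (E i) (E j) p * \<phi> p [E a p, E b p, E k p]) = 0"
    using inst V E_smooth unfolding g2_instanton_def by blast
  then show ?thesis using q by (simp add: phi_frame mult.commute)
qed

end

section \<open>The Hodge dual of the three-form\<close>

text \<open>Reindexing the sum over permutations by composition with the transposition of
  \<open>i\<close> and \<open>j\<close> exchanges the two arguments and reverses every sign.\<close>

lemma wedge1_swap:
  assumes "length vs = length \<alpha>s" "i < length \<alpha>s" "j < length \<alpha>s"
    and "i \<noteq> j" and ws: "ws = vs[i := vs ! j, j := vs ! i]"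
  shows "wedge1 \<alpha>s p ws = - wedge1 \<alpha>s p vs"
proof -
  let ?n = "length \<alpha>s" and ?t = "Transposition.transpose i j"
  have t: "?t permutes {..<?n}" using assms by (intro permutes_swap_id) auto
  have nth: "ws ! k = vs ! (?t k)" if "k < ?n" for k
    using that assms by (auto simp: Transposition.transpose_def nth_list_update)
  have "wedge1 \<alpha>s p vs = (\<Sum>\<pi> | \<pi> permutes {..<?n}.
     of_int (sign (?t \<circ> \<pi>)) * (\<Prod>m<?n. (\<alpha>s ! m) p [vs ! (?t \<circ> \<pi>) m]))"
    unfolding wedge1_def by (rule setum_permutations_compose_left[OF t])
  also have "\<dots> = (\<Sum>\<pi> | \<pi> permutes {..<?n}. - (of_int (sign \<pi>) * (\<Prod>m<?n. (\<alpha>s ! m) p [ws ! \<pi> m])))"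
  proof (rule sum.cong[OF refl])
    fix \<pi> assume "\<pi> \<in> {\<pi>. \<pi> permutes {..<?n}}"
    then have \<pi>: "\<pi> permutes {..<?n}" by simp
    have "sign (?t \<circ> \<pi>) = - sign \<pi>"
      using assms(4) permutation_permutes[of \<pi>] \<pi>
      by (subst sign_compose) (auto simp: permutation_swap_id sign_swap_id intro: permutes_imp_permutation)
    moreover have "(\<Prod>m<?n. (\<alpha>s ! m) p [vs ! (?t \<circ> \<pi>) m]) = (\<Prod>m<?n. (\<alpha>s ! m) p [ws ! \<pi> m])"
      using permutes_in_image[OF \<pi>] by (intro prod.cong refl) (auto simp: nth)
    ultimately show "of_int (sign (?t \<circ> \<pi>)) * (\<Prod>m<?n. (\<alpha>s ! m) p [vs ! (?t \<circ> \<pi>) m]) =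
      - (of_int (sign \<pi>) * (\<Prod>m<?n. (\<alpha>s ! m) p [ws ! \<pi> m]))" by simp
  qed
  finally show ?thesis by (simp add: wedge1_def sum_negf)
qed

lemma wedge1_linear:
  assumes "length vs = length \<alpha>s" "k < length \<alpha>s" and lin: "\<And>m. m < length \<alpha>s \<Longrightarrow> linear (\<lambda>v. (\<alpha>s ! m) p [v])"
  shows "linear (\<lambda>v. wedge1 \<alpha>s p (vs[k := v]))"
  unfolding wedge1_def
proof (rule linear_compose_sum, intro ballI)
  let ?n = "length \<alpha>s"
  fix \<pi> assume "\<pi> \<in> {\<pi>. \<pi> permutes {..<?n}}"
  then have \<pi>: "\<pi> permutes {..<?n}" by simp
  \<comment> \<open>The one factor of the product that receives the slot \<open>k\<close>; the
    remaining factors are constant in \<open>v\<close>.\<close>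
  define m0 where "m0 = inv \<pi> k"
  have m0: "m0 < ?n" "\<pi> m0 = k"
    using \<pi> assms(2) permutes_in_image[OF permutes_inv[OF \<pi>], of k] permutes_inverses(1)[OF \<pi>]
    by (auto simp: m0_def)
  have "(\<Prod>m<?n. (\<alpha>s ! m) p [vs[k := v] ! \<pi> m]) =
      (\<alpha>s ! m0) p [v] * (\<Prod>m\<in>{..<?n} - {m0}. (\<alpha>s ! m) p [vs ! \<pi> m])" for v
  proof -
    have "(\<Prod>m<?n. (\<alpha>s ! m) p [vs[k := v] ! \<pi> m]) =
      (\<alpha>s ! m0) p [vs[k := v] ! \<pi> m0] * (\<Prod>m\<in>{..<?n} - {m0}. (\<alpha>s ! m) p [vs[k := v] ! \<pi> m])"
      by (rule prod.remove) (use m0 in auto)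
    moreover have "(\<Prod>m\<in>{..<?n} - {m0}. (\<alpha>s ! m) p [vs[k := v] ! \<pi> m]) =
      (\<Prod>m\<in>{..<?n} - {m0}. (\<alpha>s ! m) p [vs ! \<pi> m])"
    proof (intro prod.cong refl)
      fix m assume "m \<in> {..<?n} - {m0}"
      then have "\<pi> m \<noteq> k" using m0(2) permutes_inj[OF \<pi>] by (auto dest: injD)
      then show "(\<alpha>s ! m) p [vs[k := v] ! \<pi> m] = (\<alpha>s ! m) p [vs ! \<pi> m]" by simp
    qed
    ultimately show ?thesis using m0 assms by simp
  qed
  then show "linear (\<lambda>v. of_int (sign \<pi>) * (\<Prod>m<?n. (\<alpha>s ! m) p [vs[k := v] ! \<pi> m]))"
    using lin[OF m0(1)] by (simp add: linear_iff algebra_simps)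
qed

lemma wedge1_dual:
  assumes "distinct xs" "\<And>i j. e i p [E j] = kdelta i j"
  shows "wedge1 (map e xs) p (map E xs) = 1"
proof -
  let ?n = "length xs"
  have z: "(\<Prod>m<?n. kdelta (xs ! m) (xs ! \<pi> m)) = 0" if perm: "\<pi> permutes {..<?n}" and ne: "\<pi> \<noteq> id" for \<pi>
  proof -
    obtain m where m: "\<pi> m \<noteq> m" using ne by (auto simp: fun_eq_iff)
    then have "m < ?n" using permutes_not_in[OF perm] by fastforce
    moreover from this have "\<pi> m < ?n" using permutes_in_image[OF perm, of m] by simp
    ultimately show ?thesis using m assms(1) by (intro prod_zero bexI[of _ m]) (auto simp: kdelta_def nth_eq_iff_index_eq)
  qed
  have "wedge1 (map e xs) p (map E xs) =
     (\<Sum>\<pi> | \<pi> permutes {..<?n}. of_int (sign \<pi>) * (\<Prod>m<?n. kdelta (xs ! m) (xs ! \<pi> m)))"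
    unfolding wedge1_def length_map
  proof (intro sum.cong arg_cong2[where f = "(*)"] prod.cong refl)
    fix \<pi> m assume "\<pi> \<in> {\<pi>. \<pi> permutes {..<?n}}" "m \<in> {..<?n}"
    then have "m < ?n" "\<pi> m < ?n" using permutes_in_image[of \<pi> "{..<?n}" m] by auto
    then show "(map e xs ! m) p [map E xs ! \<pi> m] = kdelta (xs ! m) (xs ! \<pi> m)"
      by (simp add: assms(2))
  qed
  also have "\<dots> = (\<Sum>\<pi>\<in>{id}. of_int (sign \<pi>) * (\<Prod>m<?n. kdelta (xs ! m) (xs ! \<pi> m)))"
    by (rule sum.mono_neutral_right) (use z in \<open>auto simp: permutes_id finite_permutations\<close>)
  finally show ?thesis by (simp add: sign_id kdelta_def)
qed

text \<open>An explicit ranking of the frame indices, in which 7 comes last although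
  \<open>7 = 0\<close> in the index type. It guards the sorting rules below, so that rewriting
  exchanges neighbours only towards ascending order and stops.\<close>

definition rk :: "7 \<Rightarrow> nat" where
  "rk i = (if i = 1 then 1 else if i = 2 then 2 else if i = 3 then 3 else if i = 4 then 4
     else if i = 5 then 5 else if i = 6 then 6 else 7)"

lemma rk_simps: "rk 1 = 1" "rk 2 = 2" "rk 3 = 3" "rk 4 = 4" "rk 5 = 5" "rk 6 = 6" "rk 7 = 7"
  by (simp_all add: rk_def)

text \<open>The Levi-Civita symbol is the standard volume form on standard basis vectors; taking it over a
  one-point base makes the facts on \<open>wedge1\<close> applicable.\<close>

definition eps :: "7 list \<Rightarrow> real" where
  "eps xs = wedge1 (map (\<lambda>i (p::unit) vs. hd vs $ i) [1, 2, 3, 4, 5, 6, 7]) () (map (\<lambda>a. axis a (1::real)) xs)"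

lemma eps_id: "eps [1, 2, 3, 4, 5, 6, 7] = 1"
  unfolding eps_def
  by (rule wedge1_dual[where e = "\<lambda>i (p::unit) vs. hd vs $ i" and E = "\<lambda>a. axis a (1::real)"])
    (auto simp: kdelta_def axis_def)

lemma eps_swap:
  assumes "length xs = 7" "i < 7" "j < 7" "i \<noteq> j" "js = xs[i := xs ! j, j := xs ! i]"
  shows "eps js = - eps xs"
  unfolding eps_def
  by (rule wedge1_swap[where i = i and j = j]) (use assms in \<open>auto simp: map_update nth_map\<close>)

lemma eps_skew:
  "eps [b, a, c, d, e, f, g] = - eps [a, b, c, d, e, f, g]"
  "eps [a, c, b, d, e, f, g] = - eps [a, b, c, d, e, f, g]"
  "eps [a, b, d, c, e, f, g] = - eps [a, b, c, d, e, f, g]"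
  "eps [a, b, c, e, d, f, g] = - eps [a, b, c, d, e, f, g]"
  "eps [a, b, c, d, f, e, g] = - eps [a, b, c, d, e, f, g]"
  "eps [a, b, c, d, e, g, f] = - eps [a, b, c, d, e, f, g]"
proof -
  note * = eps_swap[where xs = "[a, b, c, d, e, f, g]"]
  show "eps [b, a, c, d, e, f, g] = - eps [a, b, c, d, e, f, g]" by (rule *[where i = 0 and j = 1]) simp_all
  show "eps [a, c, b, d, e, f, g] = - eps [a, b, c, d, e, f, g]"
    by (rule *[where i = 1 and j = 2]) (simp_all add: numeral_eq_Suc)
  show "eps [a, b, d, c, e, f, g] = - eps [a, b, c, d, e, f, g]"
    by (rule *[where i = 2 and j = 3]) (simp_all add: numeral_eq_Suc)
  show "eps [a, b, c, e, d, f, g] = - eps [a, b, c, d, e, f, g]"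
    by (rule *[where i = 3 and j = 4]) (simp_all add: numeral_eq_Suc)
  show "eps [a, b, c, d, f, e, g] = - eps [a, b, c, d, e, f, g]"
    by (rule *[where i = 4 and j = 5]) (simp_all add: numeral_eq_Suc)
  show "eps [a, b, c, d, e, g, f] = - eps [a, b, c, d, e, f, g]"
    by (rule *[where i = 5 and j = 6]) (simp_all add: numeral_eq_Suc)
qed

lemma eps_sort:
  "rk b < rk a \<Longrightarrow> eps [a, b, c, d, e, f, g] = - eps [b, a, c, d, e, f, g]"
  "rk c < rk b \<Longrightarrow> eps [a, b, c, d, e, f, g] = - eps [a, c, b, d, e, f, g]"
  "rk d < rk c \<Longrightarrow> eps [a, b, c, d, e, f, g] = - eps [a, b, d, c, e, f, g]"
  "rk e < rk d \<Longrightarrow> eps [a, b, c, d, e, f, g] = - eps [a, b, c, e, d, f, g]"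
  "rk f < rk e \<Longrightarrow> eps [a, b, c, d, e, f, g] = - eps [a, b, c, d, f, e, g]"
  "rk g < rk f \<Longrightarrow> eps [a, b, c, d, e, f, g] = - eps [a, b, c, d, e, g, f]"
  by (rule eps_skew)+

lemma eps_zero:
  "eps [a, a, c, d, e, f, g] = 0" "eps [a, b, b, d, e, f, g] = 0" "eps [a, b, c, c, e, f, g] = 0"
  "eps [a, b, c, d, d, f, g] = 0" "eps [a, b, c, d, e, e, g] = 0" "eps [a, b, c, d, e, f, f] = 0"
  using eps_skew(1)[of a a c d e f g] eps_skew(2)[of a b b d e f g] eps_skew(3)[of a b c c e f g]
    eps_skew(4)[of a b c d d f g] eps_skew(5)[of a b c d e e g] eps_skew(6)[of a b c d e f f]
  by simp_all

text \<open>The components of \<open>*\<phi>\<close> in an adapted frame, with \<open>6 = 3!\<close>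
  from the Hodge star. The summation over \<open>k\<close> is outermost so that
  \<open>phi0_sum_first_simps\<close> applies to the inner double sum. The nonzero components turn
  out to sit at the complements of the seven lines.\<close>

definition psi0 :: "7 \<Rightarrow> 7 \<Rightarrow> 7 \<Rightarrow> 7 \<Rightarrow> real" where
  "psi0 a b c d = (SUM k i j. phi0 i j k * eps [i, j, k, a, b, c, d]) / 6"

lemma psi0_skew:
  "psi0 b a c d = - psi0 a b c d" "psi0 a c b d = - psi0 a b c d" "psi0 a b d c = - psi0 a b c d"
  unfolding psi0_def by (simp_all only: eps_skew(4)[of _ _ _ b a c d] eps_skew(5)[of _ _ _ a c b d]
      eps_skew(6)[of _ _ _ a b d c] mult_minus_right sum_negf minus_divide_left)

lemma psi0_zero: "psi0 a a c d = 0" "psi0 a b b d = 0" "psi0 a b c c = 0"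
  using psi0_skew(1)[of a a c d] psi0_skew(2)[of a b b d] psi0_skew(3)[of a b c c] by simp_all

lemma psi0_sort:
  "rk b < rk a \<Longrightarrow> psi0 a b c d = - psi0 b a c d"
  "rk c < rk b \<Longrightarrow> psi0 a b c d = - psi0 a c b d"
  "rk d < rk c \<Longrightarrow> psi0 a b c d = - psi0 a b d c"
  by (rule psi0_skew)+

lemma psi0_lines:
  "psi0 a b c d = eps [1, 2, 7, a, b, c, d] + eps [1, 3, 5, a, b, c, d] - eps [1, 4, 6, a, b, c, d]
     - eps [2, 3, 6, a, b, c, d] - eps [2, 4, 5, a, b, c, d] + eps [3, 4, 7, a, b, c, d]
     + eps [5, 6, 7, a, b, c, d]"
  unfolding psi0_def sum_7[of "\<lambda>k. SUM i j. phi0 i j k * eps [i, j, k, a, b, c, d]"]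
    phi0_sum_first_simps by (simp add: eps_sort(1,2) rk_simps)

lemma psi0_table:
  "psi0 1 2 3 4 = 1" "psi0 1 2 3 5 = 0" "psi0 1 2 3 6 = 0" "psi0 1 2 3 7 = 0"
  "psi0 1 2 4 5 = 0" "psi0 1 2 4 6 = 0" "psi0 1 2 4 7 = 0" "psi0 1 2 5 6 = 1"
  "psi0 1 2 5 7 = 0" "psi0 1 2 6 7 = 0" "psi0 1 3 4 5 = 0" "psi0 1 3 4 6 = 0"
  "psi0 1 3 4 7 = 0" "psi0 1 3 5 6 = 0" "psi0 1 3 5 7 = 0" "psi0 1 3 6 7 = 1"
  "psi0 1 4 5 6 = 0" "psi0 1 4 5 7 = 1" "psi0 1 4 6 7 = 0" "psi0 1 5 6 7 = 0"
  "psi0 2 3 4 5 = 0" "psi0 2 3 4 6 = 0" "psi0 2 3 4 7 = 0" "psi0 2 3 5 6 = 0"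
  "psi0 2 3 5 7 = 1" "psi0 2 3 6 7 = 0" "psi0 2 4 5 6 = 0" "psi0 2 4 5 7 = 0"
  "psi0 2 4 6 7 = -1" "psi0 2 5 6 7 = 0" "psi0 3 4 5 6 = 1" "psi0 3 4 5 7 = 0"
  "psi0 3 4 6 7 = 0" "psi0 3 5 6 7 = 0" "psi0 4 5 6 7 = 0"
  by (simp_all add: psi0_lines eps_sort eps_zero eps_id rk_simps)

section \<open>The Hodge star in an adapted frame\<close>

lemma sum_lists3:
  fixes f :: "'i::finite list \<Rightarrow> real"
  shows "(\<Sum>xs | length xs = 3. f xs) = (SUM i j k. f [i, j, k])"
proof -
  have "(SUM i j k. f [i, j, k]) = (\<Sum>(i, j, k)\<in>UNIV. f [i, j, k])"
    by (simp add: sum.cartesian_product case_prod_beta UNIV_Times_UNIV[symmetric] del: UNIV_Times_UNIV)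
  also have "\<dots> = (\<Sum>xs | length xs = 3. f xs)"
    by (rule sum.reindex_bij_witness[of _ "\<lambda>xs. (xs ! 0, xs ! 1, xs ! 2)" "\<lambda>(i, j, k). [i, j, k]"])
      (auto simp: numeral_3_eq_3 length_Suc_conv numeral_2_eq_2)
  finally show ?thesis ..
qed

text \<open>If the inverse metric is the frame matrix \<open>N\<close> times its transpose,
  contracting a pair of coordinate indices with it amounts to evaluating both factors on the frame
  and summing once.\<close>

lemma sum_raise_indices:
  fixes N :: "'a::finite \<Rightarrow> 'i::finite \<Rightarrow> real"
  shows "(SUM a b. (SUM i. N a i * N b i) * (F a * H b)) = (SUM i. (SUM a. N a i * F a) * (SUM b. N b i * H b))"
proof -
  have "(SUM a b. (SUM i. N a i * N b i) * (F a * H b)) = (SUM a b i. (N a i * F a) * (N b i * H b))"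
    by (simp add: sum_distrib_left sum_distrib_right mult_ac)
  also have "\<dots> = (SUM a i b. (N a i * F a) * (N b i * H b))"
    by (rule sum.cong[OF refl], rule sum.swap)
  also have "\<dots> = (SUM i a b. (N a i * F a) * (N b i * H b))" by (rule sum.swap)
  finally show ?thesis by (simp add: sum_product)
qed

context g2_local_frame
begin

abbreviation "coframe_list \<equiv> [e 1, e 2, e 3, e 4, e 5, e 6, e 7]"

definition H where "H = hodge g vol 3 \<phi>"

context
  fixes q assumes q: "q \<in> V"
begin

lemma vol_eq: "length vs = 7 \<Longrightarrow> vol q vs = wedge1 coframe_list q vs"
  using volume coframe q unfolding induced_volume_def by blast

lemma vol_linear: "length vs = 7 \<Longrightarrow> k < 7 \<Longrightarrow> linear (\<lambda>v. vol q (vs[k := v]))"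
proof -
  assume vs: "length vs = 7" "k < 7"
  have "linear (\<lambda>v. wedge1 coframe_list q (vs[k := v]))"
  proof (rule wedge1_linear)
    fix m assume "m < length coframe_list"
    then have "coframe_list ! m \<in> set coframe_list" by (rule nth_mem)
    then show "linear (\<lambda>v. (coframe_list ! m) q [v])" using e_linear[OF q] by auto
  qed (use vs in auto)
  then show ?thesis using vs by (simp add: vol_eq)
qed

lemma vol_E: "length xs = 7 \<Longrightarrow> vol q (map (\<lambda>a. E a q) xs) = eps xs"
proof -
  assume xs: "length xs = 7"
  have len: "length coframe_list = 7"
    and len2: "length (map (\<lambda>i (p::unit) vs. hd vs $ i) [1, 2, 3, 4, 5, 6, 7 :: 7]) = 7" by simp_all
  have "wedge1 coframe_list q (map (\<lambda>a. E a q) xs) = eps xs"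
    unfolding eps_def wedge1_def len len2
  proof (intro sum.cong arg_cong2[where f = "(*)"] refl)
    fix \<pi> assume "\<pi> \<in> {\<pi>. \<pi> permutes {..<7::nat}}"
    then have \<pi>: "\<pi> permutes {..<7}" by simp
    have "(\<Prod>j<7. (map e [1, 2, 3, 4, 5, 6, 7] ! j) q [map (\<lambda>a. E a q) xs ! \<pi> j]) =
      (\<Prod>j<7. (map (\<lambda>i (p::unit) vs. hd vs $ i) [1, 2, 3, 4, 5, 6, 7] ! j) () [map (\<lambda>a. axis a (1::real)) xs ! \<pi> j])"
    proof (intro prod.cong refl)
      fix j :: nat assume "j \<in> {..<7}"
      then have "j < length [1, 2, 3, 4, 5, 6, 7 :: 7]" "\<pi> j < length xs"
        using permutes_in_image[OF \<pi>, of j] xs by auto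
      then show "(map e [1, 2, 3, 4, 5, 6, 7] ! j) q [map (\<lambda>a. E a q) xs ! \<pi> j] =
        (map (\<lambda>i (p::unit) vs. hd vs $ i) [1, 2, 3, 4, 5, 6, 7] ! j) () [map (\<lambda>a. axis a (1::real)) xs ! \<pi> j]"
        by (simp only: nth_map dual[OF q] list.sel) (simp add: kdelta_def axis_def)
    qed
    then show "(\<Prod>j<7. (coframe_list ! j) q [map (\<lambda>a. E a q) xs ! \<pi> j]) =
      (\<Prod>j<7. (map (\<lambda>i (p::unit) vs. hd vs $ i) [1, 2, 3, 4, 5, 6, 7] ! j) () [map (\<lambda>a. axis a (1::real)) xs ! \<pi> j])"
      by (simp only: list.map)
  qed
  then show ?thesis using xs by (simp add: vol_eq)
qed

text \<open>The Gram matrix is the transposed coframe matrix times the coframe matrix, so its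
  inverse is the frame matrix times its transpose.\<close>

lemma inv_metric_eq: "inv_metric g q $ a $ b = (SUM i. E i q $ a * E i q $ b)"
proof -
  define M :: "real^7^7" where "M = (\<chi> i b. e i q [axis b 1])"
  define N :: "real^7^7" where "N = (\<chi> b i. E i q $ b)"
  have "e i q [w] = (SUM b. M $ i $ b * w $ b)" for w i
  proof -
    have "e i q [w] = e i q [(SUM b. w $ b *\<^sub>R axis b 1)]" unfolding vec_axis_sum ..
    then show ?thesis
      by (simp add: M_def linear_sum[OF e_linear[OF q]] linear_scale[OF e_linear[OF q]] mult.commute)
  qed
  then have "M ** N = mat 1"
    using dual[OF q] by (simp add: vec_eq_iff matrix_matrix_mult_def N_def mat_def kdelta_def)
  then have NM: "N ** M = mat 1" and MN: "M ** N = mat 1" using matrix_left_right_inverse by blast+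
  have G: "(\<chi> i j. g q [axis i 1, axis j 1]) = Finite_Cartesian_Product.transpose M ** M"
    by (simp add: vec_eq_iff g_frame[OF q] matrix_matrix_mult_def Finite_Cartesian_Product.transpose_def M_def)
  let ?G = "Finite_Cartesian_Product.transpose M ** M" and ?I = "N ** Finite_Cartesian_Product.transpose N"
  have tr: "Finite_Cartesian_Product.transpose N ** Finite_Cartesian_Product.transpose M = mat 1"
    using MN by (metis matrix_transpose_mul transpose_mat)
  have "?I ** ?G = N ** ((Finite_Cartesian_Product.transpose N ** Finite_Cartesian_Product.transpose M) ** M)"
    by (simp add: matrix_mul_assoc)
  then have IG: "?I ** ?G = mat 1" by (simp add: tr NM)
  then have GI: "?G ** ?I = mat 1" using matrix_left_right_inverse by blast
  have "\<exists>B. ?G ** B = mat 1 \<and> B ** ?G = mat 1" using IG GI by blast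
  then have "?G ** matrix_inv ?G = mat 1" unfolding matrix_inv_def by (rule someI2_ex) blast
  then have "?I = ?I ** (?G ** matrix_inv ?G)" by simp
  also have "\<dots> = (?I ** ?G) ** matrix_inv ?G" by (rule matrix_mul_assoc)
  also have "\<dots> = matrix_inv ?G" unfolding IG by simp
  finally have "inv_metric g q = ?I" by (simp add: inv_metric_def G)
  then show ?thesis
    by (simp add: matrix_matrix_mult_def Finite_Cartesian_Product.transpose_def N_def)
qed

text \<open>\<open>slot\<close> turns one contracted pair of coordinate indices into one frame
  index. It is applied three times, starting with the innermost pair, and each time the new sum is
  moved outside before the next pair is treated.\<close>

lemma hodge_frame:
  assumes vs: "length vs = 4"
  shows "H q vs = (SUM i j k. phi0 i j k * vol q ([E i q, E j q, E k q] @ vs)) / 6"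
proof -
  note pl = smooth_form3_linear[OF phi_form UNIV_I, of q]
  have vl: "linear (\<lambda>v. vol q (v # y # z # vs))" "linear (\<lambda>v. vol q (x # v # z # vs))"
    "linear (\<lambda>v. vol q (x # y # v # vs))" for x y z
    using vol_linear[of "x # y # z # vs" 0] vol_linear[of "x # y # z # vs" 1] vol_linear[of "x # y # z # vs" 2] vs
    by (simp_all add: numeral_2_eq_2)
  define n where "n a i = E i q $ a" for a i
  have E: "E i q = (SUM a. n a i *\<^sub>R axis a 1)" for i unfolding n_def vec_axis_sum ..
  have con: "(SUM a. n a i * L (axis a 1)) = L (E i q)" if "linear L" for L :: "real^7 \<Rightarrow> real" and i
    unfolding E by (simp add: linear_sum[OF that] linear_scale[OF that])
  let ?g = "\<lambda>a b. SUM i. n a i * n b i"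
  have slot: "(SUM a b. ?g a b * (L (axis a 1) * L' (axis b 1))) = (SUM i. L (E i q) * L' (E i q))"
    if "linear L" "linear L'" for L L' :: "real^7 \<Rightarrow> real"
    unfolding sum_raise_indices con[OF that(1)] con[OF that(2)] ..
  let ?A = "\<lambda>a. axis a (1::real) :: real^7"
  have "H q vs = (SUM a b c a' b' c'.
      ?g a a' * (?g b b' * (?g c c' * (\<phi> q [?A a, ?A b, ?A c] * vol q (?A a' # ?A b' # ?A c' # vs))))) / 6"
    unfolding H_def hodge_def sum_lists3
    by (simp add: inv_metric_eq n_def fact_numeral numeral_3_eq_3 lessThan_Suc mult_ac)
  also have "(SUM a b c a' b' c'.
      ?g a a' * (?g b b' * (?g c c' * (\<phi> q [?A a, ?A b, ?A c] * vol q (?A a' # ?A b' # ?A c' # vs))))) =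
    (SUM a a'. ?g a a' * (SUM b b'. ?g b b' * (SUM c c'. ?g c c' *
      (\<phi> q [?A a, ?A b, ?A c] * vol q (?A a' # ?A b' # ?A c' # vs)))))"
  proof -
    have reorder: "(SUM b c a' b' c'. f b c a' b' c') = (SUM a' b b' c c'. f b c a' b' c')"
      for f :: "7 \<Rightarrow> 7 \<Rightarrow> 7 \<Rightarrow> 7 \<Rightarrow> 7 \<Rightarrow> real"
    proof -
      have "(SUM b c a' b' c'. f b c a' b' c') = (SUM b a' c b' c'. f b c a' b' c')"
        by (rule sum.cong[OF refl], rule sum.swap)
      also have "\<dots> = (SUM a' b c b' c'. f b c a' b' c')" by (rule sum.swap)
      also have "\<dots> = (SUM a' b b' c c'. f b c a' b' c')"
        by (rule sum.cong[OF refl], rule sum.cong[OF refl], rule sum.swap)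
      finally show ?thesis .
    qed
    show ?thesis unfolding sum_distrib_left by (rule sum.cong[OF refl], rule reorder)
  qed
  also have "\<dots> = (SUM a a'. ?g a a' * (SUM b b'. ?g b b' * (SUM k.
      \<phi> q [?A a, ?A b, E k q] * vol q (?A a' # ?A b' # E k q # vs))))"
    by (simp only: slot[OF pl(3) vl(3)])
  also have "\<dots> = (SUM a a'. ?g a a' * (SUM k b b'. ?g b b' *
      (\<phi> q [?A a, ?A b, E k q] * vol q (?A a' # ?A b' # E k q # vs))))"
  proof -
    have "(SUM b b'. ?g b b' * (SUM k. f b b' k)) = (SUM k b b'. ?g b b' * f b b' k)" for f :: "7 \<Rightarrow> 7 \<Rightarrow> 7 \<Rightarrow> real"
    proof -
      have "(SUM b b'. ?g b b' * (SUM k. f b b' k)) = (SUM b b' k. ?g b b' * f b b' k)"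
        by (simp only: sum_distrib_left)
      also have "\<dots> = (SUM b k b'. ?g b b' * f b b' k)" by (rule sum.cong[OF refl], rule sum.swap)
      also have "\<dots> = (SUM k b b'. ?g b b' * f b b' k)" by (rule sum.swap)
      finally show ?thesis .
    qed
    then show ?thesis by (simp only:)
  qed
  also have "\<dots> = (SUM a a'. ?g a a' * (SUM k j.
      \<phi> q [?A a, E j q, E k q] * vol q (?A a' # E j q # E k q # vs)))"
    by (simp only: slot[OF pl(2) vl(2)])
  also have "\<dots> = (SUM k j a a'. ?g a a' *
      (\<phi> q [?A a, E j q, E k q] * vol q (?A a' # E j q # E k q # vs)))"
  proof -
    have "(SUM b b'. ?g b b' * (SUM k j. f b b' k j)) = (SUM k j b b'. ?g b b' * f b b' k j)"
      for f :: "7 \<Rightarrow> 7 \<Rightarrow> 7 \<Rightarrow> 7 \<Rightarrow> real"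
    proof -
      have "(SUM b b'. ?g b b' * (SUM k j. f b b' k j)) = (SUM b b' k j. ?g b b' * f b b' k j)"
        by (simp only: sum_distrib_left)
      also have "\<dots> = (SUM b k b' j. ?g b b' * f b b' k j)" by (rule sum.cong[OF refl], rule sum.swap)
      also have "\<dots> = (SUM k b b' j. ?g b b' * f b b' k j)" by (rule sum.swap)
      also have "\<dots> = (SUM k b j b'. ?g b b' * f b b' k j)"
        by (rule sum.cong[OF refl], rule sum.cong[OF refl], rule sum.swap)
      also have "\<dots> = (SUM k j b b'. ?g b b' * f b b' k j)" by (rule sum.cong[OF refl], rule sum.swap)
      finally show ?thesis .
    qed
    then show ?thesis by (simp only:)
  qed
  also have "\<dots> = (SUM k j i. \<phi> q [E i q, E j q, E k q] * vol q (E i q # E j q # E k q # vs))"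
    by (simp only: slot[OF pl(1) vl(1)])
  also have "\<dots> = (SUM j k i. phi0 i j k * vol q (E i q # E j q # E k q # vs))"
    unfolding phi_frame[OF q] by (rule sum.swap)
  also have "\<dots> = (SUM j i k. phi0 i j k * vol q (E i q # E j q # E k q # vs))"
    by (rule sum.cong[OF refl], rule sum.swap)
  also have "\<dots> = (SUM i j k. phi0 i j k * vol q (E i q # E j q # E k q # vs))" by (rule sum.swap)
  finally show ?thesis by simp
qed

lemma H_linear: "length vs = 4 \<Longrightarrow> k < 4 \<Longrightarrow> linear (\<lambda>v. H q (vs[k := v]))"
proof -
  assume vs: "length vs = 4" "k < 4"
  have l: "linear (\<lambda>v. vol q ([E i q, E j q, E m q] @ vs[k := v]))" for i j m
    using vol_linear[of "[E i q, E j q, E m q] @ vs" "3 + k"] vs by (simp add: numeral_3_eq_3)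
  have "linear (\<lambda>v. (SUM i j m. phi0 i j m * vol q ([E i q, E j q, E m q] @ vs[k := v])) / 6)"
    unfolding linear_iff
    by (simp add: linear_add[OF l, simplified] linear_scale[OF l, simplified] distrib_left sum.distrib
        add_divide_distrib sum_distrib_left mult_ac)
  then show ?thesis using vs by (simp add: hodge_frame)
qed

lemma H_E: "H q [E a q, E b q, E c q, E d q] = psi0 a b c d"
proof -
  have "H q [E a q, E b q, E c q, E d q] = (SUM i j k. phi0 i j k * eps [i, j, k, a, b, c, d]) / 6"
    using vol_E[of "[i, j, k, a, b, c, d]" for i j k] by (simp add: hodge_frame)
  also have "(SUM i j k. phi0 i j k * eps [i, j, k, a, b, c, d]) =
      (SUM i k j. phi0 i j k * eps [i, j, k, a, b, c, d])"
    by (rule sum.cong[OF refl], rule sum.swap)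
  also have "\<dots> = (SUM k i j. phi0 i j k * eps [i, j, k, a, b, c, d])" by (rule sum.swap)
  finally show ?thesis by (simp add: psi0_def)
qed

text \<open>Writes \<open>*\<phi>\<close> as a constant-coefficient polynomial in the coframe, so
  that its exterior derivative involves only derivatives of the coframe.\<close>

lemma H_expansion:
  "H q [u, v, w, x] = (SUM a b c d. psi0 a b c d * (e a q [u] * (e b q [v] * (e c q [w] * e d q [x]))))"
proof -
  have l: "linear (\<lambda>t. H q [t, v, w, x])" "linear (\<lambda>t. H q [u, t, w, x])" "linear (\<lambda>t. H q [u, v, t, x])"
    "linear (\<lambda>t. H q [u, v, w, t])" for u v w x
    using H_linear[of "[u, v, w, x]" 0] H_linear[of "[u, v, w, x]" 1] H_linear[of "[u, v, w, x]" 2]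
      H_linear[of "[u, v, w, x]" 3] by (simp_all add: numeral_3_eq_3 numeral_2_eq_2)
  have 1: "H q [u, v, w, x] = (SUM a. e a q [u] * H q [E a q, v, w, x])" for u v w x
    by (subst frame_expansion[OF q, of u]) (simp add: linear_sum[OF l(1)] linear_scale[OF l(1)])
  have 2: "H q [E a q, v, w, x] = (SUM b. e b q [v] * H q [E a q, E b q, w, x])" for a v w x
    by (subst frame_expansion[OF q, of v]) (simp add: linear_sum[OF l(2)] linear_scale[OF l(2)])
  have 3: "H q [E a q, E b q, w, x] = (SUM c. e c q [w] * H q [E a q, E b q, E c q, x])" for a b w x
    by (subst frame_expansion[OF q, of w]) (simp add: linear_sum[OF l(3)] linear_scale[OF l(3)])
  have 4: "H q [E a q, E b q, E c q, x] = (SUM d. e d q [x] * psi0 a b c d)" for a b c x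
    by (subst frame_expansion[OF q, of x]) (simp add: linear_sum[OF l(4)] linear_scale[OF l(4)] H_E)
  have "H q [u, v, w, x] = (SUM a. e a q [u] * (SUM b. e b q [v] * (SUM c. e c q [w] * (SUM d. e d q [x] * psi0 a b c d))))"
    by (simp only: 1[of u v w x] 2[of _ v w x] 3[of _ _ w x] 4[of _ _ _ x])
  then show ?thesis by (simp add: sum_distrib_left mult_ac)
qed

end

end

section \<open>Cocalibration\<close>

lemma has_derivative_mult4:
  fixes f1 f2 f3 f4 :: "'a::real_normed_vector \<Rightarrow> real"
  assumes "(f1 has_derivative d1) (at x)" "(f2 has_derivative d2) (at x)"
    "(f3 has_derivative d3) (at x)" "(f4 has_derivative d4) (at x)"
  shows "((\<lambda>x. f1 x * (f2 x * (f3 x * f4 x))) has_derivative (\<lambda>v. d1 v * (f2 x * (f3 x * f4 x))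
     + f1 x * (d2 v * (f3 x * f4 x)) + f1 x * (f2 x * (d3 v * f4 x)) + f1 x * (f2 x * (f3 x * d4 v)))) (at x)"
  by (rule has_derivative_eq_rhs[OF has_derivative_mult[OF assms(1) has_derivative_mult[OF assms(2)
        has_derivative_mult[OF assms(3,4)]]]]) (simp add: fun_eq_iff algebra_simps)

lemma sum_kdelta_right: "(SUM i. f i * kdelta i a) = f a" for a :: "'i::finite" and f :: "'i \<Rightarrow> real"
  using sum_kdelta2[of a f] by (simp add: mult.commute)

text \<open>The four terms of the product rule for \<open>H_expansion\<close> on frame vectors:
  three coframe factors are deltas at the point, and one factor \<open>t\<close> is a
  derivative.\<close>

lemma sum_kdelta4:
  fixes f :: "'i::finite \<Rightarrow> 'i \<Rightarrow> 'i \<Rightarrow> 'i \<Rightarrow> real" and t :: "'i \<Rightarrow> real"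
  shows "(SUM a b c d. f a b c d * (t a * (kdelta b j * (kdelta c k * kdelta d l)))) = (SUM s. t s * f s j k l)"
    and "(SUM a b c d. f a b c d * (kdelta a i * (t b * (kdelta c k * kdelta d l)))) = (SUM s. t s * f i s k l)"
    and "(SUM a b c d. f a b c d * (kdelta a i * (kdelta b j * (t c * kdelta d l)))) = (SUM s. t s * f i j s l)"
    and "(SUM a b c d. f a b c d * (kdelta a i * (kdelta b j * (kdelta c k * t d)))) = (SUM s. t s * f i j k s)"
proof -
  have d: "(SUM d. f a b c d * (x * (y * (z * kdelta d l)))) = f a b c l * (x * (y * z))" for a b c x y z l
    using sum_kdelta_right[of "\<lambda>d. f a b c d * (x * (y * z))" l] by (simp add: mult.assoc)
  have c: "(SUM c. f a b c l * (x * (y * kdelta c k))) = f a b k l * (x * y)" for a b l x y k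
    using sum_kdelta_right[of "\<lambda>c. f a b c l * (x * y)" k] by (simp add: mult.assoc)
  have b: "(SUM b. f a b k l * (x * kdelta b j)) = f a j k l * x" for a k l x j
    using sum_kdelta_right[of "\<lambda>b. f a b k l * x" j] by (simp add: mult.assoc)
  show "(SUM a b c d. f a b c d * (t a * (kdelta b j * (kdelta c k * kdelta d l)))) = (SUM s. t s * f s j k l)"
    unfolding d c b by (simp add: mult.commute)
  have 2: "(SUM b. f a b k l * (kdelta a i * t b)) = (SUM b. t b * f a b k l) * kdelta a i" for a
    by (simp add: sum_distrib_left sum_distrib_right mult_ac)
  show "(SUM a b c d. f a b c d * (kdelta a i * (t b * (kdelta c k * kdelta d l)))) = (SUM s. t s * f i s k l)"
    unfolding d c 2 sum_kdelta_right ..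
  have 3: "(SUM b c. f a b c l * (kdelta a i * (kdelta b j * t c))) = (SUM s. t s * f a j s l) * kdelta a i" for a
  proof -
    have "(SUM c. f a b c l * (kdelta a i * (kdelta b j * t c))) = (SUM s. t s * f a b s l) * kdelta a i * kdelta b j" for b
      by (simp add: sum_distrib_left sum_distrib_right mult_ac)
    then show ?thesis by (simp add: sum_kdelta_right)
  qed
  show "(SUM a b c d. f a b c d * (kdelta a i * (kdelta b j * (t c * kdelta d l)))) = (SUM s. t s * f i j s l)"
    unfolding d 3 sum_kdelta_right ..
  have 4: "(SUM b c d. f a b c d * (kdelta a i * (kdelta b j * (kdelta c k * t d)))) = (SUM s. t s * f a j k s) * kdelta a i" for a
  proof -
    have "(SUM c d. f a b c d * (kdelta a i * (kdelta b j * (kdelta c k * t d)))) =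
      (SUM s. t s * f a b k s) * kdelta a i * kdelta b j" for b
    proof -
      have "(SUM d. f a b c d * (kdelta a i * (kdelta b j * (kdelta c k * t d)))) =
        (SUM s. t s * f a b c s) * kdelta a i * kdelta b j * kdelta c k" for c
        by (simp add: sum_distrib_left sum_distrib_right mult_ac)
      then show ?thesis by (simp add: sum_kdelta_right)
    qed
    then show ?thesis by (simp add: sum_kdelta_right)
  qed
  show "(SUM a b c d. f a b c d * (kdelta a i * (kdelta b j * (kdelta c k * t d)))) = (SUM s. t s * f i j k s)"
    unfolding 4 sum_kdelta_right ..
qed

section \<open>Closedness of \<open>*\<phi>\<close> as linear relations between structure
  functions\<close>

context g2_local_frame
begin

context
  fixes p assumes p: "p \<in> V"
begin

text \<open>The coframe in the coordinates at \<open>p\<close>. Closedness of \<open>*\<phi>\<close> is expressed through \<open>dtheta\<close>, whose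
  skew part is \<open>C\<close>, and becomes the linear relations \<open>cocal_tuple\<close> between \<open>C\<close> and the components \<open>psi0\<close>
  of \<open>*\<phi>\<close>.\<close>

definition theta where "theta s w x = form_rep A (chart_at A p) (e s) x [w]"

definition dtheta where "dtheta s w = frechet_derivative (theta s w) (at (snd (chart_at A p) p))"

abbreviation "p_coord \<equiv> snd (chart_at A p) p"
abbreviation "V_coord \<equiv> snd (chart_at A p) ` (fst (chart_at A p) \<inter> V)"

lemma V_coord: "open V_coord" "p_coord \<in> V_coord"
  using open_image[OF chart_at(1) V] p chart_at by auto

lemma theta_smooth: "smooth_on V_coord (theta s w)"
  using e_form[of s] chart_at(1) unfolding smooth_form_def theta_def by simp

lemma theta_has_derivative: "(theta s w has_derivative dtheta s w) (at p_coord)"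
  unfolding dtheta_def by (rule smooth_on_has_derivative[OF theta_smooth V_coord(2)])

lemma theta_linear: "x \<in> V_coord \<Longrightarrow> linear (\<lambda>w. theta s w x)"
proof -
  assume "x \<in> V_coord"
  then have q: "inv_chart (chart_at A p) x \<in> fst (chart_at A p)" "inv_chart (chart_at A p) x \<in> V"
    using image_Int_iff[OF chart_at(1), of x p V] inv_chart_in[OF chart_at(1), of x p] by auto
  have "linear (\<lambda>w. e s (inv_chart (chart_at A p) x) [from_chart A (chart_at A p) (inv_chart (chart_at A p) x) w])"
    using linear_compose[OF from_chart_linear[OF chart_at(1) q(1)] e_linear[OF q(2), of s]] by (simp add: comp_def)
  then show ?thesis by (simp add: theta_def form_rep_def)
qed

lemma theta_at: "theta s w p_coord = e s p [w]"
  by (simp add: theta_def form_rep_def chart_at)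

lemma theta_axis: "x \<in> V_coord \<Longrightarrow> theta s w x = (SUM k. w $ k * theta s (axis k 1) x)"
proof -
  assume x: "x \<in> V_coord"
  have "theta s (SUM k. w $ k *\<^sub>R axis k 1) x = (SUM k. w $ k * theta s (axis k 1) x)"
    by (simp add: linear_sum[OF theta_linear[OF x]] linear_scale[OF theta_linear[OF x]])
  then show "theta s w x = (SUM k. w $ k * theta s (axis k 1) x)" unfolding vec_axis_sum .
qed

lemma dtheta_axis: "dtheta s w v = (SUM k. w $ k * dtheta s (axis k 1) v)"
proof -
  have "((\<lambda>x. SUM k. w $ k * theta s (axis k 1) x) has_derivative (\<lambda>v. SUM k. w $ k * dtheta s (axis k 1) v)) (at p_coord)"
    by (intro has_derivative_sum has_derivative_mult_right theta_has_derivative)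
  then have "(theta s w has_derivative (\<lambda>v. SUM k. w $ k * dtheta s (axis k 1) v)) (at p_coord)"
    by (rule has_derivative_transform_within_open[OF _ V_coord]) (simp add: theta_axis[of _ s w])
  from fun_cong[OF frechet_derivative_at[OF this], of v] show ?thesis
    unfolding dtheta_def[of s w] by simp
qed

text \<open>Cartan's formula: the exterior derivative of a coframe member on two frame fields is
  minus its value on their bracket. In \<open>key\<close>, differentiating the constant pairing of
  coframe and frame trades a derivative of the frame for one of the coframe.\<close>

lemma C_dtheta: "C a b s p = dtheta s (E a p) (E b p) - dtheta s (E b p) (E a p)"
proof -
  let ?c = "chart_at A p"
  have key: "e s p [frechet_derivative (vf_rep A ?c (E b)) (at p_coord) v] = - dtheta s (E b p) v" for b v
  proof -
    let ?W = "vf_rep A ?c (E b)"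
    have W: "smooth_on V_coord ?W" using E_vsm[of b] chart_at(1) unfolding vsm_on_def by blast
    have Wd: "(?W has_derivative frechet_derivative ?W (at p_coord)) (at p_coord)"
      by (rule smooth_on_has_derivative[OF W V_coord(2)])
    have W0: "?W p_coord = E b p" by (simp add: vf_rep_def chart_at)
    have "((\<lambda>x. SUM k. ?W x $ k * theta s (axis k 1) x) has_derivative
      (\<lambda>v. SUM k. ?W p_coord $ k * dtheta s (axis k 1) v + frechet_derivative ?W (at p_coord) v $ k * theta s (axis k 1) p_coord)) (at p_coord)"
      by (intro has_derivative_sum has_derivative_mult theta_has_derivative
          bounded_linear.has_derivative[OF bounded_linear_vec_nth Wd])
    then have "((\<lambda>x. kdelta s b) has_derivative
      (\<lambda>v. SUM k. ?W p_coord $ k * dtheta s (axis k 1) v + frechet_derivative ?W (at p_coord) v $ k * theta s (axis k 1) p_coord)) (at p_coord)"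
    proof (rule has_derivative_transform_within_open[OF _ V_coord])
      fix x assume x: "x \<in> V_coord"
      then have q: "inv_chart ?c x \<in> fst ?c" "inv_chart ?c x \<in> V"
        using image_Int_iff[OF chart_at(1), of x p V] inv_chart_in[OF chart_at(1), of x p] by auto
      have "(SUM k. ?W x $ k * theta s (axis k 1) x) = theta s (?W x) x"
        by (rule theta_axis[OF x, symmetric])
      also have "\<dots> = kdelta s b"
        using q chart_at(1) by (simp add: theta_def form_rep_def vf_rep_def dual)
      finally show "(SUM k. ?W x $ k * theta s (axis k 1) x) = kdelta s b" .
    qed
    then have "(\<lambda>v. SUM k. ?W p_coord $ k * dtheta s (axis k 1) v + frechet_derivative ?W (at p_coord) v $ k * theta s (axis k 1) p_coord) = (\<lambda>v. 0)"
      by (rule has_derivative_unique) simp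
    then have "(SUM k. ?W p_coord $ k * dtheta s (axis k 1) v) + (SUM k. frechet_derivative ?W (at p_coord) v $ k * theta s (axis k 1) p_coord) = 0"
      unfolding sum.distrib[symmetric] by metis
    then show ?thesis
      using theta_axis[OF V_coord(2), of s "frechet_derivative ?W (at p_coord) v"]
      unfolding dtheta_axis[of s "E b p" v] W0 theta_at by linarith
  qed
  have "C a b s p = e s p [lie_bracket A (E a) (E b) p]"
    by (simp add: bracket_E[OF p] e_sum[OF p])
  also have "\<dots> = dtheta s (E a p) (E b p) - dtheta s (E b p) (E a p)"
    by (simp add: lie_bracket_def Let_def linear_diff[OF e_linear[OF p]] key)
  finally show ?thesis .
qed

lemma H_derivative:
  "frechet_derivative (\<lambda>x. form_rep A (chart_at A p) H x [E i p, E j p, E k p, E l p]) (at p_coord) v =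
     (SUM s. dtheta s (E i p) v * psi0 s j k l) - (SUM s. dtheta s (E j p) v * psi0 s i k l)
     + (SUM s. dtheta s (E k p) v * psi0 s i j l) - (SUM s. dtheta s (E l p) v * psi0 s i j k)"
proof -
  let ?w = "\<lambda>i. E i p"
  have "((\<lambda>x. SUM a b c d. psi0 a b c d *
      (theta a (?w i) x * (theta b (?w j) x * (theta c (?w k) x * theta d (?w l) x)))) has_derivative
    (\<lambda>v. SUM a b c d. psi0 a b c d *
      (dtheta a (?w i) v * (theta b (?w j) p_coord * (theta c (?w k) p_coord * theta d (?w l) p_coord))
      + theta a (?w i) p_coord * (dtheta b (?w j) v * (theta c (?w k) p_coord * theta d (?w l) p_coord))
      + theta a (?w i) p_coord * (theta b (?w j) p_coord * (dtheta c (?w k) v * theta d (?w l) p_coord))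
      + theta a (?w i) p_coord * (theta b (?w j) p_coord * (theta c (?w k) p_coord * dtheta d (?w l) v))))) (at p_coord)"
    by (intro has_derivative_sum has_derivative_mult_right has_derivative_mult4 theta_has_derivative)
  then have "((\<lambda>x. form_rep A (chart_at A p) H x [?w i, ?w j, ?w k, ?w l]) has_derivative
    (\<lambda>v. SUM a b c d. psi0 a b c d *
      (dtheta a (?w i) v * (theta b (?w j) p_coord * (theta c (?w k) p_coord * theta d (?w l) p_coord))
      + theta a (?w i) p_coord * (dtheta b (?w j) v * (theta c (?w k) p_coord * theta d (?w l) p_coord))
      + theta a (?w i) p_coord * (theta b (?w j) p_coord * (dtheta c (?w k) v * theta d (?w l) p_coord))
      + theta a (?w i) p_coord * (theta b (?w j) p_coord * (theta c (?w k) p_coord * dtheta d (?w l) v))))) (at p_coord)"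
  proof (rule has_derivative_transform_within_open[OF _ V_coord])
    fix x assume "x \<in> V_coord"
    then have "inv_chart (chart_at A p) x \<in> V" using image_Int_iff[OF chart_at(1), of x p V] by auto
    then show "(SUM a b c d. psi0 a b c d *
      (theta a (?w i) x * (theta b (?w j) x * (theta c (?w k) x * theta d (?w l) x)))) =
      form_rep A (chart_at A p) H x [?w i, ?w j, ?w k, ?w l]"
      by (simp add: form_rep_def H_expansion theta_def)
  qed
  from frechet_derivative_at[OF this, symmetric]
  have "frechet_derivative (\<lambda>x. form_rep A (chart_at A p) H x [?w i, ?w j, ?w k, ?w l]) (at p_coord) v =
    (SUM s. dtheta s (?w i) v * psi0 s j k l) + (SUM s. dtheta s (?w j) v * psi0 i s k l)
     + (SUM s. dtheta s (?w k) v * psi0 i j s l) + (SUM s. dtheta s (?w l) v * psi0 i j k s)"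
    unfolding theta_at dual[OF p] by (simp only: distrib_left sum.distrib sum_kdelta4)
  moreover have "psi0 i s k l = - psi0 s i k l" "psi0 i j s l = psi0 s i j l" "psi0 i j k s = - psi0 s i j k" for s
    by (metis psi0_skew minus_minus)+
  ultimately show ?thesis by (simp add: sum_negf)
qed

text \<open>The twenty sums in the exterior derivative pair up into ten structure functions. This is
  the invariant formula for the exterior derivative on frame fields, where the form has constant
  components and only bracket terms remain.\<close>

lemma cocal_tuple:
  "(SUM s. C i j s p * psi0 s k l m) - (SUM s. C i k s p * psi0 s j l m) + (SUM s. C i l s p * psi0 s j k m)
   - (SUM s. C i m s p * psi0 s j k l) + (SUM s. C j k s p * psi0 s i l m) - (SUM s. C j l s p * psi0 s i k m)
   + (SUM s. C j m s p * psi0 s i k l) + (SUM s. C k l s p * psi0 s i j m) - (SUM s. C k m s p * psi0 s i j l)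
   + (SUM s. C l m s p * psi0 s i j k) = 0"
proof -
  have "ext_deriv A H p [E i p, E j p, E k p, E l p, E m p] = 0"
    using cocal unfolding cocalibrated_def H_def by simp
  then have "frechet_derivative (\<lambda>x. form_rep A (chart_at A p) H x [E j p, E k p, E l p, E m p]) (at p_coord) (E i p)
    - frechet_derivative (\<lambda>x. form_rep A (chart_at A p) H x [E i p, E k p, E l p, E m p]) (at p_coord) (E j p)
    + frechet_derivative (\<lambda>x. form_rep A (chart_at A p) H x [E i p, E j p, E l p, E m p]) (at p_coord) (E k p)
    - frechet_derivative (\<lambda>x. form_rep A (chart_at A p) H x [E i p, E j p, E k p, E m p]) (at p_coord) (E l p)
    + frechet_derivative (\<lambda>x. form_rep A (chart_at A p) H x [E i p, E j p, E k p, E l p]) (at p_coord) (E m p) = 0"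
    by (simp add: ext_deriv_def Let_def lessThan_Suc eval_nat_numeral)
  then show ?thesis
    unfolding H_derivative C_dtheta left_diff_distrib sum_subtractf by linarith
qed

end

text \<open>The skew part of \<open>S\<close> is the seven-dimensional component of the torsion,
  which the closedness of \<open>*\<phi>\<close> makes vanish. Closedness constrains
  \<open>C\<close>, hence a combination of \<Gamma> and \<open>T\<close>; the relations placing
  \<Gamma> in \<open>g2\<close> eliminate \<Gamma> from it.\<close>

lemma T_contraction_sym:
  assumes p: "p \<in> V"
  shows "(SUM a b. phi0 a b l * T m a b p) = (SUM a b. phi0 a b m * T l a b p)"
proof -
  define G where "G a b c = \<Gamma> a b c p" for a b c
  define t where "t a b c = T a b c p" for a b c
  define St where "St l m = (SUM a b. phi0 a b m * t l a b)" for l m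
  have G_in_g2: "(SUM i j. phi0 i j k * G a i j) = 0" for a k
    unfolding G_def by (rule phi0_annihilator_contraction[OF \<Gamma>_skew[OF p] \<Gamma>_phi0[OF p]])
  have skew: "G a c b = - G a b c" "t b a c = - t a b c" "t a c b = - t a b c" for a b c
    unfolding G_def t_def by (rule \<Gamma>_skew[OF p] T_skew)+
  have C_eq: "C a b c p = G a b c - G b a c - t a b c" for a b c
    by (simp add: C_def G_def t_def)
  note psi_rules = psi0_sort psi0_zero psi0_table rk_simps
  note rules = St_def phi0_sum_first_simps C_eq skew_sorted[of "G a" for a, OF skew(1)]
    skew_sorted[of "\<lambda>a b. t a b c" for c, OF skew(2)] skew_sorted[of "t a" for a, OF skew(3)]
  note cocal_tuple = cocal_tuple[OF p]
  \<comment> \<open>In each of \<open>c1\<close> to \<open>c7\<close> the two indices missing from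
    the tuple form a line with the index named by the label. All terms then have the degree of that
    index, as have the relations for \<Gamma> used with it, and the three symmetries obtained belong
    to the three lines through it.\<close>
  have c1: "C 1 3 3 p + C 1 4 4 p + C 1 5 5 p + C 1 6 6 p - C 3 4 2 p - C 3 6 7 p - C 4 5 7 p
      - C 5 6 2 p = 0"
    using cocal_tuple[of 1 3 4 5 6] by (simp add: sum_7 psi_rules)
  have s1: "St 2 7 = St 7 2 \<and> St 3 5 = St 5 3 \<and> St 4 6 = St 6 4"
    using c1
      G_in_g2[of 7 2] G_in_g2[of 5 3] G_in_g2[of 6 4] G_in_g2[of 3 5] G_in_g2[of 4 6] G_in_g2[of 2 7]
    unfolding rules by (intro conjI; algebra)
  have c2: "C 2 3 3 p + C 2 4 4 p + C 2 5 5 p + C 2 6 6 p + C 3 4 1 p - C 3 5 7 p + C 4 6 7 p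
      + C 5 6 1 p = 0"
    using cocal_tuple[of 2 3 4 5 6] by (simp add: sum_7 psi_rules)
  have s2: "St 1 7 = St 7 1 \<and> St 3 6 = St 6 3 \<and> St 4 5 = St 5 4"
    using c2
      G_in_g2[of 7 1] G_in_g2[of 6 3] G_in_g2[of 5 4] G_in_g2[of 4 5] G_in_g2[of 3 6] G_in_g2[of 1 7]
    unfolding rules by (intro conjI; algebra)
  have c3: "- C 2 3 2 p - C 2 4 1 p - C 2 7 5 p + C 3 4 4 p + C 3 6 6 p + C 3 7 7 p + C 4 6 5 p
      + C 6 7 1 p = 0"
    using cocal_tuple[of 2 3 4 6 7] by (simp add: sum_7 psi_rules)
  have s3: "St 1 5 = St 5 1 \<and> St 2 6 = St 6 2 \<and> St 4 7 = St 7 4"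
    using c3
      G_in_g2[of 5 1] G_in_g2[of 6 2] G_in_g2[of 7 4] G_in_g2[of 1 5] G_in_g2[of 2 6] G_in_g2[of 4 7]
    unfolding rules by (intro conjI; algebra)
  have c4: "C 2 3 1 p - C 2 4 2 p + C 2 7 6 p - C 3 4 3 p + C 3 5 6 p + C 4 5 5 p + C 4 7 7 p
      + C 5 7 1 p = 0"
    using cocal_tuple[of 2 3 4 5 7] by (simp add: sum_7 psi_rules)
  have s4: "St 1 6 = St 6 1 \<and> St 2 5 = St 5 2 \<and> St 3 7 = St 7 3"
    using c4
      G_in_g2[of 6 1] G_in_g2[of 5 2] G_in_g2[of 7 3] G_in_g2[of 2 5] G_in_g2[of 1 6] G_in_g2[of 3 7]
    unfolding rules by (intro conjI; algebra)
  have c5: "C 2 5 2 p + C 2 6 1 p - C 2 7 3 p + C 4 5 4 p + C 4 6 3 p + C 4 7 1 p - C 5 6 6 p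
      - C 5 7 7 p = 0"
    using cocal_tuple[of 2 4 5 6 7] by (simp add: sum_7 psi_rules)
  have s5: "St 1 3 = St 3 1 \<and> St 2 4 = St 4 2 \<and> St 6 7 = St 7 6"
    using c5
      G_in_g2[of 3 1] G_in_g2[of 4 2] G_in_g2[of 1 3] G_in_g2[of 2 4] G_in_g2[of 7 6] G_in_g2[of 6 7]
    unfolding rules by (intro conjI; algebra)
  have c6: "- C 2 5 1 p + C 2 6 2 p + C 2 7 4 p + C 3 5 4 p + C 3 6 3 p + C 3 7 1 p + C 5 6 5 p
      - C 6 7 7 p = 0"
    using cocal_tuple[of 2 3 5 6 7] by (simp add: sum_7 psi_rules)
  have s6: "St 1 4 = St 4 1 \<and> St 2 3 = St 3 2 \<and> St 5 7 = St 7 5"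
    using c6
      G_in_g2[of 4 1] G_in_g2[of 3 2] G_in_g2[of 2 3] G_in_g2[of 1 4] G_in_g2[of 7 5] G_in_g2[of 5 7]
    unfolding rules by (intro conjI; algebra)
  have c7: "C 3 5 2 p + C 3 6 1 p - C 3 7 3 p + C 4 5 1 p - C 4 6 2 p - C 4 7 4 p - C 5 7 5 p
      - C 6 7 6 p = 0"
    using cocal_tuple[of 3 4 5 6 7] by (simp add: sum_7 psi_rules)
  have s7: "St 1 2 = St 2 1 \<and> St 3 4 = St 4 3 \<and> St 5 6 = St 6 5"
    using c7
      G_in_g2[of 2 1] G_in_g2[of 1 2] G_in_g2[of 4 3] G_in_g2[of 3 4] G_in_g2[of 6 5] G_in_g2[of 5 6]
    unfolding rules by (intro conjI; algebra)
  have "\<forall>l m. St m l = St l m"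
    unfolding forall_7 by (simp add: s1 s2 s3 s4 s5 s6 s7)
  then show ?thesis unfolding St_def t_def by blast
qed

end

section \<open>Parallel torsion\<close>

lemma sum_swap_13:
  fixes f :: "'i::finite \<Rightarrow> 'i \<Rightarrow> 'i \<Rightarrow> real"
  shows "(SUM a b c. f a b c) = (SUM c b a. f a b c)"
proof -
  have "(SUM a b c. f a b c) = (SUM a c b. f a b c)"
    by (rule sum.cong[OF refl], rule sum.swap)
  also have "\<dots> = (SUM c a b. f a b c)" by (rule sum.swap)
  also have "\<dots> = (SUM c b a. f a b c)" by (rule sum.cong[OF refl], rule sum.swap)
  finally show ?thesis .
qed

lemma sum_swap_14:
  fixes f :: "'i::finite \<Rightarrow> 'i \<Rightarrow> 'i \<Rightarrow> 'i \<Rightarrow> real"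
  shows "(SUM a b c d. f a b c d) = (SUM d b c a. f a b c d)"
proof -
  have "(SUM a b c d. f a b c d) = (SUM a d c b. f a b c d)"
    by (rule sum.cong[OF refl], rule sum_swap_13)
  also have "\<dots> = (SUM d a c b. f a b c d)" by (rule sum.swap)
  also have "\<dots> = (SUM d b c a. f a b c d)"
    by (rule sum.cong[OF refl], rule sum_swap_13)
  finally show ?thesis .
qed

section \<open>From frame components to arbitrary vector fields\<close>

context g2_local_frame
begin

lemma torsion_components_parallel:
  assumes p: "p \<in> V"
  shows "vf_apply A (E d) (T a b c) p = (SUM s. \<Gamma> d a s p * T s b c p + \<Gamma> d b s p * T a s c p + \<Gamma> d c s p * T a b s p)"
proof -
  interpret fr: g2_frame V "sm_on A V" "\<lambda>a. vf_apply A (E a)" \<Gamma> T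
  proof
    fix f h q v s and a b c d l m :: 7
    show "sm_on A V (\<lambda>p. r)" for r by (rule sm_const[OF V])
    show "sm_on A V f \<Longrightarrow> sm_on A V h \<Longrightarrow> sm_on A V (\<lambda>p. f p + h p)" by (rule sm_add[OF V])
    show "sm_on A V f \<Longrightarrow> sm_on A V h \<Longrightarrow> sm_on A V (\<lambda>p. f p * h p)" by (rule sm_mult[OF V])
    show "sm_on A V f \<Longrightarrow> sm_on A V (vf_apply A (E a) f)" by (rule sm_vf_apply[OF V _ E_vsm])
    show "sm_on A V f \<Longrightarrow> sm_on A V h \<Longrightarrow> q \<in> V \<Longrightarrow>
      vf_apply A (E a) (\<lambda>p. f p + h p) q = vf_apply A (E a) f q + vf_apply A (E a) h q"
      by (rule vf_apply_add[OF V])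
    show "sm_on A V f \<Longrightarrow> sm_on A V h \<Longrightarrow> q \<in> V \<Longrightarrow>
      vf_apply A (E a) (\<lambda>p. f p * h p) q = vf_apply A (E a) f q * h q + f q * vf_apply A (E a) h q"
      by (rule vf_apply_mult[OF V])
    show "vf_apply A (E a) (\<lambda>p. r) q = 0" for r by (rule vf_apply_const[OF V])
    show "vf_apply A (E a) f q = vf_apply A (E a) h q" if "\<And>r. r \<in> V \<Longrightarrow> f r = h r" "q \<in> V"
      by (rule vf_apply_cong[OF V that(2,1) refl])
    show "sm_on A V (\<Gamma> a b c)" "sm_on A V (T a b c)" by (rule sm_\<Gamma> sm_T)+
    show "sm_on A V f \<Longrightarrow> q \<in> V \<Longrightarrow> vf_apply A (E a) (vf_apply A (E b) f) q - vf_apply A (E b) (vf_apply A (E a) f) q =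
        (SUM s. (\<Gamma> a b s q - \<Gamma> b a s q - T a b s q) * vf_apply A (E s) f q)"
      by (rule commutator[unfolded C_def])
    show "v s = 0" if "q \<in> V" "\<And>f. sm_on A V f \<Longrightarrow> (SUM s. v s * vf_apply A (E s) f q) = 0"
      by (rule independent[OF that])
    show "q \<in> V \<Longrightarrow> \<Gamma> a c b q = - \<Gamma> a b c q" by (rule \<Gamma>_skew)
    show "T b a c q = - T a b c q" "T a c b q = - T a b c q" by (rule T_skew)+
    show "q \<in> V \<Longrightarrow> (SUM s. \<Gamma> a b s q * phi0 s c d + \<Gamma> a c s q * phi0 b s d + \<Gamma> a d s q * phi0 b c s) = 0"
      by (rule \<Gamma>_phi0)
    show "q \<in> V \<Longrightarrow> (SUM a b. phi0 a b l * T m a b q) = (SUM a b. phi0 a b m * T l a b q)"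
      by (rule T_contraction_sym)
  qed
  interpret fi: g2_instanton_frame V "sm_on A V" "\<lambda>a. vf_apply A (E a)" \<Gamma> T
  proof
    fix q k i j assume q: "q \<in> V"
    have "fr.R a b i j q = curvature A g D (E a) (E b) (E i) (E j) q" for a b
      by (simp add: fr.R_def fr.C_def curvature_E[OF q] C_def)
    then show "(SUM a b. phi0 a b k * fr.R a b i j q) = 0"
      using instanton_E[OF q] by simp
  qed
  show ?thesis using fi.DT_zero[OF p, of d a b c] by (simp add: fr.DT_def)
qed

text \<open>All fields are expanded in the frame. The terms that differentiate the coefficients of
  the arguments match on both sides, and the others match by
  \<open>torsion_components_parallel\<close> contracted with \<open>X\<close>.\<close>

lemma cov_deriv_tau:
  assumes p: "p \<in> V" and X: "smooth_vf A X" and Y: "smooth_vf A Y0" "smooth_vf A Y1" "smooth_vf A Y2"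
  shows "vf_apply A X (\<lambda>q. \<tau> q [Y0 q, Y1 q, Y2 q]) p =
    \<tau> p [D X Y0 p, Y1 p, Y2 p] + \<tau> p [Y0 p, D X Y1 p, Y2 p] + \<tau> p [Y0 p, Y1 p, D X Y2 p]"
proof -
  define y where "y Z a q = e a q [Z q]" for Z a q
  have sy: "smooth_vf A Z \<Longrightarrow> sm_on A V (y Z a)" for Z a unfolding y_def by (rule sm_coef)
  have exp: "q \<in> V \<Longrightarrow> Z q = (SUM a. y Z a q *\<^sub>R E a q)" for Z q
    unfolding y_def by (rule frame_expansion)
  \<comment> \<open>The connection form evaluated on \<open>X\<close>.\<close>
  define \<omega> where "\<omega> a b = (SUM d. y X d p * \<Gamma> d a b p)" for a b
  have tri: "\<tau> q [u, v, w] = (SUM a b c. e a q [u] * (e b q [v] * (e c q [w] * T a b c q)))"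
    if q: "q \<in> V" for q u v w
  proof -
    note lin = smooth_form3_linear[OF tau_form UNIV_I, of q]
    have 1: "\<tau> q [u, v, w] = (SUM a. e a q [u] * \<tau> q [E a q, v, w])" for u v w
      by (subst frame_expansion[OF q, of u]) (simp add: linear_sum[OF lin(1)] linear_scale[OF lin(1)])
    have 2: "\<tau> q [E a q, v, w] = (SUM b. e b q [v] * \<tau> q [E a q, E b q, w])" for a v w
      by (subst frame_expansion[OF q, of v]) (simp add: linear_sum[OF lin(2)] linear_scale[OF lin(2)])
    have 3: "\<tau> q [E a q, E b q, w] = (SUM c. e c q [w] * T a b c q)" for a b w
      by (subst frame_expansion[OF q, of w]) (simp add: linear_sum[OF lin(3)] linear_scale[OF lin(3)] T_def)
    show ?thesis unfolding 1[of u v w] 2[of _ v w] 3[of _ _ w] by (simp add: sum_distrib_left)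
  qed
  have DXE: "e s p [D X (E a) p] = \<omega> a s" for a s
  proof -
    have "D X (E a) p = (SUM d. y X d p *\<^sub>R D (E d) (E a) p)"
      by (rule D_expand1[OF V p sy[OF X] E_smooth X exp E_smooth])
    then show ?thesis
      by (simp add: linear_sum[OF e_linear[OF p]] linear_scale[OF e_linear[OF p]] \<omega>_def \<Gamma>_def)
  qed
  have DXY: "e s p [D X Z p] = vf_apply A X (y Z s) p + (SUM a. y Z a p * \<omega> a s)" if Z: "smooth_vf A Z" for Z s
  proof -
    have "D X Z p = (SUM a. vf_apply A X (y Z a) p *\<^sub>R E a p + y Z a p *\<^sub>R D X (E a) p)"
      by (rule D_expand2[OF V p sy[OF Z] E_smooth Z exp X])
    then show ?thesis
      by (simp add: sum.distrib linear_add[OF e_linear[OF p]] e_sum[OF p])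
        (simp add: linear_sum[OF e_linear[OF p]] linear_scale[OF e_linear[OF p]] DXE)
  qed
  have XT: "vf_apply A X (T a b c) p = (SUM s. \<omega> a s * T s b c p) + (SUM s. \<omega> b s * T a s c p) + (SUM s. \<omega> c s * T a b s p)" for a b c
  proof -
    have "vf_apply A X (T a b c) p = (SUM d. y X d p * vf_apply A (E d) (T a b c) p)"
      by (rule vf_apply_linear_field[OF V sm_T p]) (rule exp[OF p])
    also have "\<dots> = (SUM d s. y X d p * (\<Gamma> d a s p * T s b c p)) + (SUM d s. y X d p * (\<Gamma> d b s p * T a s c p))
        + (SUM d s. y X d p * (\<Gamma> d c s p * T a b s p))"
      unfolding torsion_components_parallel[OF p] by (simp add: sum_distrib_left distrib_left sum.distrib)
    also have "\<dots> = (SUM s d. y X d p * (\<Gamma> d a s p * T s b c p)) + (SUM s d. y X d p * (\<Gamma> d b s p * T a s c p))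
        + (SUM s d. y X d p * (\<Gamma> d c s p * T a b s p))"
      by (intro arg_cong2[where f = "(+)"] sum.swap)
    finally show ?thesis by (simp add: \<omega>_def sum_distrib_right mult.assoc)
  qed
  have "vf_apply A X (\<lambda>q. \<tau> q [Y0 q, Y1 q, Y2 q]) p =
    vf_apply A X (\<lambda>q. SUM a b c. y Y0 a q * (y Y1 b q * (y Y2 c q * T a b c q))) p"
    by (rule vf_apply_cong[OF V p _ refl]) (simp add: tri y_def)
  also have "\<dots> = (SUM a b c. vf_apply A X (y Y0 a) p * (y Y1 b p * (y Y2 c p * T a b c p))
      + y Y0 a p * (vf_apply A X (y Y1 b) p * (y Y2 c p * T a b c p)
      + y Y1 b p * (vf_apply A X (y Y2 c) p * T a b c p + y Y2 c p * vf_apply A X (T a b c) p)))"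
    using V p by (simp add: vf_apply_sum vf_apply_mult sm_sum sm_mult sy Y sm_T)
  finally have L: "vf_apply A X (\<lambda>q. \<tau> q [Y0 q, Y1 q, Y2 q]) p =
    (SUM a b c. vf_apply A X (y Y0 a) p * (y Y1 b p * (y Y2 c p * T a b c p)))
    + (SUM a b c. y Y0 a p * (vf_apply A X (y Y1 b) p * (y Y2 c p * T a b c p)))
    + (SUM a b c. y Y0 a p * (y Y1 b p * (vf_apply A X (y Y2 c) p * T a b c p)))
    + (SUM a b c s. y Y0 a p * (y Y1 b p * (y Y2 c p * (\<omega> a s * T s b c p))))
    + (SUM a b c s. y Y0 a p * (y Y1 b p * (y Y2 c p * (\<omega> b s * T a s c p))))
    + (SUM a b c s. y Y0 a p * (y Y1 b p * (y Y2 c p * (\<omega> c s * T a b s p))))"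
    unfolding XT by (simp add: distrib_left sum.distrib sum_distrib_left)
  have R0: "\<tau> p [D X Y0 p, Y1 p, Y2 p] =
    (SUM a b c. vf_apply A X (y Y0 a) p * (y Y1 b p * (y Y2 c p * T a b c p)))
    + (SUM a b c s. y Y0 a p * (y Y1 b p * (y Y2 c p * (\<omega> a s * T s b c p))))"
  proof -
    have "\<tau> p [D X Y0 p, Y1 p, Y2 p] = (SUM a b c. vf_apply A X (y Y0 a) p * (y Y1 b p * (y Y2 c p * T a b c p)))
      + (SUM s b c a. y Y0 a p * (y Y1 b p * (y Y2 c p * (\<omega> a s * T s b c p))))"
      unfolding tri[OF p] DXY[OF Y(1)] unfolding y_def[symmetric]
      by (simp add: distrib_right distrib_left sum.distrib sum_distrib_right sum_distrib_left mult_ac)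
    also have "(SUM s b c a. y Y0 a p * (y Y1 b p * (y Y2 c p * (\<omega> a s * T s b c p)))) =
      (SUM a b c s. y Y0 a p * (y Y1 b p * (y Y2 c p * (\<omega> a s * T s b c p))))"
      by (rule sum_swap_14)
    finally show ?thesis .
  qed
  have R1: "\<tau> p [Y0 p, D X Y1 p, Y2 p] =
    (SUM a b c. y Y0 a p * (vf_apply A X (y Y1 b) p * (y Y2 c p * T a b c p)))
    + (SUM a b c s. y Y0 a p * (y Y1 b p * (y Y2 c p * (\<omega> b s * T a s c p))))"
  proof -
    have "\<tau> p [Y0 p, D X Y1 p, Y2 p] = (SUM a b c. y Y0 a p * (vf_apply A X (y Y1 b) p * (y Y2 c p * T a b c p)))
      + (SUM a s c b. y Y0 a p * (y Y1 b p * (y Y2 c p * (\<omega> b s * T a s c p))))"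
      unfolding tri[OF p] DXY[OF Y(2)] unfolding y_def[symmetric]
      by (simp add: distrib_right distrib_left sum.distrib sum_distrib_right sum_distrib_left mult_ac)
    also have "(SUM a s c b. y Y0 a p * (y Y1 b p * (y Y2 c p * (\<omega> b s * T a s c p)))) =
      (SUM a b c s. y Y0 a p * (y Y1 b p * (y Y2 c p * (\<omega> b s * T a s c p))))"
      by (rule sum.cong[OF refl], rule sum_swap_13)
    finally show ?thesis .
  qed
  have R2: "\<tau> p [Y0 p, Y1 p, D X Y2 p] =
    (SUM a b c. y Y0 a p * (y Y1 b p * (vf_apply A X (y Y2 c) p * T a b c p)))
    + (SUM a b c s. y Y0 a p * (y Y1 b p * (y Y2 c p * (\<omega> c s * T a b s p))))"
  proof -
    have "\<tau> p [Y0 p, Y1 p, D X Y2 p] = (SUM a b c. y Y0 a p * (y Y1 b p * (vf_apply A X (y Y2 c) p * T a b c p)))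
      + (SUM a b s c. y Y0 a p * (y Y1 b p * (y Y2 c p * (\<omega> c s * T a b s p))))"
      unfolding tri[OF p] DXY[OF Y(3)] unfolding y_def[symmetric]
      by (simp add: distrib_right distrib_left sum.distrib sum_distrib_right sum_distrib_left mult_ac)
    also have "(SUM a b s c. y Y0 a p * (y Y1 b p * (y Y2 c p * (\<omega> c s * T a b s p)))) =
      (SUM a b c s. y Y0 a p * (y Y1 b p * (y Y2 c p * (\<omega> c s * T a b s p))))"
      by (rule sum.cong[OF refl], rule sum.cong[OF refl], rule sum.swap)
    finally show ?thesis .
  qed
  show ?thesis unfolding L R0 R1 R2 by simp
qed

end

context g2_setup
begin

theorem torsion_parallel: "parallel A D 3 (torsion A g D)"
  unfolding parallel_def
proof (intro allI impI)
  fix X Ys p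
  assume a: "smooth_vf A X \<and> length Ys = 3 \<and> (\<forall>Y\<in>set Ys. smooth_vf A Y)"
  then obtain Y0 Y1 Y2 where Ys: "Ys = [Y0, Y1, Y2]"
    by (auto simp: numeral_3_eq_3 length_Suc_conv)
  have s: "smooth_vf A X" "smooth_vf A Y0" "smooth_vf A Y1" "smooth_vf A Y2" using a Ys by auto
  obtain V e E where f: "p \<in> V" "is_frame V e E" by (rule frame_exists)
  interpret g2_local_frame A D \<phi> g vol \<tau> V e E by unfold_locales (rule f)
  have tors: "torsion A g D [Z0, Z1, Z2] = (\<lambda>q. \<tau> q [Z0 q, Z1 q, Z2 q])"
    if "smooth_vf A Z0" "smooth_vf A Z1" "smooth_vf A Z2" for Z0 Z1 Z2
    using torsion_tau[of "[Z0, Z1, Z2]"] that by (auto simp: on_fields_def)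
  show "cov_deriv A D (torsion A g D) X Ys p = 0"
    using cov_deriv_tau[OF f(1) s] s
    by (simp add: cov_deriv_def Ys numeral_3_eq_3 tors D_smooth)
qed

end

theorem corollary1p3:
  fixes A :: "('m::{t2_space,second_countable_topology}, 7) chart set"
    and \<phi> g vol :: "('m, 7) tensor"
    and D :: "('m, 7) conn"
  assumes "g2_manifold A \<phi>"
    and "induced_metric A \<phi> g"
    and "induced_volume A \<phi> vol"
    and "cocalibrated A \<phi> g vol"
    and "characteristic_connection A \<phi> g D"
    and "g2_instanton A \<phi> g D"
  shows "parallel A D 3 (torsion A g D)"
proof -
  obtain \<tau> where \<tau>: "smooth_form A UNIV 3 \<tau>"
    "\<And>Ys p. length Ys = 3 \<Longrightarrow> (\<forall>Y\<in>set Ys. smooth_vf A Y) \<Longrightarrow> torsion A g D Ys p = on_fields \<tau> Ys p"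
    using assms(5) unfolding characteristic_connection_def by blast
  interpret g2_setup A D \<phi> g vol \<tau>
    by unfold_locales
      (use assms \<tau> in \<open>auto simp: g2_manifold_def characteristic_connection_def\<close>)
  show ?thesis by (rule torsion_parallel)
qed

end
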